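(* Let $(\Omega,\mathcal F,\mu)$ be a probability space, let $(\mathcal E,\mathcal D(\mathcal E))$ be a Dirichlet form on $L^2(\mu)$ with associated Markov semigroup $(P_t)_{t\ge0}$ and generator $(L,\mathcal D(L))$, let $p\in[1,2]$, and let $\alpha:(0,\infty)\to(0,\infty)$. All inequalities are understood for bounded non-negative $f\in\mathcal D(\mathcal E)$. Consider the two properties: (W) for every bounded non-negative $f\in\mathcal D(\mathcal E)$ and every $r>0$, $$\Psi_p(f)\le\alpha(r)\,\mathcal E(f,f)+r\,\mathrm{Osc}(f)^2;$$ (S) for every bounded non-negative non-constant $f\in\mathcal D(\mathcal E)$, every $t\ge0$ and every $s>0$, $$\Psi_p\big((P_tf)^{1/p}\big)-s\,\mathrm{Osc}(f^{1/p})^2\le\exp\!\left(-\frac{2t}{\alpha(s)}\right)\Big[\Psi_p(f^{1/p})-s\,\mathrm{Osc}(f^{1/p})^2\Big].$$ Consider also the two assumptions: (a) $\mathcal E(f^q,f)=\frac{4q}{(1+q)^2}\,\mathcal E\big(f^{(1+q)/2},f^{(1+q)/2}\big)$ for every $q>0$ and every uniformly positive $f\in L^\infty(\mu)\cap\mathcal D(L)$; (b) $P_t$ is symmetric. Then: 1. If (a) holds, then (W) is equivalent to (S). 2. If (b) holds, then (W) implies (S).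
   Context: The Dirichlet form is not assumed to be symmetric except where assumption (b) is invoked; $P_t$ symmetric means symmetric in $L^2(\mu)$. A function $f$ is uniformly positive if $f\ge\delta$ $\mu$-a.e. for some $\delta>0$. For a non-negative $f\in L^2(\mu)$ and $1\le p<2$, with $\mu(g):=\int g\,d\mu$, $$\Psi_p(f):=\frac{\mu(f^2)-\mu(f^p)^{2/p}}{2-p},$$ and $\Psi_2(f):=\tfrac12\mathrm{Ent}_\mu(f^2)$, where $\mathrm{Ent}_\mu(f^2)=\mu(f^2\log f^2)-\mu(f^2)\log\mu(f^2)$ (convention $0\log 0=0$). For bounded $f$, $\mathrm{Osc}(f):=\operatorname{ess\,sup}f-\operatorname{ess\,inf}f$. *)

theory Defs
  imports "HOL-Probability.Probability"
begin

section \<open>The space $L^2(\mu)$, represented by functions\<close>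

text \<open>Elements of $L^2(\mu)$ are represented by square-integrable measurable functions. All sets,
  forms and operators below are compatible with equality almost everywhere.\<close>

definition L2_space :: "'a measure \<Rightarrow> ('a \<Rightarrow> real) set" where
  "L2_space M = {f \<in> borel_measurable M. integrable M (\<lambda>x. (f x)\<^sup>2)}"

definition L2_inner :: "'a measure \<Rightarrow> ('a \<Rightarrow> real) \<Rightarrow> ('a \<Rightarrow> real) \<Rightarrow> real" where
  "L2_inner M f g = (\<integral>x. f x * g x \<partial>M)"

definition L2_norm :: "'a measure \<Rightarrow> ('a \<Rightarrow> real) \<Rightarrow> real" where
  "L2_norm M f = sqrt (L2_inner M f f)"

definition ess_bounded :: "'a measure \<Rightarrow> ('a \<Rightarrow> real) \<Rightarrow> bool" where
  "ess_bounded M f \<longleftrightarrow> (\<exists>C. AE x in M. \<bar>f x\<bar> \<le> C)"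

definition ess_nonneg :: "'a measure \<Rightarrow> ('a \<Rightarrow> real) \<Rightarrow> bool" where
  "ess_nonneg M f \<longleftrightarrow> (AE x in M. 0 \<le> f x)"

definition ess_constant :: "'a measure \<Rightarrow> ('a \<Rightarrow> real) \<Rightarrow> bool" where
  "ess_constant M f \<longleftrightarrow> (\<exists>c. AE x in M. f x = c)"

definition uniformly_positive :: "'a measure \<Rightarrow> ('a \<Rightarrow> real) \<Rightarrow> bool" where
  "uniformly_positive M f \<longleftrightarrow> (\<exists>\<delta>>0. AE x in M. \<delta> \<le> f x)"

definition essinf :: "'a measure \<Rightarrow> ('a \<Rightarrow> ereal) \<Rightarrow> ereal" where
  "essinf M f = - esssup M (\<lambda>x. - f x)"

definition Osc :: "'a measure \<Rightarrow> ('a \<Rightarrow> real) \<Rightarrow> real" where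
  "Osc M f = real_of_ereal (esssup M (\<lambda>x. ereal (f x)) - essinf M (\<lambda>x. ereal (f x)))"

text \<open>The convention $0\log 0=0$ holds automatically.\<close>

definition Ent :: "'a measure \<Rightarrow> ('a \<Rightarrow> real) \<Rightarrow> real" where
  "Ent M g = (\<integral>x. g x * ln (g x) \<partial>M) - (\<integral>x. g x \<partial>M) * ln (\<integral>x. g x \<partial>M)"

definition Psi :: "'a measure \<Rightarrow> real \<Rightarrow> ('a \<Rightarrow> real) \<Rightarrow> real" where
  "Psi M p f =
    (if p = 2 then Ent M (\<lambda>x. (f x)\<^sup>2) / 2
     else ((\<integral>x. (f x)\<^sup>2 \<partial>M) - (\<integral>x. f x powr p \<partial>M) powr (2 / p)) / (2 - p))"


section \<open>Non-symmetric Dirichlet forms\<close>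

definition form1 ::
  "'a measure \<Rightarrow> (('a \<Rightarrow> real) \<Rightarrow> ('a \<Rightarrow> real) \<Rightarrow> real) \<Rightarrow> ('a \<Rightarrow> real) \<Rightarrow> ('a \<Rightarrow> real) \<Rightarrow> real" where
  "form1 M \<E> u v = \<E> u v + L2_inner M u v"

text \<open>Coercive closed forms and Dirichlet forms in the sense of Ma and Roeckner. On the diagonal,
  a form coincides with its symmetric part, so closedness only involves \<open>form1 M \<E> u u\<close>.\<close>

locale coercive_closed_form =
  fixes M :: "'a measure"
    and D :: "('a \<Rightarrow> real) set"
    and \<E> :: "('a \<Rightarrow> real) \<Rightarrow> ('a \<Rightarrow> real) \<Rightarrow> real"
  assumes dom_L2: "D \<subseteq> L2_space M"
    and dom_AE: "\<lbrakk>u \<in> D; v \<in> borel_measurable M; AE x in M. u x = v x\<rbrakk> \<Longrightarrow> v \<in> D"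
    and dom_zero: "(\<lambda>x. 0) \<in> D"
    and dom_add: "\<lbrakk>u \<in> D; v \<in> D\<rbrakk> \<Longrightarrow> (\<lambda>x. u x + v x) \<in> D"
    and dom_scale: "u \<in> D \<Longrightarrow> (\<lambda>x. c * u x) \<in> D"
    and dom_dense: "\<lbrakk>f \<in> L2_space M; 0 < \<epsilon>\<rbrakk> \<Longrightarrow> \<exists>u\<in>D. L2_norm M (\<lambda>x. f x - u x) < \<epsilon>"
    and form_AE: "\<lbrakk>u \<in> D; u' \<in> D; v \<in> D; v' \<in> D; AE x in M. u x = u' x; AE x in M. v x = v' x\<rbrakk>
      \<Longrightarrow> \<E> u v = \<E> u' v'"
    and form_add_left: "\<lbrakk>u \<in> D; v \<in> D; w \<in> D\<rbrakk> \<Longrightarrow> \<E> (\<lambda>x. u x + v x) w = \<E> u w + \<E> v w"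
    and form_add_right: "\<lbrakk>u \<in> D; v \<in> D; w \<in> D\<rbrakk> \<Longrightarrow> \<E> u (\<lambda>x. v x + w x) = \<E> u v + \<E> u w"
    and form_scale_left: "\<lbrakk>u \<in> D; v \<in> D\<rbrakk> \<Longrightarrow> \<E> (\<lambda>x. c * u x) v = c * \<E> u v"
    and form_scale_right: "\<lbrakk>u \<in> D; v \<in> D\<rbrakk> \<Longrightarrow> \<E> u (\<lambda>x. c * v x) = c * \<E> u v"
    and form_nonneg: "u \<in> D \<Longrightarrow> 0 \<le> \<E> u u"
    and weak_sector: "\<exists>K. \<forall>u\<in>D. \<forall>v\<in>D.
      \<bar>form1 M \<E> u v\<bar> \<le> K * sqrt (form1 M \<E> u u) * sqrt (form1 M \<E> v v)"
    and closed: "\<lbrakk>\<And>n. us n \<in> D;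
      \<And>\<epsilon>. 0 < \<epsilon> \<Longrightarrow> \<exists>N. \<forall>m\<ge>N. \<forall>n\<ge>N.
        form1 M \<E> (\<lambda>x. us m x - us n x) (\<lambda>x. us m x - us n x) < \<epsilon>\<rbrakk>
      \<Longrightarrow> \<exists>v\<in>D. (\<lambda>n. form1 M \<E> (\<lambda>x. us n x - v x) (\<lambda>x. us n x - v x)) \<longlonglongrightarrow> 0"

definition unit_contraction :: "('a \<Rightarrow> real) \<Rightarrow> 'a \<Rightarrow> real" where
  "unit_contraction u x = min (max (u x) 0) 1"

locale dirichlet_form = coercive_closed_form +
  assumes unit_contraction_dom: "u \<in> D \<Longrightarrow> unit_contraction u \<in> D"
    and unit_contraction_left: "u \<in> D \<Longrightarrow>
      0 \<le> \<E> (\<lambda>x. u x + unit_contraction u x) (\<lambda>x. u x - unit_contraction u x)"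
    and unit_contraction_right: "u \<in> D \<Longrightarrow>
      0 \<le> \<E> (\<lambda>x. u x - unit_contraction u x) (\<lambda>x. u x + unit_contraction u x)"


section \<open>Markov semigroups and their generators\<close>

text \<open>Strongly continuous, positivity preserving contraction semigroups on $L^2(\mu)$ that preserve
  the constant function 1. Compatibility with equality almost everywhere follows from linearity
  and contractivity; the values of \<open>P t\<close> for negative \<open>t\<close> are irrelevant.\<close>

locale markov_semigroup =
  fixes M :: "'a measure"
    and P :: "real \<Rightarrow> ('a \<Rightarrow> real) \<Rightarrow> 'a \<Rightarrow> real"
  assumes P_L2: "\<lbrakk>0 \<le> t; f \<in> L2_space M\<rbrakk> \<Longrightarrow> P t f \<in> L2_space M"
    and P_add: "\<lbrakk>0 \<le> t; f \<in> L2_space M; g \<in> L2_space M\<rbrakk>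
      \<Longrightarrow> AE x in M. P t (\<lambda>y. f y + g y) x = P t f x + P t g x"
    and P_scale: "\<lbrakk>0 \<le> t; f \<in> L2_space M\<rbrakk> \<Longrightarrow> AE x in M. P t (\<lambda>y. c * f y) x = c * P t f x"
    and P_contraction: "\<lbrakk>0 \<le> t; f \<in> L2_space M\<rbrakk> \<Longrightarrow> L2_norm M (P t f) \<le> L2_norm M f"
    and P_zero: "f \<in> L2_space M \<Longrightarrow> AE x in M. P 0 f x = f x"
    and P_semigroup: "\<lbrakk>0 \<le> s; 0 \<le> t; f \<in> L2_space M\<rbrakk> \<Longrightarrow> AE x in M. P (s + t) f x = P s (P t f) x"
    and P_continuous: "f \<in> L2_space M
      \<Longrightarrow> ((\<lambda>t. L2_norm M (\<lambda>x. P t f x - f x)) \<longlongrightarrow> 0) (at_right 0)"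
    and P_nonneg: "\<lbrakk>0 \<le> t; f \<in> L2_space M; AE x in M. 0 \<le> f x\<rbrakk> \<Longrightarrow> AE x in M. 0 \<le> P t f x"
    and P_one: "0 \<le> t \<Longrightarrow> AE x in M. P t (\<lambda>y. 1) x = 1"

definition symmetric_semigroup ::
  "'a measure \<Rightarrow> (real \<Rightarrow> ('a \<Rightarrow> real) \<Rightarrow> 'a \<Rightarrow> real) \<Rightarrow> bool" where
  "symmetric_semigroup M P \<longleftrightarrow>
    (\<forall>t\<ge>0. \<forall>f\<in>L2_space M. \<forall>g\<in>L2_space M. L2_inner M (P t f) g = L2_inner M f (P t g))"

text \<open>The graph of the generator: $f\in\mathcal D(L)$ and $Lf=g$ almost everywhere.\<close>

definition generates ::
  "'a measure \<Rightarrow> (real \<Rightarrow> ('a \<Rightarrow> real) \<Rightarrow> 'a \<Rightarrow> real) \<Rightarrow> ('a \<Rightarrow> real) \<Rightarrow> ('a \<Rightarrow> real) \<Rightarrow> bool" where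
  "generates M P f g \<longleftrightarrow> f \<in> L2_space M \<and> g \<in> L2_space M \<and>
    ((\<lambda>t. L2_norm M (\<lambda>x. (P t f x - f x) / t - g x)) \<longlongrightarrow> 0) (at_right 0)"

definition generator_domain ::
  "'a measure \<Rightarrow> (real \<Rightarrow> ('a \<Rightarrow> real) \<Rightarrow> 'a \<Rightarrow> real) \<Rightarrow> ('a \<Rightarrow> real) set" where
  "generator_domain M P = {f. \<exists>g. generates M P f g}"

text \<open>The form and the semigroup are associated if the generator of the semigroup is the operator
  $L$ defined by the form through $\mathcal E(v,f)=-\mu(v\,Lf)$ for all $v\in\mathcal D(\mathcal E)$.
  For non-symmetric forms the order of the arguments matters: the function in the domain of
  the generator is the second one.\<close>

definition associated ::
  "'a measure \<Rightarrow> ('a \<Rightarrow> real) set \<Rightarrow> (('a \<Rightarrow> real) \<Rightarrow> ('a \<Rightarrow> real) \<Rightarrow> real)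
    \<Rightarrow> (real \<Rightarrow> ('a \<Rightarrow> real) \<Rightarrow> 'a \<Rightarrow> real) \<Rightarrow> bool" where
  "associated M D \<E> P \<longleftrightarrow> (\<forall>f g. generates M P f g \<longleftrightarrow>
    f \<in> D \<and> g \<in> L2_space M \<and> (\<forall>v\<in>D. \<E> v f = - L2_inner M v g))"


section \<open>The functional inequalities\<close>

definition weak_inequality ::
  "'a measure \<Rightarrow> ('a \<Rightarrow> real) set \<Rightarrow> (('a \<Rightarrow> real) \<Rightarrow> ('a \<Rightarrow> real) \<Rightarrow> real)
    \<Rightarrow> real \<Rightarrow> (real \<Rightarrow> real) \<Rightarrow> bool" where
  "weak_inequality M D \<E> p \<alpha> \<longleftrightarrow>
    (\<forall>f\<in>D. ess_bounded M f \<longrightarrow> ess_nonneg M f \<longrightarrow>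
      (\<forall>r>0. Psi M p f \<le> \<alpha> r * \<E> f f + r * (Osc M f)\<^sup>2))"

definition semigroup_decay ::
  "'a measure \<Rightarrow> ('a \<Rightarrow> real) set \<Rightarrow> (real \<Rightarrow> ('a \<Rightarrow> real) \<Rightarrow> 'a \<Rightarrow> real)
    \<Rightarrow> real \<Rightarrow> (real \<Rightarrow> real) \<Rightarrow> bool" where
  "semigroup_decay M D P p \<alpha> \<longleftrightarrow>
    (\<forall>f\<in>D. ess_bounded M f \<longrightarrow> ess_nonneg M f \<longrightarrow> \<not> ess_constant M f \<longrightarrow>
      (\<forall>t\<ge>0. \<forall>s>0.
        Psi M p (\<lambda>x. P t f x powr (1 / p)) - s * (Osc M (\<lambda>x. f x powr (1 / p)))\<^sup>2
        \<le> exp (- (2 * t / \<alpha> s)) *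
            (Psi M p (\<lambda>x. f x powr (1 / p)) - s * (Osc M (\<lambda>x. f x powr (1 / p)))\<^sup>2)))"

definition power_identity ::
  "'a measure \<Rightarrow> (('a \<Rightarrow> real) \<Rightarrow> ('a \<Rightarrow> real) \<Rightarrow> real)
    \<Rightarrow> (real \<Rightarrow> ('a \<Rightarrow> real) \<Rightarrow> 'a \<Rightarrow> real) \<Rightarrow> bool" where
  "power_identity M \<E> P \<longleftrightarrow>
    (\<forall>q>0. \<forall>f\<in>generator_domain M P. ess_bounded M f \<longrightarrow> uniformly_positive M f \<longrightarrow>
      \<E> (\<lambda>x. f x powr q) f =
        4 * q / (1 + q)\<^sup>2 *
          \<E> (\<lambda>x. f x powr ((1 + q) / 2)) (\<lambda>x. f x powr ((1 + q) / 2)))"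

end

theory Submission
  imports Defs
begin

text \<open>\<^bold>\<open>Dissipation of entropy.\<close> Put \<open>\<Phi>(x) = x powr (2/p) / (2 - p)\<close>, or \<open>x ln x / 2\<close> for \<open>p = 2\<close>. Then
  \<open>\<Psi>\<^sub>p(F powr (1/p)) = \<mu>(\<Phi>(F)) - \<Phi>(\<mu>(F))\<close>. The semigroup preserves means, so for \<open>F\<^sub>t = P\<^sub>t G\<close> with \<open>G\<close> in
  the domain of the generator and \<open>G\<close> bounded and uniformly positive,
  \<open>d/dt \<Psi>\<^sub>p(F\<^sub>t powr (1/p)) = - \<E>(\<Phi>'(F\<^sub>t), F\<^sub>t)\<close>. For \<open>p < 2\<close> the function \<open>\<Phi>'\<close> is a multiple of the power with exponent
  \<open>q = 2/p - 1\<close>, and the power identity turns the right-hand side into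
  \<open>- 2 \<E>(F\<^sub>t powr (1/p), F\<^sub>t powr (1/p))\<close>; for \<open>p = 2\<close> it does so by a limit \<open>q \<rightarrow> 0\<close>, because
  \<open>(F powr q - 1) / q\<close> tends to \<open>ln F\<close>. For a symmetric semigroup the right-hand side is at most this
  number, because \<open>(\<Phi>'(s) - \<Phi>'(t)) (s - t) \<ge> 2 (s powr (1/p) - t powr (1/p))\<^sup>2\<close>. Hence the weak inequality,
  applied to \<open>F\<^sub>t powr (1/p)\<close>, gives a differential inequality that integrates to the decay
  (\<open>weak_inequality_decay_generator\<close>), and the decay, differentiated at time 0, gives the weak inequality
  for \<open>G powr (1/p)\<close> (\<open>decay_imp_inequality_generator\<close>). Markov operators do not enlarge the range of a
  function, so oscillations do not grow along the way.

  \<^bold>\<open>Approximation.\<close> A general \<open>f\<close> is replaced by \<open>R f\<close> with \<open>R\<close> a normalised resolvent, which is obtained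
  from the form by the Lax--Milgram theorem and is Markov because the form is a Dirichlet form. The decay
  involves only integrals of functions of \<open>f\<close>, so there convergence in \<open>L\<^sup>2\<close> suffices. For the converse
  the energies of \<open>(R f\<^sup>p) powr (1/p)\<close> have to converge to the energy of \<open>f\<close>: smooth functions have to act
  \<^emph>\<open>continuously\<close> on the form domain (\<open>form_compose_tendsto\<close>). The power identity is assumed on the
  domain of the generator only, and lower semicontinuity of the energy gives the wrong inequality.

  \<^bold>\<open>Pointwise inequalities.\<close> Energies are limits of \<open>\<beta> \<mu>(f (f - R f))\<close>. If \<open>R\<close> were given by a kernel,
  this would be an integral of \<open>(f(x) - f(y))\<^sup>2\<close>, and inequalities between such integrands would carry over
  to energies. This holds without a kernel (\<open>kernel_positivity\<close>): if
  \<open>\<Sum>\<^sub>i a\<^sub>i(x) b\<^sub>i(y) \<ge> 0\<close> for all \<open>x\<close> and \<open>y\<close>, then \<open>\<Sum>\<^sub>i \<mu>(a\<^sub>i R b\<^sub>i) \<ge> 0\<close>. It yields the contraction property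
  for Lipschitz functions, the inequality for symmetric semigroups, and an estimate of
  \<open>\<phi>(u + w) - \<phi>(u)\<close> in energy by the energy of \<open>w\<close> and the integral of \<open>w\<^sup>2\<close> against the energy measure
  of \<open>u\<close>. The last quantity is \<open>2 \<E>(w\<^sup>2 u, u) - \<E>(w\<^sup>2, u\<^sup>2)\<close> up to a factor, which tends to 0 with \<open>w\<close> by
  weak convergence.\<close>

section \<open>Lax--Milgram and near-minimisers in a space of functions\<close>

text \<open>The inner product may be degenerate, because functions that agree almost everywhere are not identified.
  The two instances are \<open>L\<^sup>2(\<mu>)\<close> and the domain of the form.\<close>

locale semi_inner_space =
  fixes V :: "('a \<Rightarrow> real) set"
    and B :: "('a \<Rightarrow> real) \<Rightarrow> ('a \<Rightarrow> real) \<Rightarrow> real"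
  assumes V_zero: "(\<lambda>x. 0) \<in> V"
    and V_comb: "\<lbrakk>u \<in> V; v \<in> V\<rbrakk> \<Longrightarrow> (\<lambda>x. a * u x + b * v x) \<in> V"
    and B_comb_left: "\<lbrakk>u \<in> V; v \<in> V; w \<in> V\<rbrakk>
      \<Longrightarrow> B (\<lambda>x. a * u x + b * v x) w = a * B u w + b * B v w"
    and B_commute: "\<lbrakk>u \<in> V; v \<in> V\<rbrakk> \<Longrightarrow> B u v = B v u"
    and B_nonneg: "u \<in> V \<Longrightarrow> 0 \<le> B u u"
begin

definition nrm :: "('a \<Rightarrow> real) \<Rightarrow> real" where "nrm u = sqrt (B u u)"

lemma V_add: "\<lbrakk>u \<in> V; v \<in> V\<rbrakk> \<Longrightarrow> (\<lambda>x. u x + v x) \<in> V"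
  using V_comb[of u v 1 1] by simp

lemma V_diff: "\<lbrakk>u \<in> V; v \<in> V\<rbrakk> \<Longrightarrow> (\<lambda>x. u x - v x) \<in> V"
  using V_comb[of u v 1 "-1"] by simp

lemma V_scale: "u \<in> V \<Longrightarrow> (\<lambda>x. c * u x) \<in> V"
  using V_comb[of u u c 0] by simp

lemma B_comb_right: "\<lbrakk>u \<in> V; v \<in> V; w \<in> V\<rbrakk>
    \<Longrightarrow> B w (\<lambda>x. a * u x + b * v x) = a * B w u + b * B w v"
  using B_comb_left[of u v w a b] B_commute V_comb by metis

lemma B_diff_left: "\<lbrakk>u \<in> V; v \<in> V; w \<in> V\<rbrakk> \<Longrightarrow> B (\<lambda>x. u x - v x) w = B u w - B v w"
  using B_comb_left[of u v w 1 "-1"] by simp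

lemma B_scale_left: "\<lbrakk>u \<in> V; w \<in> V\<rbrakk> \<Longrightarrow> B (\<lambda>x. c * u x) w = c * B u w"
  using B_comb_left[of u u w c 0] by simp

lemma B_diff_right: "\<lbrakk>u \<in> V; v \<in> V; w \<in> V\<rbrakk> \<Longrightarrow> B w (\<lambda>x. u x - v x) = B w u - B w v"
  using B_comb_right[of u v w 1 "-1"] by simp

lemma B_scale_right: "\<lbrakk>u \<in> V; w \<in> V\<rbrakk> \<Longrightarrow> B w (\<lambda>x. c * u x) = c * B w u"
  using B_comb_right[of u u w c 0] by simp

lemma B_square_comb: "\<lbrakk>u \<in> V; v \<in> V\<rbrakk> \<Longrightarrow>
    B (\<lambda>x. a * u x + b * v x) (\<lambda>x. a * u x + b * v x)
      = a\<^sup>2 * B u u + 2 * a * b * B u v + b\<^sup>2 * B v v"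
  using B_comb_left[of u v "\<lambda>x. a * u x + b * v x" a b] V_comb[of u v a b]
    B_comb_right[of u v u a b] B_comb_right[of u v v a b] B_commute[of u v]
  by (simp add: algebra_simps power2_eq_square)

lemma nrm_nonneg [simp]: "u \<in> V \<Longrightarrow> 0 \<le> nrm u"
  by (simp add: nrm_def B_nonneg)

lemma nrm_square: "u \<in> V \<Longrightarrow> (nrm u)\<^sup>2 = B u u"
  by (simp add: nrm_def B_nonneg)

text \<open>If \<open>B v v\<close> vanishes, then the quadratic \<open>t \<mapsto> B (u + t v) (u + t v)\<close> is affine; being bounded below it
  is constant, so \<open>B u v\<close> vanishes too.\<close>

lemma cauchy_schwarz: assumes "u \<in> V" "v \<in> V" shows "\<bar>B u v\<bar> \<le> nrm u * nrm v"
proof -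
  have nn: "0 \<le> B u u + 2 * t * B u v + t\<^sup>2 * B v v" for t
    using B_nonneg[OF V_comb[OF assms, of 1 t]] B_square_comb[OF assms, of 1 t] by simp
  have "(B u v)\<^sup>2 \<le> B u u * B v v"
  proof (cases "B v v = 0")
    case True
    have "B u v = 0"
    proof (rule ccontr)
      assume a: "B u v \<noteq> 0"
      have "0 \<le> B u u + 2 * (- (B u u + 1) / (2 * B u v)) * B u v"
        using nn[of "- (B u u + 1) / (2 * B u v)"] True by simp
      then show False using a B_nonneg[OF assms(1)] by (simp add: field_simps)
    qed
    then show ?thesis using True by simp
  next
    case False
    then have pos: "0 < B v v" using B_nonneg[OF assms(2)] by simp
    have "0 \<le> B u u - (B u v)\<^sup>2 / B v v"
      using nn[of "- B u v / B v v"] False by (simp add: field_simps power2_eq_square)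
    then show ?thesis using pos by (simp add: field_simps)
  qed
  then have "(B u v)\<^sup>2 \<le> (nrm u * nrm v)\<^sup>2"
    using assms by (simp add: power_mult_distrib nrm_square)
  then show ?thesis using assms by (metis abs_le_square_iff abs_of_nonneg mult_nonneg_nonneg nrm_nonneg)
qed

lemma nrm_triangle: assumes "u \<in> V" "v \<in> V" shows "nrm (\<lambda>x. u x + v x) \<le> nrm u + nrm v"
proof -
  have "B (\<lambda>x. u x + v x) (\<lambda>x. u x + v x) = B u u + 2 * B u v + B v v"
    using B_square_comb[OF assms, of 1 1] by simp
  also have "\<dots> \<le> (nrm u + nrm v)\<^sup>2"
    using cauchy_schwarz[OF assms] assms by (simp add: power2_sum nrm_square)
  finally have "(nrm (\<lambda>x. u x + v x))\<^sup>2 \<le> (nrm u + nrm v)\<^sup>2"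
    by (simp add: nrm_square V_add assms)
  then show ?thesis by (rule power2_le_imp_le) (use assms in simp)
qed

lemma nrm_scale: "u \<in> V \<Longrightarrow> nrm (\<lambda>x. c * u x) = \<bar>c\<bar> * nrm u"
  by (simp add: nrm_def B_scale_left B_scale_right V_scale real_sqrt_mult)

lemma nrm_zero [simp]: "nrm (\<lambda>x. 0) = 0"
  using nrm_scale[OF V_zero, of 0] by simp

lemma nrm_minus_commute: assumes "u \<in> V" "v \<in> V" shows "nrm (\<lambda>x. u x - v x) = nrm (\<lambda>x. v x - u x)"
  using nrm_scale[OF V_diff[OF assms], of "-1"] by simp

lemma nrm_diff_triangle: assumes "u \<in> V" "v \<in> V" "w \<in> V"
  shows "nrm (\<lambda>x. u x - w x) \<le> nrm (\<lambda>x. u x - v x) + nrm (\<lambda>x. v x - w x)"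
  using nrm_triangle[OF V_diff[OF assms(1,2)] V_diff[OF assms(2,3)]] by simp

lemma nrm_reverse_triangle: assumes "u \<in> V" "v \<in> V"
  shows "\<bar>nrm u - nrm v\<bar> \<le> nrm (\<lambda>x. u x - v x)"
  using nrm_triangle[OF V_diff[OF assms] assms(2)] nrm_triangle[OF V_diff[OF assms(2,1)] assms(1)]
    nrm_minus_commute[OF assms] by simp

lemma nrm_tendsto: assumes "\<And>n. us n \<in> V" "w \<in> V" "(\<lambda>n. nrm (\<lambda>x. us n x - w x)) \<longlonglongrightarrow> 0"
  shows "(\<lambda>n. nrm (us n)) \<longlonglongrightarrow> nrm w"
proof -
  have "(\<lambda>n. nrm (us n) - nrm w) \<longlonglongrightarrow> 0"
    by (rule Lim_null_comparison[OF _ assms(3)]) (use nrm_reverse_triangle[OF assms(1,2)] in simp)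
  then show ?thesis by (simp add: LIM_zero_iff)
qed

lemma B_tendsto: assumes "\<And>n. us n \<in> V" "w \<in> V" "v \<in> V" "(\<lambda>n. nrm (\<lambda>x. us n x - w x)) \<longlonglongrightarrow> 0"
  shows "(\<lambda>n. B v (us n)) \<longlonglongrightarrow> B v w"
proof -
  have "(\<lambda>n. B v (us n) - B v w) \<longlonglongrightarrow> 0"
  proof (rule Lim_null_comparison[where g="\<lambda>n. nrm v * nrm (\<lambda>x. us n x - w x)"])
    show "\<forall>\<^sub>F n in sequentially. norm (B v (us n) - B v w) \<le> nrm v * nrm (\<lambda>x. us n x - w x)"
      using cauchy_schwarz[OF assms(3) V_diff[OF assms(1,2)]] by (simp add: B_diff_right assms)
  qed (use tendsto_mult_right_zero[OF assms(4)] in simp)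
  then show ?thesis by (simp add: LIM_zero_iff)
qed

lemma parallelogram: assumes "u \<in> V" "v \<in> V"
  shows "B (\<lambda>x. 1/2 * u x + 1/2 * v x) (\<lambda>x. 1/2 * u x + 1/2 * v x)
     = (B u u + B v v) / 2 - B (\<lambda>x. u x - v x) (\<lambda>x. u x - v x) / 4"
  using B_square_comb[OF assms, of "1/2" "1/2"] B_square_comb[OF assms, of 1 "-1"]
  by (simp add: power2_eq_square field_simps)

end

locale complete_semi_inner_space = semi_inner_space +
  assumes complete: "\<lbrakk>\<And>n. us n \<in> V;
      \<And>\<epsilon>. 0 < \<epsilon> \<Longrightarrow> \<exists>N. \<forall>m\<ge>N. \<forall>n\<ge>N. B (\<lambda>x. us m x - us n x) (\<lambda>x. us m x - us n x) < \<epsilon>\<rbrakk>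
      \<Longrightarrow> \<exists>v\<in>V. (\<lambda>n. B (\<lambda>x. us n x - v x) (\<lambda>x. us n x - v x)) \<longlonglongrightarrow> 0"
begin

lemma complete_nrm:
  assumes "\<And>n. us n \<in> V"
    and "\<And>\<epsilon>. 0 < \<epsilon> \<Longrightarrow> \<exists>N. \<forall>m\<ge>N. \<forall>n\<ge>N. B (\<lambda>x. us m x - us n x) (\<lambda>x. us m x - us n x) < \<epsilon>"
  obtains w where "w \<in> V" "(\<lambda>n. nrm (\<lambda>x. us n x - w x)) \<longlonglongrightarrow> 0"
proof -
  obtain w where "w \<in> V" and "(\<lambda>n. B (\<lambda>x. us n x - w x) (\<lambda>x. us n x - w x)) \<longlonglongrightarrow> 0"
    using complete[OF assms] by blast
  then have "(\<lambda>n. nrm (\<lambda>x. us n x - w x)) \<longlonglongrightarrow> sqrt 0"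
    unfolding nrm_def by (intro tendsto_real_sqrt)
  with \<open>w \<in> V\<close> show ?thesis using that by simp
qed

text \<open>The midpoint of \<open>us m\<close> and \<open>us n\<close> lies in the larger of the two sets, so its value is at least the
  infimum there. The infima increase to a finite limit, and uniform convexity of \<open>J\<close> turns this into a
  Cauchy estimate. With constant sets this produces minimisers; with shrinking sets it extracts a strong
  limit from a bounded sequence without any weak compactness.\<close>

lemma near_minimisers_converge:
  fixes C :: "nat \<Rightarrow> ('a \<Rightarrow> real) set" and J :: "('a \<Rightarrow> real) \<Rightarrow> real"
  assumes CV: "\<And>n. C n \<subseteq> V" and dec: "\<And>n m. n \<le> m \<Longrightarrow> C m \<subseteq> C n"
    and mid: "\<And>n u v. \<lbrakk>u \<in> C n; v \<in> C n\<rbrakk> \<Longrightarrow> (\<lambda>x. 1/2 * u x + 1/2 * v x) \<in> C n"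
    and \<kappa>: "0 < \<kappa>"
    and J: "\<And>u v. \<lbrakk>u \<in> C 0; v \<in> C 0\<rbrakk> \<Longrightarrow> \<kappa> * B (\<lambda>x. u x - v x) (\<lambda>x. u x - v x)
              \<le> J u + J v - 2 * J (\<lambda>x. 1/2 * u x + 1/2 * v x)"
    and low: "\<And>u. u \<in> C 0 \<Longrightarrow> b \<le> J u" and up: "\<And>n. \<exists>u\<in>C n. J u \<le> K"
  obtains us w where "w \<in> V" "\<And>n. us n \<in> C n" "(\<lambda>n. nrm (\<lambda>x. us n x - w x)) \<longlonglongrightarrow> 0"
    "\<And>n. J (us n) \<le> Inf (J ` C n) + 1 / (real n + 1)"
proof -
  define d where "d n = Inf (J ` C n)" for n
  have C0: "u \<in> C n \<Longrightarrow> u \<in> C 0" for u n using dec[of 0 n] by auto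
  have bdd: "bdd_below (J ` C n)" for n by (rule bdd_belowI2[where m=b]) (use low C0 in auto)
  have ne: "J ` C n \<noteq> {}" for n using up[of n] by auto
  have d_le: "u \<in> C n \<Longrightarrow> d n \<le> J u" for u n
    unfolding d_def by (rule cInf_lower) (use bdd in auto)
  have dK: "d n \<le> K" for n using up[of n] d_le[of _ n] by force
  have dmono: "d n \<le> d m" if "n \<le> m" for n m
    unfolding d_def using cInf_superset_mono[OF ne bdd image_mono[OF dec[OF that]]] .
  have "\<exists>u\<in>C n. J u < d n + 1 / (real n + 1)" for n
    using cInf_lessD[OF ne, of n "d n + 1 / (real n + 1)"] unfolding d_def by auto
  then obtain us where us: "\<And>n. us n \<in> C n" "\<And>n. J (us n) < d n + 1 / (real n + 1)" by metis
  have "incseq d" using dmono by (simp add: incseq_def)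
  then obtain l where "d \<longlonglongrightarrow> l" using incseq_convergent[of d K] dK by blast
  then have cau: "Cauchy d" by (rule LIMSEQ_imp_Cauchy)
  have "\<exists>N. \<forall>m\<ge>N. \<forall>n\<ge>N. B (\<lambda>x. us m x - us n x) (\<lambda>x. us m x - us n x) < \<epsilon>" if "0 < \<epsilon>" for \<epsilon>
  proof -
    define e where "e = \<kappa> * \<epsilon> / 4"
    have e: "0 < e" using that \<kappa> by (simp add: e_def)
    obtain N1 where N1: "\<And>m n. \<lbrakk>N1 \<le> m; N1 \<le> n\<rbrakk> \<Longrightarrow> \<bar>d m - d n\<bar> < e"
      using CauchyD[OF cau e] by auto
    obtain N2 :: nat where N2: "1 / (real N2 + 1) < e"
      using reals_Archimedean[OF e] by (auto simp: inverse_eq_divide add.commute)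
    have small: "1 / (real n + 1) < e" if "N2 \<le> n" for n
      using N2 that by (smt (verit) frac_le of_nat_0_le_iff of_nat_mono)
    have "B (\<lambda>x. us m x - us n x) (\<lambda>x. us m x - us n x) < \<epsilon>" if "max N1 N2 \<le> m" "max N1 N2 \<le> n" for m n
    proof -
      have "us m \<in> C (min m n)" "us n \<in> C (min m n)" using us(1) dec by (meson min.cobounded1 min.cobounded2 subsetD)+
      then have "d (min m n) \<le> J (\<lambda>x. 1/2 * us m x + 1/2 * us n x)" by (intro d_le mid)
      then have "\<kappa> * B (\<lambda>x. us m x - us n x) (\<lambda>x. us m x - us n x)
          \<le> d m + 1 / (real m + 1) + (d n + 1 / (real n + 1)) - 2 * d (min m n)"
        using J[OF C0[OF us(1)] C0[OF us(1)], of m n] us(2)[of m] us(2)[of n] by linarith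
      also have "\<dots> < 4 * e"
        using small[of m] small[of n] N1[of m n] that by (auto simp: min_def split: if_splits)
      finally show ?thesis using \<kappa> by (simp add: e_def)
    qed
    then show ?thesis by blast
  qed
  moreover have "us n \<in> V" for n using us(1) CV by blast
  ultimately obtain w where w: "w \<in> V" "(\<lambda>n. nrm (\<lambda>x. us n x - w x)) \<longlonglongrightarrow> 0"
    using complete_nrm[of us] by blast
  show ?thesis by (rule that[OF w(1) us(1) w(2)]) (use us(2) less_imp_le d_def in auto)
qed

text \<open>The representing vector minimises \<open>u \<mapsto> B u u / 2 - F u\<close>.\<close>

lemma riesz:
  assumes F: "\<And>a b u v. \<lbrakk>u \<in> V; v \<in> V\<rbrakk> \<Longrightarrow> F (\<lambda>x. a * u x + b * v x) = a * F u + b * F v"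
    and c: "\<And>v. v \<in> V \<Longrightarrow> \<bar>F v\<bar> \<le> c * nrm v"
  obtains g where "g \<in> V" "\<And>v. v \<in> V \<Longrightarrow> B v g = F v"
proof -
  define J where "J u = B u u / 2 - F u" for u
  have J_low: "- (c\<^sup>2 / 2) \<le> J u" if "u \<in> V" for u
  proof -
    have "0 \<le> (nrm u - c)\<^sup>2" by simp
    then show ?thesis unfolding J_def using c[OF that] nrm_square[OF that]
      by (auto simp: power2_diff algebra_simps)
  qed
  have J_mid: "1/4 * B (\<lambda>x. u x - v x) (\<lambda>x. u x - v x) \<le> J u + J v - 2 * J (\<lambda>x. 1/2 * u x + 1/2 * v x)"
    if "u \<in> V" "v \<in> V" for u v
    using F[OF that, of "1/2" "1/2"] parallelogram[OF that] unfolding J_def by argo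
  have F0: "J (\<lambda>x. 0) \<le> 0"
    using c[OF V_zero] B_nonneg[OF V_zero] nrm_square[OF V_zero] by (simp add: J_def)
  obtain us w where w: "w \<in> V" "\<And>n. us n \<in> V" "(\<lambda>n. nrm (\<lambda>x. us n x - w x)) \<longlonglongrightarrow> 0"
    and inf: "\<And>n. J (us n) \<le> Inf (J ` V) + 1 / (real n + 1)"
  proof (rule near_minimisers_converge[of "\<lambda>n. V" "1/4" J "- (c\<^sup>2 / 2)" 0])
    show "\<exists>u\<in>V. J u \<le> 0" using F0 V_zero by blast
  next
    fix us' w'
    assume "w' \<in> V" "\<And>n. us' n \<in> V" "(\<lambda>n. nrm (\<lambda>x. us' n x - w' x)) \<longlonglongrightarrow> 0"
      "\<And>n. J (us' n) \<le> Inf (J ` V) + 1 / (real n + 1)"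
    then show thesis by (rule that)
  qed (rule order_refl V_comb J_mid J_low | assumption | simp)+
  have "(\<lambda>n. F (us n) - F w) \<longlonglongrightarrow> 0"
  proof (rule Lim_null_comparison[where g="\<lambda>n. c * nrm (\<lambda>x. us n x - w x)"])
    show "\<forall>\<^sub>F n in sequentially. norm (F (us n) - F w) \<le> c * nrm (\<lambda>x. us n x - w x)"
      using c[OF V_diff[OF w(2,1)]] F[OF w(2,1), where a=1 and b="-1"] by simp
  qed (use tendsto_mult_right_zero[OF w(3)] in simp)
  then have Fl: "(\<lambda>n. F (us n)) \<longlonglongrightarrow> F w" by (simp add: LIM_zero_iff)
  have "(\<lambda>n. (nrm (us n))\<^sup>2 / 2 - F (us n)) \<longlonglongrightarrow> (nrm w)\<^sup>2 / 2 - F w"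
    by (intro tendsto_intros Fl nrm_tendsto w) simp
  then have Jl: "(\<lambda>n. J (us n)) \<longlonglongrightarrow> J w" using w by (simp add: J_def nrm_square)
  have "J w \<le> Inf (J ` V)"
  proof (rule LIMSEQ_le[OF Jl])
    show "(\<lambda>n. Inf (J ` V) + 1 / (real n + 1)) \<longlonglongrightarrow> Inf (J ` V)"
      using tendsto_add[OF tendsto_const[of "Inf (J ` V)"] LIMSEQ_inverse_real_of_nat]
      by (simp add: inverse_eq_divide add.commute)
  qed (use inf in blast)
  then have min: "J w \<le> J v" if "v \<in> V" for v
    using that cInf_lower[of "J v" "J ` V"] J_low by (force intro: bdd_belowI2)
  have "B v w = F v" if v: "v \<in> V" for v
  proof (rule ccontr)
    assume ne: "B v w \<noteq> F v"
    define s where "s = B v w - F v"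
    have ineq: "0 \<le> t * s + t\<^sup>2 / 2 * B v v" for t
      using min[OF V_comb[OF w(1) v, of 1 t]] B_square_comb[OF w(1) v, of 1 t] F[OF w(1) v, of 1 t]
        B_commute[OF w(1) v]
      unfolding J_def s_def by (simp add: algebra_simps)
    (* The 1 keeps the step finite when v has length zero. *)
    define t where "t = - s / (B v v + 1)"
    have p: "0 < B v v + 1" using B_nonneg[OF v] by simp
    have s2: "0 < s\<^sup>2" using ne by (simp add: s_def)
    have tk: "t * (B v v + 1) = - s" using p by (simp add: t_def)
    have "t * s + t\<^sup>2 / 2 * B v v \<le> t * s + t * (t * (B v v + 1)) / 2"
      by (simp add: power2_eq_square algebra_simps)
    also have "\<dots> = t * s / 2" unfolding tk by simp
    also have "\<dots> < 0" using s2 p by (simp add: t_def power2_eq_square zero_less_divide_iff)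
    finally show False using ineq[of t] by simp
  qed
  then show ?thesis using that w(1) by blast
qed

text \<open>The solution is the fixed point of \<open>u \<mapsto> u - \<rho> (T u - f)\<close>, where \<open>T u\<close> and \<open>f\<close> represent \<open>\<lambda>v. A v u\<close> and
  \<open>F\<close> in the sense of Riesz; since \<open>A\<close> is bounded and coercive, this map is a contraction for small \<open>\<rho>\<close>.\<close>

lemma lax_milgram:
  assumes A_left: "\<And>a b u v w. \<lbrakk>u \<in> V; v \<in> V; w \<in> V\<rbrakk>
        \<Longrightarrow> A (\<lambda>x. a * u x + b * v x) w = a * A u w + b * A v w"
    and A_right: "\<And>a b u v w. \<lbrakk>u \<in> V; v \<in> V; w \<in> V\<rbrakk>
        \<Longrightarrow> A w (\<lambda>x. a * u x + b * v x) = a * A w u + b * A w v"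
    and A_bound: "\<And>u v. \<lbrakk>u \<in> V; v \<in> V\<rbrakk> \<Longrightarrow> \<bar>A v u\<bar> \<le> K * nrm v * nrm u"
    and A_coercive: "\<And>u. u \<in> V \<Longrightarrow> B u u \<le> A u u"
    and F: "\<And>a b u v. \<lbrakk>u \<in> V; v \<in> V\<rbrakk> \<Longrightarrow> F (\<lambda>x. a * u x + b * v x) = a * F u + b * F v"
    and c: "\<And>v. v \<in> V \<Longrightarrow> \<bar>F v\<bar> \<le> c * nrm v"
  obtains u where "u \<in> V" "\<And>v. v \<in> V \<Longrightarrow> A v u = F v"
proof -
  define L where "L = max K 1"
  have L: "1 \<le> L" "K \<le> L" by (auto simp: L_def)
  have A_L: "\<bar>A v u\<bar> \<le> L * nrm v * nrm u" if "u \<in> V" "v \<in> V" for u v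
    using A_bound[OF that] mult_right_mono[OF L(2), of "nrm v * nrm u"] that by (simp add: mult.assoc)
  (* This minimises the squared contraction factor 1 - 2 \<rho> + \<rho>^2 L^2. *)
  define \<rho> where "\<rho> = 1 / L\<^sup>2"
  have \<rho>: "0 < \<rho>" "\<rho> \<le> 1" "\<rho> * L\<^sup>2 = 1" using L by (auto simp: \<rho>_def)
  define r where "r = sqrt (1 - \<rho>)"
  have r: "0 \<le> r" "r < 1" "r\<^sup>2 = 1 - \<rho>" using \<rho> by (auto simp: r_def)
  have "\<exists>u'\<in>V. \<forall>v\<in>V. B v u' = B v u - \<rho> * (A v u - F v)" if u: "u \<in> V" for u
  proof -
    define G where "G v = B v u - \<rho> * (A v u - F v)" for v
    have "\<bar>G v\<bar> \<le> (nrm u + \<rho> * (L * nrm u + c)) * nrm v" if v: "v \<in> V" for v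
    proof -
      have "\<bar>G v\<bar> \<le> \<bar>B v u\<bar> + \<rho> * (\<bar>A v u\<bar> + \<bar>F v\<bar>)"
      proof -
        have "\<bar>\<rho> * (A v u - F v)\<bar> \<le> \<rho> * (\<bar>A v u\<bar> + \<bar>F v\<bar>)"
          using \<rho>(1) by (simp add: abs_mult)
        then show ?thesis unfolding G_def by linarith
      qed
      also have "\<dots> \<le> nrm v * nrm u + \<rho> * (L * nrm v * nrm u + c * nrm v)"
        using cauchy_schwarz[OF v u] A_L[OF u v] c[OF v] \<rho>(1)
        by (intro add_mono mult_left_mono) auto
      finally show ?thesis by (simp add: algebra_simps)
    qed
    moreover have "G (\<lambda>x. a * v x + b * w x) = a * G v + b * G w" if "v \<in> V" "w \<in> V" for a b v w
      unfolding G_def using that u by (simp add: B_comb_left A_left F algebra_simps)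
    ultimately obtain g where "g \<in> V" "\<And>v. v \<in> V \<Longrightarrow> B v g = G v"
      using riesz[of G "nrm u + \<rho> * (L * nrm u + c)"] by blast
    then show ?thesis unfolding G_def by blast
  qed
  then obtain T where T: "\<And>u. u \<in> V \<Longrightarrow> T u \<in> V"
    "\<And>u v. \<lbrakk>u \<in> V; v \<in> V\<rbrakk> \<Longrightarrow> B v (T u) = B v u - \<rho> * (A v u - F v)" by metis
  define us where "us n = (T ^^ n) (\<lambda>x. 0)" for n
  have us: "us n \<in> V" for n by (induction n) (auto simp: us_def V_zero T)
  define d where "d n = (\<lambda>x. us (Suc n) x - us n x)" for n
  have d: "d n \<in> V" for n by (simp add: d_def V_diff us)
  have Bus: "B v (us (Suc n)) = B v (us n) - \<rho> * (A v (us n) - F v)" if "v \<in> V" for v n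
    using T(2)[OF us that] by (simp add: us_def)
  have A_diff: "A w (\<lambda>x. u x - v x) = A w u - A w v" if "u \<in> V" "v \<in> V" "w \<in> V" for u v w
    using A_right[OF that, of 1 "-1"] by simp
  have Bd: "B v (d (Suc n)) = B v (d n) - \<rho> * A v (d n)" if v: "v \<in> V" for v n
    using Bus[OF v, of n] Bus[OF v, of "Suc n"] v
    by (simp add: d_def B_diff_right us A_diff algebra_simps)
  have step: "nrm (d (Suc n)) \<le> r * nrm (d n)" for n
  proof -
    define w where "w = d n"
    define z where "z = d (Suc n)"
    define t where "t = (\<lambda>x. w x - z x)"
    have V: "w \<in> V" "z \<in> V" "t \<in> V" using d by (auto simp: w_def z_def t_def intro: V_diff)
    have Bt: "B v t = \<rho> * A v w" if "v \<in> V" for v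
      using Bd[OF that, of n] that V by (simp add: t_def B_diff_right w_def z_def)
    have "nrm t * nrm t = B t t" using nrm_square[OF V(3)] by (simp add: power2_eq_square)
    also have "\<dots> \<le> \<rho> * (L * nrm t * nrm w)"
      using Bt[OF V(3)] A_L[OF V(1,3)] \<rho>(1) by simp
    finally have "nrm t * nrm t \<le> nrm t * (\<rho> * L * nrm w)" by (simp add: mult_ac)
    then have "nrm t \<le> \<rho> * L * nrm w"
      using V \<rho>(1) L(1) by (cases "nrm t = 0") (auto simp: mult_le_cancel_left less_le)
    then have "(nrm t)\<^sup>2 \<le> (\<rho> * L * nrm w)\<^sup>2" using V by (intro power_mono) auto
    also have "\<dots> = \<rho> * (\<rho> * L\<^sup>2) * (nrm w)\<^sup>2" by (simp add: power2_eq_square)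
    finally have tt: "B t t \<le> \<rho> * B w w" using V \<rho>(3) by (simp add: nrm_square)
    have wt: "\<rho> * B w w \<le> B w t"
      using Bt[OF V(1)] A_coercive[OF V(1)] \<rho>(1) by simp
    have "B z z = B w w - 2 * B w t + B t t"
      using B_square_comb[OF V(1,3), of 1 "-1"] by (simp add: t_def)
    also have "\<dots> \<le> (1 - \<rho>) * B w w" using tt wt by (simp add: algebra_simps)
    finally have "(nrm z)\<^sup>2 \<le> (r * nrm w)\<^sup>2"
      using V r(3) by (simp add: nrm_square power_mult_distrib)
    then have "nrm z \<le> r * nrm w" by (rule power2_le_imp_le) (use V r(1) in simp)
    then show ?thesis by (simp add: w_def z_def)
  qed
  define c0 where "c0 = nrm (d 0)"
  have c0: "0 \<le> c0" using d by (simp add: c0_def)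
  have dn: "nrm (d n) \<le> c0 * r ^ n" for n
  proof (induction n)
    case (Suc n)
    then show ?case using step[of n] mult_left_mono[OF Suc r(1)] by (simp add: mult_ac)
  qed (simp add: c0_def)
  have sum: "nrm (\<lambda>x. us (n + k) x - us n x) \<le> c0 * r ^ n * (1 - r ^ k) / (1 - r)" for n k
  proof (induction k)
    case (Suc k)
    have "nrm (\<lambda>x. us (n + Suc k) x - us n x) \<le> nrm (d (n + k)) + nrm (\<lambda>x. us (n + k) x - us n x)"
      using nrm_diff_triangle[where u="us (n + Suc k)" and v="us (n + k)" and w="us n", OF us us us]
      by (simp add: d_def)
    also have "\<dots> \<le> c0 * r ^ (n + k) + c0 * r ^ n * (1 - r ^ k) / (1 - r)"
      using dn Suc by (intro add_mono) auto
    also have "\<dots> = c0 * r ^ n * (1 - r ^ Suc k) / (1 - r)"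
      using r by (simp add: field_simps power_add)
    finally show ?case .
  qed simp
  have dist: "nrm (\<lambda>x. us m x - us n x) \<le> c0 * r ^ N / (1 - r)" if mn: "N \<le> n" "n \<le> m" for N n m
  proof -
    have "c0 * r ^ n * (1 - r ^ (m - n)) / (1 - r) \<le> c0 * r ^ N / (1 - r)"
    proof -
      have "r ^ n * (1 - r ^ (m - n)) \<le> r ^ N * 1"
        using r mn by (intro mult_mono power_decreasing) (auto simp: power_le_one)
      then show ?thesis using c0 r by (simp add: divide_right_mono mult_left_mono mult.assoc)
    qed
    then show ?thesis using sum[of n "m - n"] mn by simp
  qed
  have dist': "nrm (\<lambda>x. us m x - us n x) \<le> c0 * r ^ N / (1 - r)" if "N \<le> n" "N \<le> m" for N n m
    using dist[OF that(1), of m] dist[OF that(2), of n] nrm_minus_commute[OF us us, of m n] by linarith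
  have lim0: "(\<lambda>N. c0 * r ^ N / (1 - r)) \<longlonglongrightarrow> 0"
    using tendsto_divide[OF tendsto_mult[OF tendsto_const[of c0] LIMSEQ_realpow_zero[OF r(1,2)]]
        tendsto_const[of "1 - r"]] r by simp
  have "\<exists>N. \<forall>m\<ge>N. \<forall>n\<ge>N. B (\<lambda>x. us m x - us n x) (\<lambda>x. us m x - us n x) < \<epsilon>" if "0 < \<epsilon>" for \<epsilon>
  proof -
    have "0 < sqrt \<epsilon>" using that by simp
    then obtain N where N: "c0 * r ^ N / (1 - r) < sqrt \<epsilon>"
      using eventually_happens'[OF sequentially_bot order_tendstoD(2)[OF lim0]] by blast
    have "B (\<lambda>x. us m x - us n x) (\<lambda>x. us m x - us n x) < \<epsilon>" if mn: "N \<le> m" "N \<le> n" for m n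
      using le_less_trans[OF dist'[OF mn(2,1)] N] unfolding nrm_def by simp
    then show ?thesis by blast
  qed
  then obtain w where w: "w \<in> V" "(\<lambda>n. nrm (\<lambda>x. us n x - w x)) \<longlonglongrightarrow> 0"
    using complete_nrm[of us] us by blast
  have "A v w = F v" if v: "v \<in> V" for v
  proof -
    have "(\<lambda>n. A v (us n) - A v w) \<longlonglongrightarrow> 0"
    proof (rule Lim_null_comparison[where g="\<lambda>n. L * nrm v * nrm (\<lambda>x. us n x - w x)"])
      show "\<forall>\<^sub>F n in sequentially. norm (A v (us n) - A v w) \<le> L * nrm v * nrm (\<lambda>x. us n x - w x)"
        using A_L[OF V_diff[OF us w(1)] v] by (simp add: A_diff us w v)
    qed (use tendsto_mult_right_zero[OF w(2)] in simp)
    then have "(\<lambda>n. A v (us n)) \<longlonglongrightarrow> A v w" by (simp add: LIM_zero_iff)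
    then have l1: "(\<lambda>n. \<rho> * (A v (us n) - F v)) \<longlonglongrightarrow> \<rho> * (A v w - F v)" by (intro tendsto_intros)
    have "(\<lambda>n. B v (us n) - B v (us (Suc n))) \<longlonglongrightarrow> B v w - B v w"
      using B_tendsto[OF us w(1) v w(2)] by (intro tendsto_diff LIMSEQ_Suc)
    then have "(\<lambda>n. \<rho> * (A v (us n) - F v)) \<longlonglongrightarrow> 0" using Bus[OF v] by simp
    then have "\<rho> * (A v w - F v) = 0" using l1 LIMSEQ_unique by blast
    then show ?thesis using \<rho>(1) by simp
  qed
  then show ?thesis using that w(1) by blast
qed

end

section \<open>Square-integrable functions on a probability space\<close>

lemma L2_spaceD:
  assumes "f \<in> L2_space M"
  shows "f \<in> borel_measurable M" "integrable M (\<lambda>x. (f x)\<^sup>2)"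
  using assms by (auto simp: L2_space_def)

lemma L2_integrable_mult:
  assumes "f \<in> L2_space M" "g \<in> L2_space M"
  shows "integrable M (\<lambda>x. f x * g x)"
proof (rule Bochner_Integration.integrable_bound)
  show "integrable M (\<lambda>x. (f x)\<^sup>2 + (g x)\<^sup>2)" using assms by (simp add: L2_spaceD)
  show "(\<lambda>x. f x * g x) \<in> borel_measurable M" using assms by (intro borel_measurable_times L2_spaceD)
  have "\<bar>a * b\<bar> \<le> a\<^sup>2 + b\<^sup>2" for a b :: real
  proof -
    have "0 \<le> (a - b)\<^sup>2" "0 \<le> (a + b)\<^sup>2" "0 \<le> a\<^sup>2 + b\<^sup>2" by simp_all
    then show ?thesis by (simp add: power2_diff power2_sum abs_le_iff)
  qed
  then show "AE x in M. norm (f x * g x) \<le> norm ((f x)\<^sup>2 + (g x)\<^sup>2)" by simp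
qed

lemma L2_comb:
  assumes "f \<in> L2_space M" "g \<in> L2_space M"
  shows "(\<lambda>x. a * f x + b * g x) \<in> L2_space M"
proof -
  have "integrable M (\<lambda>x. a\<^sup>2 * (f x)\<^sup>2 + 2 * a * b * (f x * g x) + b\<^sup>2 * (g x)\<^sup>2)"
    using assms by (intro Bochner_Integration.integrable_add integrable_mult_right L2_integrable_mult L2_spaceD)
  moreover have "(\<lambda>x. (a * f x + b * g x)\<^sup>2)
      = (\<lambda>x. a\<^sup>2 * (f x)\<^sup>2 + 2 * a * b * (f x * g x) + b\<^sup>2 * (g x)\<^sup>2)"
    by (simp add: power2_eq_square algebra_simps)
  ultimately show ?thesis using L2_spaceD(1)[OF assms(1)] L2_spaceD(1)[OF assms(2)]
    by (simp add: L2_space_def)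
qed

interpretation L2: semi_inner_space "L2_space M" "L2_inner M" for M
proof
  show "L2_inner M (\<lambda>x. a * u x + b * v x) w = a * L2_inner M u w + b * L2_inner M v w"
    if "u \<in> L2_space M" "v \<in> L2_space M" "w \<in> L2_space M" for u v w a b
  proof -
    have "L2_inner M (\<lambda>x. a * u x + b * v x) w = (\<integral>x. a * (u x * w x) + b * (v x * w x) \<partial>M)"
      unfolding L2_inner_def by (simp add: algebra_simps)
    also have "\<dots> = (\<integral>x. a * (u x * w x) \<partial>M) + (\<integral>x. b * (v x * w x) \<partial>M)"
      using that by (intro Bochner_Integration.integral_add integrable_mult_right L2_integrable_mult)
    finally show ?thesis by (simp add: L2_inner_def)
  qed
  show "0 \<le> L2_inner M u u" for u unfolding L2_inner_def by simp
qed (auto simp: L2_comb L2_inner_def mult.commute, simp add: L2_space_def)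

lemma L2_norm_eq: "L2.nrm M f = L2_norm M f"
  by (simp add: L2.nrm_def L2_norm_def)

lemma L2_inner_cong_AE:
  assumes "AE x in M. f x = f' x" "AE x in M. g x = g' x"
    "f \<in> borel_measurable M" "f' \<in> borel_measurable M" "g \<in> borel_measurable M" "g' \<in> borel_measurable M"
  shows "L2_inner M f g = L2_inner M f' g'"
  unfolding L2_inner_def by (rule integral_cong_AE) (use assms in auto)

lemma L2_inner_self_zero:
  assumes "f \<in> L2_space M" "L2_inner M f f = 0"
  shows "AE x in M. f x = 0"
proof -
  have "AE x in M. (f x)\<^sup>2 = 0"
    using integral_nonneg_eq_0_iff_AE[OF L2_spaceD(2)[OF assms(1)]] assms(2)
    by (simp add: L2_inner_def power2_eq_square)
  then show ?thesis by simp
qed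

context prob_space
begin

lemma L2_bounded:
  assumes "f \<in> borel_measurable M" "AE x in M. \<bar>f x\<bar> \<le> C"
  shows "f \<in> L2_space M"
proof -
  have "AE x in M. norm ((f x)\<^sup>2) \<le> C\<^sup>2"
    using assms(2) by eventually_elim (simp, metis abs_ge_zero power2_abs power_mono)
  then have "integrable M (\<lambda>x. (f x)\<^sup>2)"
    using assms(1) by (intro integrable_const_bound) auto
  then show ?thesis using assms(1) by (simp add: L2_space_def)
qed

lemma L2_between:
  assumes "f \<in> borel_measurable M" "AE x in M. a \<le> f x \<and> f x \<le> b"
  shows "f \<in> L2_space M"
  by (rule L2_bounded[OF assms(1), of "\<bar>a\<bar> + \<bar>b\<bar>"]) (use assms(2) in \<open>eventually_elim, auto\<close>)

lemma AE_interval_nonempty: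
  assumes "AE x in M. a \<le> u x \<and> u x \<le> (b::real)" shows "a \<le> b"
proof (rule ccontr)
  assume "\<not> a \<le> b"
  have "AE x in M. False" using assms by eventually_elim (use \<open>\<not> a \<le> b\<close> in simp)
  then show False by simp
qed

lemma L2_const: "(\<lambda>x. c) \<in> L2_space M"
  by (simp add: L2_space_def)

lemma L2_integrable: "f \<in> L2_space M \<Longrightarrow> integrable M f"
  using L2_integrable_mult[OF L2_const[of 1], of f] by simp

lemma L2_inner_const: "L2_inner M (\<lambda>x. c) f = c * (\<integral>x. f x \<partial>M)"
  by (simp add: L2_inner_def)

lemma L2_inner_const_right: "L2_inner M f (\<lambda>x. c) = c * (\<integral>x. f x \<partial>M)"
  by (simp add: L2_inner_def)

lemma L2_norm_const: "L2_norm M (\<lambda>x. c) = \<bar>c\<bar>"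
  by (simp add: L2_norm_def L2_inner_def prob_space flip: power2_eq_square)

end

section \<open>The Hilbert space of a coercive closed form\<close>

context coercive_closed_form
begin

text \<open>The symmetric part of the form shifted by the inner product of \<open>L\<^sup>2\<close>. It has the same diagonal as the
  shifted form, so closedness of the form is completeness for this inner product.\<close>

definition sym_form :: "('a \<Rightarrow> real) \<Rightarrow> ('a \<Rightarrow> real) \<Rightarrow> real" where
  "sym_form u v = (form1 M \<E> u v + form1 M \<E> v u) / 2"

lemma D_L2: "u \<in> D \<Longrightarrow> u \<in> L2_space M"
  using dom_L2 by blast

lemma D_meas: "u \<in> D \<Longrightarrow> u \<in> borel_measurable M"
  using D_L2 L2_spaceD by blast

lemma D_comb: "\<lbrakk>u \<in> D; v \<in> D\<rbrakk> \<Longrightarrow> (\<lambda>x. a * u x + b * v x) \<in> D"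
  by (intro dom_add dom_scale)

lemma form_comb_left: "\<lbrakk>u \<in> D; v \<in> D; w \<in> D\<rbrakk>
    \<Longrightarrow> \<E> (\<lambda>x. a * u x + b * v x) w = a * \<E> u w + b * \<E> v w"
  by (simp add: form_add_left form_scale_left dom_scale)

lemma form_comb_right: "\<lbrakk>u \<in> D; v \<in> D; w \<in> D\<rbrakk>
    \<Longrightarrow> \<E> w (\<lambda>x. a * u x + b * v x) = a * \<E> w u + b * \<E> w v"
  by (simp add: form_add_right form_scale_right dom_scale)

lemma form_diff_left: "\<lbrakk>u \<in> D; v \<in> D; w \<in> D\<rbrakk> \<Longrightarrow> \<E> (\<lambda>x. u x - v x) w = \<E> u w - \<E> v w"
  using form_comb_left[of u v w 1 "-1"] by simp

lemma form_diff_right: "\<lbrakk>u \<in> D; v \<in> D; w \<in> D\<rbrakk> \<Longrightarrow> \<E> w (\<lambda>x. u x - v x) = \<E> w u - \<E> w v"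
  using form_comb_right[of u v w 1 "-1"] by simp

lemma dom_diff: "\<lbrakk>u \<in> D; v \<in> D\<rbrakk> \<Longrightarrow> (\<lambda>x. u x - v x) \<in> D"
  using D_comb[of u v 1 "-1"] by simp

lemma form1_comb_left: "\<lbrakk>u \<in> D; v \<in> D; w \<in> D\<rbrakk>
    \<Longrightarrow> form1 M \<E> (\<lambda>x. a * u x + b * v x) w = a * form1 M \<E> u w + b * form1 M \<E> v w"
  by (simp add: form1_def form_comb_left L2.B_comb_left D_L2 algebra_simps)

lemma form1_comb_right: "\<lbrakk>u \<in> D; v \<in> D; w \<in> D\<rbrakk>
    \<Longrightarrow> form1 M \<E> w (\<lambda>x. a * u x + b * v x) = a * form1 M \<E> w u + b * form1 M \<E> w v"
  by (simp add: form1_def form_comb_right L2.B_comb_right D_L2 algebra_simps)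

lemma sym_form_self: "sym_form u u = form1 M \<E> u u"
  by (simp add: sym_form_def)

sublocale H: complete_semi_inner_space D sym_form
proof
  show "(\<lambda>x. 0) \<in> D" by (rule dom_zero)
  show "(\<lambda>x. a * u x + b * v x) \<in> D" if "u \<in> D" "v \<in> D" for u v a b using D_comb that .
  show "sym_form (\<lambda>x. a * u x + b * v x) w = a * sym_form u w + b * sym_form v w"
    if "u \<in> D" "v \<in> D" "w \<in> D" for u v w a b
    using that by (simp add: sym_form_def form1_comb_left form1_comb_right field_simps)
  show "sym_form u v = sym_form v u" for u v by (simp add: sym_form_def)
  show "0 \<le> sym_form u u" if "u \<in> D" for u
    using form_nonneg[OF that] L2.B_nonneg[OF D_L2[OF that]] by (simp add: sym_form_self form1_def)
  show "\<exists>v\<in>D. (\<lambda>n. sym_form (\<lambda>x. us n x - v x) (\<lambda>x. us n x - v x)) \<longlonglongrightarrow> 0"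
    if "\<And>n. us n \<in> D"
      "\<And>\<epsilon>. 0 < \<epsilon> \<Longrightarrow> \<exists>N. \<forall>m\<ge>N. \<forall>n\<ge>N. sym_form (\<lambda>x. us m x - us n x) (\<lambda>x. us m x - us n x) < \<epsilon>"
    for us
    using closed[of us] that by (simp add: sym_form_self)
qed

lemma nrm_sq: "u \<in> D \<Longrightarrow> (H.nrm u)\<^sup>2 = \<E> u u + (L2_norm M u)\<^sup>2"
  using L2.nrm_square[OF D_L2[of u]]
  by (simp add: H.nrm_square sym_form_self form1_def L2_norm_eq)

lemma L2_norm_le_nrm: assumes "u \<in> D" shows "L2_norm M u \<le> H.nrm u"
  by (rule power2_le_imp_le) (use assms form_nonneg[of u] nrm_sq[of u] in auto)

lemma form_le_nrm: assumes "u \<in> D" shows "\<E> u u \<le> (H.nrm u)\<^sup>2"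
  using nrm_sq[OF assms] by simp

lemma form_bound:
  "\<exists>K\<ge>0. \<forall>u\<in>D. \<forall>v\<in>D. \<bar>\<E> u v\<bar> \<le> K * H.nrm u * H.nrm v"
proof -
  obtain K where K: "\<And>u v. \<lbrakk>u \<in> D; v \<in> D\<rbrakk> \<Longrightarrow> \<bar>form1 M \<E> u v\<bar> \<le> K * H.nrm u * H.nrm v"
    using weak_sector by (auto simp: H.nrm_def sym_form_self)
  have "\<bar>\<E> u v\<bar> \<le> (\<bar>K\<bar> + 1) * H.nrm u * H.nrm v" if "u \<in> D" "v \<in> D" for u v
  proof -
    have "\<bar>L2_inner M u v\<bar> \<le> L2_norm M u * L2_norm M v"
      using L2.cauchy_schwarz[OF D_L2 D_L2] that by (simp add: L2_norm_eq)
    also have "\<dots> \<le> H.nrm u * H.nrm v"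
      using that L2.nrm_nonneg[OF D_L2] by (intro mult_mono L2_norm_le_nrm) (auto simp: L2_norm_eq)
    finally have "\<bar>\<E> u v\<bar> \<le> K * (H.nrm u * H.nrm v) + H.nrm u * H.nrm v"
      using K[OF that] by (simp add: form1_def)
    also have "\<dots> \<le> \<bar>K\<bar> * (H.nrm u * H.nrm v) + H.nrm u * H.nrm v"
      using that by (intro add_mono mult_right_mono) auto
    finally show ?thesis by (simp add: algebra_simps)
  qed
  then show ?thesis by (intro exI[of _ "\<bar>K\<bar> + 1"]) simp
qed

lemma form_sum_le: assumes "u \<in> D" "v \<in> D"
  shows "\<E> (\<lambda>x. u x + v x) (\<lambda>x. u x + v x) \<le> 2 * \<E> u u + 2 * \<E> v v"
proof -
  have "\<E> (\<lambda>x. u x + v x) (\<lambda>x. u x + v x) + \<E> (\<lambda>x. u x - v x) (\<lambda>x. u x - v x)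
      = 2 * \<E> u u + 2 * \<E> v v"
    using assms by (simp add: form_add_left form_add_right form_diff_left form_diff_right dom_add dom_diff)
  then show ?thesis using form_nonneg[OF dom_diff[OF assms]] by linarith
qed

lemma form_scale_both: "u \<in> D \<Longrightarrow> \<E> (\<lambda>x. c * u x) (\<lambda>x. c * u x) = c\<^sup>2 * \<E> u u"
  by (simp add: form_scale_left form_scale_right dom_scale power2_eq_square)

lemma form_tendsto_diag:
  assumes "\<And>n. us n \<in> D" "w \<in> D" "(\<lambda>n. H.nrm (\<lambda>x. us n x - w x)) \<longlonglongrightarrow> 0"
  shows "(\<lambda>n. L2_norm M (\<lambda>x. us n x - w x)) \<longlonglongrightarrow> 0" "(\<lambda>n. \<E> (us n) (us n)) \<longlonglongrightarrow> \<E> w w"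
proof -
  show l: "(\<lambda>n. L2_norm M (\<lambda>x. us n x - w x)) \<longlonglongrightarrow> 0"
    by (rule Lim_null_comparison[OF _ assms(3)])
      (use L2_norm_le_nrm[OF dom_diff[OF assms(1,2)]] L2.nrm_nonneg[OF D_L2[OF dom_diff[OF assms(1,2)]]]
        in \<open>simp add: L2_norm_eq\<close>)
  have l': "(\<lambda>n. L2_norm M (us n)) \<longlonglongrightarrow> L2_norm M w"
    using L2.nrm_tendsto[of us M w] l assms D_L2 by (simp add: L2_norm_eq)
  have "(\<lambda>n. (H.nrm (us n))\<^sup>2 - (L2_norm M (us n))\<^sup>2) \<longlonglongrightarrow> (H.nrm w)\<^sup>2 - (L2_norm M w)\<^sup>2"
    by (intro tendsto_intros l' H.nrm_tendsto assms)
  then show "(\<lambda>n. \<E> (us n) (us n)) \<longlonglongrightarrow> \<E> w w" using assms by (simp add: nrm_sq)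
qed

lemma form_tendsto:
  assumes "\<And>n. us n \<in> D" "w \<in> D" "v \<in> D" "(\<lambda>n. H.nrm (\<lambda>x. us n x - w x)) \<longlonglongrightarrow> 0"
  shows "(\<lambda>n. \<E> v (us n)) \<longlonglongrightarrow> \<E> v w"
proof -
  obtain K where K: "0 \<le> K" "\<And>u v. \<lbrakk>u \<in> D; v \<in> D\<rbrakk> \<Longrightarrow> \<bar>\<E> u v\<bar> \<le> K * H.nrm u * H.nrm v"
    using form_bound by blast
  have "(\<lambda>n. \<E> v (us n) - \<E> v w) \<longlonglongrightarrow> 0"
  proof (rule Lim_null_comparison[where g="\<lambda>n. K * H.nrm v * H.nrm (\<lambda>x. us n x - w x)"])
    show "\<forall>\<^sub>F n in sequentially. norm (\<E> v (us n) - \<E> v w) \<le> K * H.nrm v * H.nrm (\<lambda>x. us n x - w x)"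
      using K(2)[OF assms(3) dom_diff[OF assms(1,2)]] by (simp add: form_diff_right assms)
  qed (use tendsto_mult_right_zero[OF assms(4)] in simp)
  then show ?thesis by (simp add: LIM_zero_iff)
qed

lemma nrm_cong_AE:
  assumes "u \<in> D" "v \<in> D" "AE x in M. u x = v x"
  shows "H.nrm u = H.nrm v"
  unfolding H.nrm_def sym_form_self form1_def
  using form_AE[OF assms(1,2,1,2) assms(3,3)] L2_inner_cong_AE[OF assms(3,3)] assms D_meas by simp

text \<open>Approximants in \<open>L\<^sup>2\<close> whose energy stays bounded can be replaced by approximants in the form norm, as in
  the theorem of Banach and Saks: the near-minimisers of the norm over the intersections of \<open>C\<close> with
  shrinking \<open>L\<^sup>2\<close>-balls around \<open>w\<close> converge.\<close>

lemma energy_bounded_limit: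
  assumes C_D: "C \<subseteq> D"
    and mid: "\<And>u v. \<lbrakk>u \<in> C; v \<in> C\<rbrakk> \<Longrightarrow> (\<lambda>x. 1/2 * u x + 1/2 * v x) \<in> C"
    and w: "w \<in> L2_space M"
    and app: "\<And>\<epsilon>. 0 < \<epsilon> \<Longrightarrow> \<exists>u\<in>C. L2_norm M (\<lambda>x. u x - w x) \<le> \<epsilon> \<and> (H.nrm u)\<^sup>2 \<le> K"
  shows "w \<in> D" and "(H.nrm w)\<^sup>2 \<le> K"
    and "\<exists>us. (\<forall>n. us n \<in> C) \<and> (\<lambda>n. H.nrm (\<lambda>x. us n x - w x)) \<longlonglongrightarrow> 0"
proof -
  define Cn where "Cn n = {u \<in> C. L2_norm M (\<lambda>x. u x - w x) \<le> 1 / (real n + 1)}" for n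
  define J where "J u = (H.nrm u)\<^sup>2" for u
  have J_eq: "J u = sym_form u u" if "u \<in> D" for u unfolding J_def using that by (rule H.nrm_square)
  have 1: "Cn n \<subseteq> D" for n using C_D by (auto simp: Cn_def)
  have 2: "Cn m \<subseteq> Cn n" if "n \<le> m" for n m
  proof -
    have "1 / (real m + 1) \<le> 1 / (real n + 1)" using that by (simp add: frac_le)
    then show ?thesis by (auto simp: Cn_def)
  qed
  have 3: "(\<lambda>x. 1/2 * u x + 1/2 * v x) \<in> Cn n" if uv: "u \<in> Cn n" "v \<in> Cn n" for n u v
  proof -
    have L: "u \<in> L2_space M" "v \<in> L2_space M" using uv 1 D_L2 by blast+
    note du = L2.V_diff[OF L(1) w] and dv = L2.V_diff[OF L(2) w]
    have "L2_norm M (\<lambda>x. 1/2 * (u x - w x) + 1/2 * (v x - w x))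
        \<le> 1/2 * L2_norm M (\<lambda>x. u x - w x) + 1/2 * L2_norm M (\<lambda>x. v x - w x)"
      using L2.nrm_triangle[OF L2.V_scale[OF du, of "1/2"] L2.V_scale[OF dv, of "1/2"]]
        L2.nrm_scale[OF du, of "1/2"] L2.nrm_scale[OF dv, of "1/2"] by (simp add: L2_norm_eq)
    also have "\<dots> \<le> 1 / (real n + 1)" using uv by (simp add: Cn_def)
    also have "(\<lambda>x. 1/2 * (u x - w x) + 1/2 * (v x - w x)) = (\<lambda>x. (1/2 * u x + 1/2 * v x) - w x)"
      by (rule ext) (simp add: field_simps)
    finally have "L2_norm M (\<lambda>x. (1/2 * u x + 1/2 * v x) - w x) \<le> 1 / (real n + 1)" .
    then show ?thesis using mid[of u v] uv by (simp add: Cn_def)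
  qed
  have 4: "1/2 * sym_form (\<lambda>x. u x - v x) (\<lambda>x. u x - v x)
      \<le> J u + J v - 2 * J (\<lambda>x. 1/2 * u x + 1/2 * v x)" if "u \<in> Cn 0" "v \<in> Cn 0" for u v
  proof -
    have D: "u \<in> D" "v \<in> D" using that 1 by blast+
    show ?thesis
      unfolding J_eq[OF D(1)] J_eq[OF D(2)] J_eq[OF D_comb[OF D]] H.parallelogram[OF D] by argo
  qed
  have 5: "0 \<le> J u" for u by (simp add: J_def)
  have 6: "\<exists>u\<in>Cn n. J u \<le> K" for n
    using app[of "1 / (real n + 1)"] by (auto simp: Cn_def J_def)
  obtain us w' where w': "w' \<in> D" "\<And>n. us n \<in> Cn n" "(\<lambda>n. H.nrm (\<lambda>x. us n x - w' x)) \<longlonglongrightarrow> 0"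
    and inf: "\<And>n. J (us n) \<le> Inf (J ` Cn n) + 1 / (real n + 1)"
    by (rule H.near_minimisers_converge[OF 1 2 3 _ 4 5 6]) auto
  have usD: "us n \<in> D" for n using w'(2) 1 by blast
  have l0: "(\<lambda>n. 1 / (real n + 1)) \<longlonglongrightarrow> 0"
    using LIMSEQ_inverse_real_of_nat by (simp add: inverse_eq_divide add.commute)
  have "(\<lambda>n. L2_norm M (\<lambda>x. us n x - w' x)) \<longlonglongrightarrow> 0"
    using form_tendsto_diag(1)[of us w'] usD w' by blast
  moreover have "L2_norm M (\<lambda>x. w' x - w x) \<le> L2_norm M (\<lambda>x. us n x - w' x) + 1 / (real n + 1)" for n
  proof -
    have "L2_norm M (\<lambda>x. w' x - w x) \<le> L2_norm M (\<lambda>x. w' x - us n x) + L2_norm M (\<lambda>x. us n x - w x)"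
      using L2.nrm_diff_triangle[OF D_L2[OF w'(1)] D_L2[OF usD] w] by (simp add: L2_norm_eq)
    moreover have "L2_norm M (\<lambda>x. w' x - us n x) = L2_norm M (\<lambda>x. us n x - w' x)"
      using L2.nrm_minus_commute[OF D_L2[OF w'(1)] D_L2[OF usD]] by (simp add: L2_norm_eq)
    moreover have "L2_norm M (\<lambda>x. us n x - w x) \<le> 1 / (real n + 1)" using w'(2)[of n] by (simp add: Cn_def)
    ultimately show ?thesis by simp
  qed
  ultimately have "L2_norm M (\<lambda>x. w' x - w x) \<le> 0 + 0"
    using LIMSEQ_le_const[OF tendsto_add[OF _ l0]] by blast
  then have "L2_inner M (\<lambda>x. w' x - w x) (\<lambda>x. w' x - w x) = 0"
    using L2.B_nonneg[OF L2.V_diff[OF D_L2[OF w'(1)] w]] by (simp add: L2_norm_def)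
  then have "AE x in M. w' x - w x = 0"
    by (intro L2_inner_self_zero L2.V_diff D_L2 w' w)
  then have ae: "AE x in M. w' x = w x" by simp
  show wD: "w \<in> D" by (rule dom_AE[OF w'(1) _ ae]) (use w L2_spaceD in blast)

  have eq: "H.nrm (\<lambda>x. us n x - w' x) = H.nrm (\<lambda>x. us n x - w x)" for n
    by (rule nrm_cong_AE) (use usD w' wD ae in \<open>auto intro: dom_diff\<close>)
  then have lim: "(\<lambda>n. H.nrm (\<lambda>x. us n x - w x)) \<longlonglongrightarrow> 0" using w'(3) by simp
  then show "\<exists>us. (\<forall>n. us n \<in> C) \<and> (\<lambda>n. H.nrm (\<lambda>x. us n x - w x)) \<longlonglongrightarrow> 0"
    using w'(2) by (auto simp: Cn_def)
  have "J (us n) \<le> K + 1 / (real n + 1)" for n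
  proof -
    obtain u where "u \<in> Cn n" "J u \<le> K" using 6 by blast
    then have "Inf (J ` Cn n) \<le> K"
      using cInf_lower[of "J u" "J ` Cn n"] 5 by (force intro: bdd_belowI2)
    then show ?thesis using inf[of n] by simp
  qed
  moreover have "(\<lambda>n. J (us n)) \<longlonglongrightarrow> (H.nrm w)\<^sup>2"
    unfolding J_def by (intro tendsto_intros H.nrm_tendsto usD wD lim)
  ultimately have "(H.nrm w)\<^sup>2 \<le> K + 0"
    using LIMSEQ_le[OF _ tendsto_add[OF tendsto_const l0]] by blast
  then show "(H.nrm w)\<^sup>2 \<le> K" by simp
qed

end

section \<open>The resolvent\<close>

locale associated_form = prob_space M + dirichlet_form M D \<E> + markov_semigroup M P
  for M :: "'a measure" and D \<E> P +
  assumes assoc: "associated M D \<E> P"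
begin

lemma P_comb:
  assumes "0 \<le> t" "f \<in> L2_space M" "g \<in> L2_space M"
  shows "AE x in M. P t (\<lambda>y. a * f y + b * g y) x = a * P t f x + b * P t g x"
  using P_add[OF assms(1) L2.V_scale[OF assms(2), of a] L2.V_scale[OF assms(3), of b]]
    P_scale[OF assms(1,2), of a] P_scale[OF assms(1,3), of b]
  by eventually_elim simp

lemma P_meas: "\<lbrakk>0 \<le> t; f \<in> L2_space M\<rbrakk> \<Longrightarrow> P t f \<in> borel_measurable M"
  using P_L2 L2_spaceD by blast

text \<open>A contraction that fixes 1 has an adjoint that fixes 1: compare the norms of \<open>1 + e f\<close> and of its image to
  first order in \<open>e\<close>.\<close>

lemma P_mean:
  assumes t: "0 \<le> t" and f: "f \<in> L2_space M"
  shows "(\<integral>x. P t f x \<partial>M) = (\<integral>x. f x \<partial>M)"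
proof (rule ccontr)
  assume ne: "\<not> ?thesis"
  define a where "a = (\<integral>x. P t f x \<partial>M) - (\<integral>x. f x \<partial>M)"
  define k where "k = \<bar>L2_inner M f f - L2_inner M (P t f) (P t f)\<bar> + 1"
  have k: "0 < k" by (simp add: k_def)
  have a: "0 < a\<^sup>2" using ne by (simp add: a_def)
  note one = L2_const[of 1]
  note Pf = P_L2[OF t f]
  (* Small enough for the first-order term 2 e a to dominate the second-order one. *)
  define e where "e = a / k"
  have "AE x in M. P t (\<lambda>y. 1 * 1 + e * f y) x = 1 * P t (\<lambda>y. 1) x + e * P t f x"
    using P_comb[OF t one f, of 1 e] by simp
  then have ae: "AE x in M. P t (\<lambda>y. 1 * 1 + e * f y) x = 1 * 1 + e * P t f x"
    using P_one[OF t] by eventually_elim simp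
  (* The factors 1 make the function a linear combination of the shape used by the lemmas. *)
  define g where "g = (\<lambda>y. 1 * 1 + e * f y)"
  have gL: "g \<in> L2_space M" unfolding g_def by (rule L2_comb[OF one f])
  have "L2_norm M (P t g) \<le> L2_norm M g" by (rule P_contraction[OF t gL])
  then have "L2_inner M (P t g) (P t g) \<le> L2_inner M g g" by (simp add: L2_norm_def)
  moreover have "L2_inner M (P t g) (P t g) = L2_inner M (\<lambda>x. 1 * 1 + e * P t f x) (\<lambda>x. 1 * 1 + e * P t f x)"
    using ae L2_spaceD(1)[OF L2_comb[OF one Pf, of 1 e]] P_meas[OF t gL]
    by (intro L2_inner_cong_AE) (auto simp: g_def)
  ultimately have "2 * e * (\<integral>x. P t f x \<partial>M) + e\<^sup>2 * L2_inner M (P t f) (P t f)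
      \<le> 2 * e * (\<integral>x. f x \<partial>M) + e\<^sup>2 * L2_inner M f f"
    unfolding g_def L2.B_square_comb[OF one f] L2.B_square_comb[OF one Pf] by (simp add: L2_inner_const)
  then have "2 * e * a \<le> e\<^sup>2 * (L2_inner M f f - L2_inner M (P t f) (P t f))"
    by (simp add: a_def algebra_simps)
  also have "\<dots> \<le> e\<^sup>2 * k" by (intro mult_left_mono) (auto simp: k_def)
  also have "\<dots> = e * a" using k by (simp add: e_def power2_eq_square)
  finally have "e * a \<le> 0" by linarith
  moreover have "0 < e * a" using a k by (simp add: e_def power2_eq_square)
  ultimately show False by simp
qed

lemma generates_iff: "generates M P f g \<longleftrightarrow>
    f \<in> D \<and> g \<in> L2_space M \<and> (\<forall>v\<in>D. \<E> v f = - L2_inner M v g)"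
  using assoc by (simp add: associated_def)

lemma generates_one: "generates M P (\<lambda>x. 1) (\<lambda>x. 0)"
proof -
  have "L2_norm M (\<lambda>x. (P t (\<lambda>y. 1) x - 1) / t - 0) = 0" if "0 \<le> t" for t
  proof -
    have "L2_inner M (\<lambda>x. (P t (\<lambda>y. 1) x - 1) / t - 0) (\<lambda>x. (P t (\<lambda>y. 1) x - 1) / t - 0)
        = L2_inner M (\<lambda>x. 0) (\<lambda>x. 0)"
      using P_one[OF that] P_meas[OF that L2_const[of 1]] by (intro L2_inner_cong_AE) auto
    then show ?thesis by (simp add: L2_norm_def L2_inner_def)
  qed
  then have "\<forall>\<^sub>F t in at_right 0. L2_norm M (\<lambda>x. (P t (\<lambda>y. 1) x - 1) / t - 0) = 0"
    by (auto simp: eventually_at_filter)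
  then show ?thesis unfolding generates_def
    by (simp add: L2_const tendsto_eventually)
qed

lemma one_D: "(\<lambda>x. 1) \<in> D"
  using generates_one by (simp add: generates_iff)

lemma const_D: "(\<lambda>x. c) \<in> D"
  using dom_scale[OF one_D, of c] by simp

lemma form_const_right: "v \<in> D \<Longrightarrow> \<E> v (\<lambda>x. c) = 0"
  using generates_one form_scale_right[of v "\<lambda>x. 1" c] one_D
  by (simp add: generates_iff L2_inner_const_right)

lemma generates_mean_zero:
  assumes "generates M P f g"
  shows "(\<integral>x. g x \<partial>M) = 0"
proof -
  have f: "f \<in> L2_space M" and g: "g \<in> L2_space M"
    and lim: "((\<lambda>t. L2_norm M (\<lambda>x. (P t f x - f x) / t - g x)) \<longlongrightarrow> 0) (at_right 0)"
    using assms by (auto simp: generates_def)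
  have "\<bar>\<integral>x. g x \<partial>M\<bar> \<le> L2_norm M (\<lambda>x. (P t f x - f x) / t - g x)" if t: "0 < t" for t
  proof -
    have Pf: "P t f \<in> L2_space M" using P_L2 t f by simp
    define q where "q = (\<lambda>x. (P t f x - f x) / t)"
    have q: "q \<in> L2_space M" unfolding q_def
      using L2.V_scale[OF L2.V_diff[OF Pf f], of "1 / t"] by simp
    have "(\<integral>x. q x \<partial>M) = ((\<integral>x. P t f x \<partial>M) - (\<integral>x. f x \<partial>M)) / t"
      unfolding q_def by (simp add: L2_integrable Pf f)
    also have "\<dots> = 0" using P_mean[of t f] t f by simp
    finally have "L2_inner M (\<lambda>x. 1) (\<lambda>x. q x - g x) = - (\<integral>x. g x \<partial>M)"
      using q g by (simp add: L2_inner_const L2_integrable)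
    then show ?thesis
      using L2.cauchy_schwarz[OF L2_const[of 1] L2.V_diff[OF q g]]
      by (simp add: L2_norm_eq L2_norm_const q_def)
  qed
  then have "\<bar>\<integral>x. g x \<partial>M\<bar> \<le> 0"
    by (intro tendsto_lowerbound[OF lim]) (auto simp: eventually_at_filter)
  then show ?thesis by simp
qed

text \<open>The resolvent at \<open>\<beta>\<close>, multiplied by \<open>\<beta>\<close> so that it fixes constants.\<close>

definition R :: "real \<Rightarrow> ('a \<Rightarrow> real) \<Rightarrow> 'a \<Rightarrow> real" where
  "R \<beta> f = (SOME u. u \<in> D \<and> (\<forall>v\<in>D. \<E> v u = \<beta> * L2_inner M v (\<lambda>x. f x - u x)))"

lemma R_exists:
  assumes \<beta>: "1 \<le> \<beta>" and f: "f \<in> L2_space M"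
  shows "\<exists>u. u \<in> D \<and> (\<forall>v\<in>D. \<E> v u = \<beta> * L2_inner M v (\<lambda>x. f x - u x))"
proof -
  define A where "A v u = \<E> v u + \<beta> * L2_inner M v u" for v u
  obtain K where K: "0 \<le> K" "\<And>u v. \<lbrakk>u \<in> D; v \<in> D\<rbrakk> \<Longrightarrow> \<bar>\<E> u v\<bar> \<le> K * H.nrm u * H.nrm v"
    using form_bound by blast
  have in_le: "\<bar>L2_inner M v u\<bar> \<le> H.nrm v * H.nrm u" if "u \<in> D" "v \<in> D" for u v
  proof -
    have "\<bar>L2_inner M v u\<bar> \<le> L2_norm M v * L2_norm M u"
      using L2.cauchy_schwarz[OF D_L2 D_L2] that by (simp add: L2_norm_eq)
    also have "\<dots> \<le> H.nrm v * H.nrm u"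
      using that L2.nrm_nonneg[OF D_L2] by (intro mult_mono L2_norm_le_nrm) (auto simp: L2_norm_eq)
    finally show ?thesis .
  qed
  obtain u where u: "u \<in> D" "\<And>v. v \<in> D \<Longrightarrow> A v u = \<beta> * L2_inner M v f"
  proof (rule H.lax_milgram[of A "K + \<beta>" "\<lambda>v. \<beta> * L2_inner M v f" "\<beta> * L2_norm M f"])
    show "A (\<lambda>x. a * u x + b * v x) w = a * A u w + b * A v w"
      if "u \<in> D" "v \<in> D" "w \<in> D" for a b u v w
      using that by (simp add: A_def form_comb_left L2.B_comb_left D_L2 algebra_simps)
    show "A w (\<lambda>x. a * u x + b * v x) = a * A w u + b * A w v"
      if "u \<in> D" "v \<in> D" "w \<in> D" for a b u v w
      using that by (simp add: A_def form_comb_right L2.B_comb_right D_L2 algebra_simps)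
    show "\<bar>A v u\<bar> \<le> (K + \<beta>) * H.nrm v * H.nrm u" if "u \<in> D" "v \<in> D" for u v
    proof -
      have "\<bar>A v u\<bar> \<le> \<bar>\<E> v u\<bar> + \<beta> * \<bar>L2_inner M v u\<bar>"
        unfolding A_def using \<beta> by (metis abs_mult abs_of_nonneg abs_triangle_ineq order_trans zero_le_one)
      also have "\<dots> \<le> K * H.nrm v * H.nrm u + \<beta> * (H.nrm v * H.nrm u)"
        using K(2)[OF that(2,1)] in_le[OF that] \<beta> by (intro add_mono mult_left_mono) auto
      finally show ?thesis by (simp add: algebra_simps)
    qed
    show "sym_form u u \<le> A u u" if "u \<in> D" for u
    proof -
      have "1 * L2_inner M u u \<le> \<beta> * L2_inner M u u"
        using \<beta> L2.B_nonneg[OF D_L2[OF that]] by (intro mult_right_mono) auto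
      then show ?thesis by (simp add: sym_form_self form1_def A_def)
    qed
    show "\<beta> * L2_inner M (\<lambda>x. a * u x + b * v x) f = a * (\<beta> * L2_inner M u f) + b * (\<beta> * L2_inner M v f)"
      if "u \<in> D" "v \<in> D" for a b u v
      using that f by (simp add: L2.B_comb_left D_L2 algebra_simps)
    show "\<bar>\<beta> * L2_inner M v f\<bar> \<le> \<beta> * L2_norm M f * H.nrm v" if "v \<in> D" for v
    proof -
      have "\<bar>L2_inner M v f\<bar> \<le> L2_norm M v * L2_norm M f"
        using L2.cauchy_schwarz[OF D_L2[OF that] f] by (simp add: L2_norm_eq)
      also have "\<dots> \<le> H.nrm v * L2_norm M f"
        using L2_norm_le_nrm[OF that] L2.nrm_nonneg[OF f] by (intro mult_right_mono) (auto simp: L2_norm_eq)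
      finally show ?thesis using \<beta> by (simp add: abs_mult mult_left_mono mult_ac)
    qed
  next
    fix u assume "u \<in> D" "\<And>v. v \<in> D \<Longrightarrow> A v u = \<beta> * L2_inner M v f"
    then show thesis by (rule that)
  qed
  have "\<E> v u = \<beta> * L2_inner M v (\<lambda>x. f x - u x)" if "v \<in> D" for v
    using u(2)[OF that] that u(1) f by (simp add: A_def L2.B_diff_right D_L2 algebra_simps)
  then show ?thesis using u(1) by blast
qed

context
  fixes \<beta> :: real
  assumes \<beta>: "1 \<le> \<beta>"
begin

lemma R_D: "f \<in> L2_space M \<Longrightarrow> R \<beta> f \<in> D"
  and R_eq: "\<lbrakk>f \<in> L2_space M; v \<in> D\<rbrakk> \<Longrightarrow> \<E> v (R \<beta> f) = \<beta> * L2_inner M v (\<lambda>x. f x - R \<beta> f x)"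
  using someI_ex[OF R_exists[OF \<beta>]] unfolding R_def by blast+

lemma R_L2: "f \<in> L2_space M \<Longrightarrow> R \<beta> f \<in> L2_space M"
  using R_D D_L2 by blast

lemma R_meas: "f \<in> L2_space M \<Longrightarrow> R \<beta> f \<in> borel_measurable M"
  using R_D D_meas by blast

lemma R_unique:
  assumes f: "f \<in> L2_space M" and u: "u \<in> D"
    and eq: "\<And>v. v \<in> D \<Longrightarrow> \<E> v u = \<beta> * L2_inner M v (\<lambda>x. f x - u x)"
  shows "AE x in M. R \<beta> f x = u x"
proof -
  define d where "d = (\<lambda>x. R \<beta> f x - u x)"
  have d: "d \<in> D" unfolding d_def by (intro dom_diff R_D f u)
  note L = D_L2[OF u] R_L2[OF f] D_L2[OF d] f
  have "\<E> d d = \<E> d (R \<beta> f) - \<E> d u"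
    using form_diff_right[OF R_D[OF f] u d] by (simp add: d_def)
  also have "\<dots> = - \<beta> * L2_inner M d d"
  proof -
    have "L2_inner M d d = L2_inner M d (R \<beta> f) - L2_inner M d u"
      using L2.B_diff_right[OF L(2,1,3)] by (simp add: d_def)
    then show ?thesis
      unfolding R_eq[OF f d] eq[OF d] L2.B_diff_right[OF L(4,2,3)] L2.B_diff_right[OF L(4,1,3)]
      by (simp add: right_diff_distrib)
  qed
  finally have "\<beta> * L2_inner M d d \<le> 0" using form_nonneg[OF d] by simp
  then have "L2_inner M d d = 0" using L2.B_nonneg[OF L(3)] \<beta> by (simp add: mult_le_0_iff)
  then show ?thesis using L2_inner_self_zero[OF L(3)] by (simp add: d_def)
qed

lemma R_comb:
  assumes f: "f \<in> L2_space M" and g: "g \<in> L2_space M"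
  shows "AE x in M. R \<beta> (\<lambda>y. a * f y + b * g y) x = a * R \<beta> f x + b * R \<beta> g x"
proof (rule R_unique)
  show "\<E> v (\<lambda>x. a * R \<beta> f x + b * R \<beta> g x)
      = \<beta> * L2_inner M v (\<lambda>x. a * f x + b * g x - (a * R \<beta> f x + b * R \<beta> g x))" if v: "v \<in> D" for v
    using f g R_D R_L2 D_L2[OF v] v
    by (simp add: form_comb_right R_eq L2.B_diff_right L2.B_comb_right L2_comb algebra_simps)
qed (use f g in \<open>auto intro: L2_comb D_comb R_D\<close>)

lemma R_const: "AE x in M. R \<beta> (\<lambda>y. c) x = c"
  by (rule R_unique[OF L2_const const_D]) (simp add: form_const_right L2_inner_const_right)

lemma R_generates:
  assumes f: "f \<in> L2_space M"
  shows "generates M P (R \<beta> f) (\<lambda>x. \<beta> * (R \<beta> f x - f x))"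
proof -
  have "\<E> v (R \<beta> f) = - L2_inner M v (\<lambda>x. \<beta> * (R \<beta> f x - f x))" if v: "v \<in> D" for v
    unfolding R_eq[OF f v] L2.B_scale_right[OF L2.V_diff[OF R_L2[OF f] f] D_L2[OF v]]
      L2.B_diff_right[OF f R_L2[OF f] D_L2[OF v]] L2.B_diff_right[OF R_L2[OF f] f D_L2[OF v]]
    by (simp add: right_diff_distrib)
  then show ?thesis using f by (simp add: generates_iff R_D L2.V_scale L2.V_diff R_L2)
qed

lemma R_generator_domain: "f \<in> L2_space M \<Longrightarrow> R \<beta> f \<in> generator_domain M P"
  using R_generates by (auto simp: generator_domain_def)

text \<open>Test the resolvent equation with the excess \<open>d\<close> of \<open>u = R \<beta> f\<close> over its unit contraction. The Dirichlet
  property makes the form nonnegative at \<open>(d, u)\<close>, while \<open>d (f - u) \<le> - d\<^sup>2\<close> pointwise.\<close>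

lemma R_unit_interval:
  assumes f: "f \<in> L2_space M" and f01: "AE x in M. 0 \<le> f x \<and> f x \<le> 1"
  shows "AE x in M. 0 \<le> R \<beta> f x \<and> R \<beta> f x \<le> 1"
proof -
  define u where "u = R \<beta> f"
  define d where "d = (\<lambda>x. u x - unit_contraction u x)"
  have u: "u \<in> D" unfolding u_def by (rule R_D[OF f])
  have c: "unit_contraction u \<in> D" by (rule unit_contraction_dom[OF u])
  have d: "d \<in> D" unfolding d_def by (rule dom_diff[OF u c])
  have "\<E> d (\<lambda>x. u x + unit_contraction u x) = 2 * \<E> d u - \<E> d d"
    using form_add_right[OF d u c] form_diff_right[OF u c d] by (simp add: d_def[symmetric])
  then have "0 \<le> \<E> d u"
    using unit_contraction_right[OF u] form_nonneg[OF d] by (simp add: d_def[symmetric])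
  then have "0 \<le> L2_inner M d (\<lambda>x. f x - u x)"
    using R_eq[OF f d] \<beta> by (simp add: u_def zero_le_mult_iff)
  also have "\<dots> \<le> - L2_inner M d d"
  proof -
    have "(\<integral>x. d x * (f x - u x) \<partial>M) \<le> (\<integral>x. - (d x * d x) \<partial>M)"
    proof (rule integral_mono_AE)
      show "integrable M (\<lambda>x. d x * (f x - u x))"
        by (intro L2_integrable_mult L2.V_diff D_L2 d f u)
      show "integrable M (\<lambda>x. - (d x * d x))"
        by (intro Bochner_Integration.integrable_minus L2_integrable_mult D_L2 d)
      show "AE x in M. d x * (f x - u x) \<le> - (d x * d x)"
        using f01
      proof eventually_elim
        fix x assume x: "0 \<le> f x \<and> f x \<le> 1"
        show "d x * (f x - u x) \<le> - (d x * d x)"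
        proof (cases "u x \<le> 0")
          case True
          then have dx: "d x = u x" by (simp add: d_def unit_contraction_def)
          have "u x * f x \<le> 0" using True x by (simp add: mult_nonpos_nonneg)
          then show ?thesis unfolding dx by (simp add: algebra_simps)
        next
          case False
          show ?thesis
          proof (cases "u x \<le> 1")
            case True
            then show ?thesis using False by (simp add: d_def unit_contraction_def)
          next
            case False
            then have dx: "d x = u x - 1" by (simp add: d_def unit_contraction_def)
            have "(u x - 1) * (f x - 1) \<le> 0" using False x by (simp add: mult_nonneg_nonpos)
            then show ?thesis unfolding dx by (simp add: algebra_simps)
          qed
        qed
      qed
    qed
    then show ?thesis by (simp add: L2_inner_def)
  qed
  finally have "L2_inner M d d = 0" using L2.B_nonneg[OF D_L2[OF d]] by simp
  then have "AE x in M. d x = 0" by (rule L2_inner_self_zero[OF D_L2[OF d]])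
  then show ?thesis
    by eventually_elim (auto simp: d_def unit_contraction_def u_def min_def max_def split: if_splits)
qed

text \<open>Rescale to the unit interval. The interval is enlarged by 1 on one side at a time, because it may consist of
  a single point.\<close>

lemma R_between:
  assumes f: "f \<in> L2_space M" and ab: "AE x in M. a \<le> f x \<and> f x \<le> b"
  shows "AE x in M. a \<le> R \<beta> f x \<and> R \<beta> f x \<le> b"
proof -
  have le: "a \<le> b" by (rule AE_interval_nonempty[OF ab])
  have scale: "AE x in M. c \<le> R \<beta> f x \<and> R \<beta> f x \<le> d" if cd: "c < d" "AE x in M. c \<le> f x \<and> f x \<le> d" for c d
  proof -
    define g where "g = (\<lambda>x. 1 / (d - c) * f x + (- c / (d - c)) * 1)"
    have gL: "g \<in> L2_space M" unfolding g_def by (rule L2_comb[OF f L2_const])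
    have g_eq: "g x = (f x - c) / (d - c)" for x by (simp add: g_def diff_divide_distrib)
    have "AE x in M. 0 \<le> g x \<and> g x \<le> 1"
      using cd(2) by eventually_elim (use cd(1) in \<open>auto simp: g_eq\<close>)
    then have "AE x in M. 0 \<le> R \<beta> g x \<and> R \<beta> g x \<le> 1" by (rule R_unit_interval[OF gL])
    moreover have "AE x in M. R \<beta> g x = 1 / (d - c) * R \<beta> f x + (- c / (d - c)) * R \<beta> (\<lambda>x. 1) x"
      unfolding g_def by (rule R_comb[OF f L2_const])
    moreover have "AE x in M. R \<beta> (\<lambda>x. 1) x = 1" by (rule R_const)
    ultimately show ?thesis
    proof eventually_elim
      case (elim x)
      then have "R \<beta> g x = (R \<beta> f x - c) / (d - c)" by (simp add: diff_divide_distrib)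
      then have "0 \<le> (R \<beta> f x - c) / (d - c) \<and> (R \<beta> f x - c) / (d - c) \<le> 1" using elim(1) by simp
      then show ?case using cd(1) by (simp add: zero_le_divide_iff divide_le_eq_1)
    qed
  qed
  have "AE x in M. a \<le> f x \<and> f x \<le> b + 1" using ab by eventually_elim simp
  then have "AE x in M. a \<le> R \<beta> f x \<and> R \<beta> f x \<le> b + 1" by (rule scale[rotated]) (use le in simp)
  moreover have "AE x in M. a - 1 \<le> f x \<and> f x \<le> b" using ab by eventually_elim simp
  then have "AE x in M. a - 1 \<le> R \<beta> f x \<and> R \<beta> f x \<le> b" by (rule scale[rotated]) (use le in simp)
  ultimately show ?thesis by eventually_elim simp
qed

lemma R_abs_le:
  assumes "f \<in> L2_space M" "AE x in M. \<bar>f x\<bar> \<le> C"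
  shows "AE x in M. \<bar>R \<beta> f x\<bar> \<le> C"
proof -
  have "AE x in M. - C \<le> f x \<and> f x \<le> C" using assms(2) by eventually_elim (simp add: abs_le_iff)
  from R_between[OF assms(1) this] show ?thesis by eventually_elim (simp add: abs_le_iff)
qed

lemma R_mean:
  assumes f: "f \<in> L2_space M" shows "(\<integral>x. R \<beta> f x \<partial>M) = (\<integral>x. f x \<partial>M)"
  using generates_mean_zero[OF R_generates[OF f]] \<beta> f by (simp add: L2_integrable R_L2)

lemma R_energy:
  assumes f: "f \<in> L2_space M"
  shows "\<E> (R \<beta> f) (R \<beta> f) + \<beta> * (L2_norm M (\<lambda>x. f x - R \<beta> f x))\<^sup>2
      = \<beta> * L2_inner M f (\<lambda>x. f x - R \<beta> f x)"
proof -
  have d: "(\<lambda>x. f x - R \<beta> f x) \<in> L2_space M" by (intro L2.V_diff f R_L2)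
  have "L2_inner M (\<lambda>x. f x - R \<beta> f x) (\<lambda>x. f x - R \<beta> f x)
      = L2_inner M f (\<lambda>x. f x - R \<beta> f x) - L2_inner M (R \<beta> f) (\<lambda>x. f x - R \<beta> f x)"
    by (rule L2.B_diff_left[OF f R_L2[OF f] d])
  then show ?thesis
    using R_eq[OF f R_D[OF f]] L2.nrm_square[OF d] by (simp add: L2_norm_eq right_diff_distrib)
qed

lemma R_energy_le:
  assumes f: "f \<in> L2_space M"
  shows "\<E> (R \<beta> f) (R \<beta> f) \<le> \<beta> * L2_inner M f (\<lambda>x. f x - R \<beta> f x)"
proof -
  have "0 \<le> \<beta> * (L2_norm M (\<lambda>x. f x - R \<beta> f x))\<^sup>2" using \<beta> by simp
  then show ?thesis using R_energy[OF f] by linarith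
qed

lemma R_contraction:
  assumes f: "f \<in> L2_space M" shows "L2_norm M (R \<beta> f) \<le> L2_norm M f"
proof -
  define X where "X = L2_norm M (R \<beta> f)"
  have X: "0 \<le> X" using L2.nrm_nonneg[OF R_L2[OF f]] by (simp add: X_def L2_norm_eq)
  have "0 \<le> L2_inner M (R \<beta> f) (\<lambda>x. f x - R \<beta> f x)"
    using R_eq[OF f R_D[OF f]] form_nonneg[OF R_D[OF f]] \<beta> by (simp add: zero_le_mult_iff)
  then have "X * X \<le> L2_inner M (R \<beta> f) f"
    using L2.nrm_square[OF R_L2[OF f]] f
    by (simp add: L2.B_diff_right R_L2 X_def L2_norm_eq power2_eq_square)
  also have "\<dots> \<le> X * L2_norm M f"
    using L2.cauchy_schwarz[OF R_L2[OF f] f] by (simp add: X_def L2_norm_eq)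
  finally have "X = 0 \<or> X \<le> L2_norm M f" using X by (auto simp: mult_le_cancel_left)
  then show ?thesis using L2.nrm_nonneg[OF f] by (auto simp: X_def L2_norm_eq)
qed

end

text \<open>In \<open>\<E>(R f, R f) + \<beta> \<parallel>f - R f\<parallel>\<^sup>2 = \<E>(f, R f)\<close> the right-hand side is linear in the norm of \<open>R f\<close> by the
  sector condition, the left-hand side quadratic.\<close>

lemma R_bounded_energy:
  assumes f: "f \<in> D"
  shows "\<exists>C. \<forall>\<beta>\<ge>1. H.nrm (R \<beta> f) \<le> C \<and> \<beta> * (L2_norm M (\<lambda>x. f x - R \<beta> f x))\<^sup>2 \<le> C"
proof -
  obtain K where K: "0 \<le> K" "\<And>u v. \<lbrakk>u \<in> D; v \<in> D\<rbrakk> \<Longrightarrow> \<bar>\<E> u v\<bar> \<le> K * H.nrm u * H.nrm v"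
    using form_bound by blast
  define a where "a = H.nrm f"
  have a: "0 \<le> a" using f by (simp add: a_def)
  note fL = D_L2[OF f]
  have "H.nrm (R \<beta> f) \<le> (K + 1) * a \<and> \<beta> * (L2_norm M (\<lambda>x. f x - R \<beta> f x))\<^sup>2 \<le> K * a * ((K + 1) * a)"
    if \<beta>: "1 \<le> \<beta>" for \<beta>
  proof -
    define X where "X = H.nrm (R \<beta> f)"
    have RD: "R \<beta> f \<in> D" by (rule R_D[OF \<beta> fL])
    have X: "0 \<le> X" using RD by (simp add: X_def)
    have e: "\<E> (R \<beta> f) (R \<beta> f) + \<beta> * (L2_norm M (\<lambda>x. f x - R \<beta> f x))\<^sup>2 \<le> K * a * X"
      using R_energy[OF \<beta> fL] R_eq[OF \<beta> fL f] K(2)[OF f RD] by (simp add: a_def X_def)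
    have "L2_norm M (R \<beta> f) \<le> a"
      using R_contraction[OF \<beta> fL] L2_norm_le_nrm[OF f] by (simp add: a_def)
    then have "(L2_norm M (R \<beta> f))\<^sup>2 \<le> a * a"
      using L2.nrm_nonneg[OF D_L2[OF RD]] a by (simp add: power2_eq_square mult_mono L2_norm_eq)
    moreover have "0 \<le> \<beta> * (L2_norm M (\<lambda>x. f x - R \<beta> f x))\<^sup>2" using \<beta> by simp
    ultimately have "X * X \<le> K * a * X + a * a"
      using e nrm_sq[OF RD] by (simp add: X_def power2_eq_square)
    (* If X exceeds a, then a * a is at most a * X, and X can be cancelled. *)
    have "X \<le> (K + 1) * a"
    proof (cases "X \<le> a")
      case True
      then show ?thesis using mult_right_mono[of 1 "K + 1" a] K(1) a by simp
    next
      case False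
      then have "a * a \<le> a * X" using a by (intro mult_left_mono) auto
      then have "X * X \<le> (K + 1) * a * X" using \<open>X * X \<le> K * a * X + a * a\<close> by (simp add: algebra_simps)
      then show ?thesis using False a by (simp add: mult_le_cancel_right)
    qed
    moreover have "\<beta> * (L2_norm M (\<lambda>x. f x - R \<beta> f x))\<^sup>2 \<le> K * a * X"
      using e form_nonneg[OF RD] by simp
    moreover have "K * a * X \<le> K * a * ((K + 1) * a)"
      using calculation(1) K(1) a by (intro mult_left_mono) auto
    ultimately show ?thesis by (simp add: X_def)
  qed
  then show ?thesis
    by (intro exI[of _ "max ((K + 1) * a) (K * a * ((K + 1) * a))"]) (auto simp: le_max_iff_disj)
qed

lemma R_tendsto_L2_dom:
  assumes f: "f \<in> D"
  shows "(\<lambda>n. L2_norm M (\<lambda>x. f x - R (real n + 1) f x)) \<longlonglongrightarrow> 0"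
proof -
  obtain C where C: "\<And>\<beta>. 1 \<le> \<beta> \<Longrightarrow> \<beta> * (L2_norm M (\<lambda>x. f x - R \<beta> f x))\<^sup>2 \<le> C"
    using R_bounded_energy[OF f] by blast
  have l0: "(\<lambda>n. C * (1 / (real n + 1))) \<longlonglongrightarrow> 0"
    using tendsto_mult_right_zero[OF LIMSEQ_inverse_real_of_nat] by (simp add: inverse_eq_divide add.commute)
  have "(\<lambda>n. (L2_norm M (\<lambda>x. f x - R (real n + 1) f x))\<^sup>2) \<longlonglongrightarrow> 0"
  proof (rule Lim_null_comparison[OF _ l0])
    have "(L2_norm M (\<lambda>x. f x - R (real n + 1) f x))\<^sup>2 \<le> C * (1 / (real n + 1))" for n
      using C[of "real n + 1"] by (simp add: pos_le_divide_eq mult.commute)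
    then show "\<forall>\<^sub>F n in sequentially. norm ((L2_norm M (\<lambda>x. f x - R (real n + 1) f x))\<^sup>2) \<le> C * (1 / (real n + 1))"
      by simp
  qed
  then show ?thesis by simp
qed

lemma R_tendsto_L2:
  assumes f: "f \<in> L2_space M"
  shows "(\<lambda>n. L2_norm M (\<lambda>x. f x - R (real n + 1) f x)) \<longlonglongrightarrow> 0"
proof (rule LIMSEQ_I)
  fix \<epsilon> :: real assume \<epsilon>: "0 < \<epsilon>"
  obtain u where u: "u \<in> D" "L2_norm M (\<lambda>x. f x - u x) < \<epsilon> / 3"
    using dom_dense[OF f, of "\<epsilon> / 3"] \<epsilon> by auto
  note uL = D_L2[OF u(1)]
  obtain N where N: "\<And>n. N \<le> n \<Longrightarrow> L2_norm M (\<lambda>x. u x - R (real n + 1) u x) < \<epsilon> / 3"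
    using LIMSEQ_D[OF R_tendsto_L2_dom[OF u(1)], of "\<epsilon> / 3"] \<epsilon> by fastforce
  have "norm (L2_norm M (\<lambda>x. f x - R (real n + 1) f x) - 0) < \<epsilon>" if n: "N \<le> n" for n
  proof -
    define \<beta> where "\<beta> = real n + 1"
    have \<beta>: "1 \<le> \<beta>" by (simp add: \<beta>_def)
    note L = R_L2[OF \<beta> f] R_L2[OF \<beta> uL]
    have "L2_norm M (\<lambda>x. f x - R \<beta> f x) \<le> L2_norm M (\<lambda>x. f x - u x) + L2_norm M (\<lambda>x. u x - R \<beta> f x)"
      using L2.nrm_diff_triangle[OF f uL L(1)] by (simp add: L2_norm_eq)
    also have "L2_norm M (\<lambda>x. u x - R \<beta> f x) \<le> L2_norm M (\<lambda>x. u x - R \<beta> u x) + L2_norm M (\<lambda>x. R \<beta> u x - R \<beta> f x)"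
      using L2.nrm_diff_triangle[OF uL L(2,1)] by (simp add: L2_norm_eq)
    also have "L2_norm M (\<lambda>x. R \<beta> u x - R \<beta> f x) \<le> L2_norm M (\<lambda>x. f x - u x)"
    proof -
      have "AE x in M. R \<beta> (\<lambda>x. 1 * u x + (-1) * f x) x = 1 * R \<beta> u x + (-1) * R \<beta> f x"
        by (rule R_comb[OF \<beta> uL f])
      then have ae: "AE x in M. R \<beta> (\<lambda>x. u x - f x) x = R \<beta> u x - R \<beta> f x" by simp
      have "L2_norm M (\<lambda>x. R \<beta> u x - R \<beta> f x) = L2_norm M (R \<beta> (\<lambda>x. u x - f x))"
        unfolding L2_norm_def
        by (intro arg_cong[where f=sqrt] L2_inner_cong_AE)
          (use ae in \<open>auto intro!: R_meas[OF \<beta>] L2.V_diff uL f borel_measurable_diff\<close>)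
      also have "\<dots> \<le> L2_norm M (\<lambda>x. u x - f x)" by (rule R_contraction[OF \<beta> L2.V_diff[OF uL f]])
      also have "\<dots> = L2_norm M (\<lambda>x. f x - u x)" using L2.nrm_minus_commute[OF uL f] by (simp add: L2_norm_eq)
      finally show ?thesis .
    qed
    finally show ?thesis
      using u(2) N[OF n] L2.nrm_nonneg[OF L2.V_diff[OF f L(1)]] by (simp add: \<beta>_def L2_norm_eq)
  qed
  then show "\<exists>N. \<forall>n\<ge>N. norm (L2_norm M (\<lambda>x. f x - R (real n + 1) f x) - 0) < \<epsilon>" by blast
qed

lemma generator_domain_D: "f \<in> generator_domain M P \<Longrightarrow> f \<in> D"
  by (auto simp: generator_domain_def generates_iff)

lemma generates_comb:
  assumes "generates M P f f'" "generates M P g g'"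
  shows "generates M P (\<lambda>x. a * f x + b * g x) (\<lambda>x. a * f' x + b * g' x)"
  using assms by (auto simp: generates_iff D_comb L2_comb form_comb_right L2.B_comb_right D_L2)

lemma generator_domain_dense:
  assumes u: "u \<in> D"
  shows "\<exists>us. (\<forall>n. us n \<in> generator_domain M P) \<and> (\<lambda>n. H.nrm (\<lambda>x. us n x - u x)) \<longlonglongrightarrow> 0"
proof -
  obtain C where C: "\<And>\<beta>. 1 \<le> \<beta> \<Longrightarrow> H.nrm (R \<beta> u) \<le> C"
    using R_bounded_energy[OF u] by blast
  note uL = D_L2[OF u]
  show ?thesis
  proof (rule energy_bounded_limit(3)[where K="C\<^sup>2"])
    show "generator_domain M P \<subseteq> D" using generator_domain_D by blast
    show "(\<lambda>x. 1/2 * f x + 1/2 * g x) \<in> generator_domain M P"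
      if "f \<in> generator_domain M P" "g \<in> generator_domain M P" for f g
      using that generates_comb[of f _ g _ "1/2" "1/2"] unfolding generator_domain_def by blast
    show "u \<in> L2_space M" by (rule uL)
    show "\<exists>v\<in>generator_domain M P. L2_norm M (\<lambda>x. v x - u x) \<le> \<epsilon> \<and> (H.nrm v)\<^sup>2 \<le> C\<^sup>2" if \<epsilon>: "0 < \<epsilon>" for \<epsilon>
    proof -
      obtain n where n: "L2_norm M (\<lambda>x. u x - R (real n + 1) u x) < \<epsilon>"
        using eventually_happens'[OF sequentially_bot order_tendstoD(2)[OF R_tendsto_L2[OF uL] \<epsilon>]] by blast
      have \<beta>: "1 \<le> real n + 1" by simp
      have "(H.nrm (R (real n + 1) u))\<^sup>2 \<le> C\<^sup>2"
        using C[OF \<beta>] R_D[OF \<beta> uL] by (intro power_mono) auto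
      moreover have "L2_norm M (\<lambda>x. R (real n + 1) u x - u x) \<le> \<epsilon>"
        using n L2.nrm_minus_commute[OF R_L2[OF \<beta> uL] uL] by (simp add: L2_norm_eq)
      ultimately show ?thesis using R_generator_domain[OF \<beta> uL] by blast
    qed
  qed
qed

text \<open>For \<open>g\<close> in the domain of the generator, \<open>u \<mapsto> \<E> u g\<close> is continuous in \<open>L\<^sup>2\<close>; such \<open>g\<close> are dense, and
  the bound on the norms makes the error uniform.\<close>

lemma form_tendsto_left_weak:
  assumes us: "\<And>n. us n \<in> D" and w: "w \<in> D" and g: "g \<in> D"
    and lim: "(\<lambda>n. L2_norm M (\<lambda>x. us n x - w x)) \<longlonglongrightarrow> 0"
    and bdd: "\<And>n. H.nrm (us n) \<le> C"
  shows "(\<lambda>n. \<E> (us n) g) \<longlonglongrightarrow> \<E> w g"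
proof (rule LIMSEQ_I)
  fix \<epsilon> :: real assume \<epsilon>: "0 < \<epsilon>"
  obtain K where K: "0 \<le> K" "\<And>u v. \<lbrakk>u \<in> D; v \<in> D\<rbrakk> \<Longrightarrow> \<bar>\<E> u v\<bar> \<le> K * H.nrm u * H.nrm v"
    using form_bound by blast
  define B where "B = K * (\<bar>C\<bar> + H.nrm w) + 1"
  have B: "0 < B" using K(1) w by (simp add: B_def add_nonneg_pos)
  obtain gs where gs: "\<And>n. gs n \<in> generator_domain M P" "(\<lambda>n. H.nrm (\<lambda>x. gs n x - g x)) \<longlonglongrightarrow> 0"
    using generator_domain_dense[OF g] by blast
  have "0 < \<epsilon> / (2 * B)" using \<epsilon> B by simp
  then obtain k where k: "H.nrm (\<lambda>x. gs k x - g x) < \<epsilon> / (2 * B)"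
    using eventually_happens'[OF sequentially_bot order_tendstoD(2)[OF gs(2)]] by blast
  define h where "h = gs k"
  have h: "h \<in> D" "h \<in> generator_domain M P" using gs(1) generator_domain_D by (auto simp: h_def)
  obtain h' where h': "h' \<in> L2_space M" "\<And>v. v \<in> D \<Longrightarrow> \<E> v h = - L2_inner M v h'"
    using h(2) by (auto simp: generator_domain_def generates_iff)
  have "(\<lambda>n. L2_norm M (\<lambda>x. us n x - w x) * L2_norm M h') \<longlonglongrightarrow> 0"
    using tendsto_mult_left_zero[OF lim] .
  then obtain N where N: "\<And>n. N \<le> n \<Longrightarrow> \<bar>L2_norm M (\<lambda>x. us n x - w x) * L2_norm M h'\<bar> < \<epsilon> / 2"
    using LIMSEQ_D[of _ 0 "\<epsilon> / 2"] \<epsilon> by fastforce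
  have "norm (\<E> (us n) g - \<E> w g) < \<epsilon>" if n: "N \<le> n" for n
  proof -
    define d where "d = (\<lambda>x. us n x - w x)"
    have d: "d \<in> D" unfolding d_def by (rule dom_diff[OF us w])
    have "\<E> (us n) g - \<E> w g = \<E> d h - \<E> d (\<lambda>x. h x - g x)"
      using form_diff_left[OF us w g] form_diff_right[OF h(1) g d] by (simp add: d_def)
    moreover have "\<bar>\<E> d h\<bar> < \<epsilon> / 2"
      using N[OF n] L2.cauchy_schwarz[OF D_L2[OF d] h'(1)] h'(2)[OF d] by (simp add: L2_norm_eq d_def)
    moreover have "\<bar>\<E> d (\<lambda>x. h x - g x)\<bar> \<le> \<epsilon> / 2"
    proof -
      have "H.nrm d \<le> \<bar>C\<bar> + H.nrm w"
        using H.nrm_triangle[OF us H.V_scale[OF w, of "-1"], of n] H.nrm_scale[OF w, of "-1"] bdd[of n]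
        by (simp add: d_def)
      then have "K * H.nrm d \<le> B" using K(1) by (simp add: B_def mult_left_mono add_increasing2)
      then have "K * H.nrm d * H.nrm (\<lambda>x. h x - g x) \<le> B * (\<epsilon> / (2 * B))"
        using k d h g B by (intro mult_mono) (auto simp: h_def intro!: H.nrm_nonneg dom_diff)
      then show ?thesis using K(2)[OF d dom_diff[OF h(1) g]] B by simp
    qed
    ultimately show ?thesis unfolding real_norm_def by linarith
  qed
  then show "\<exists>N. \<forall>n\<ge>N. norm (\<E> (us n) g - \<E> w g) < \<epsilon>" by blast
qed

text \<open>For \<open>e = f - R f\<close> one has \<open>\<E>(e, R f) = \<beta> \<parallel>e\<parallel>\<^sup>2 \<ge> 0\<close>, so \<open>\<E>(e, e) \<le> \<E>(e, f)\<close>, and this tends to 0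
  weakly.\<close>

lemma R_tendsto_form:
  assumes f: "f \<in> D"
  shows "(\<lambda>n. H.nrm (\<lambda>x. R (real n + 1) f x - f x)) \<longlonglongrightarrow> 0"
proof -
  note fL = D_L2[OF f]
  have \<beta>: "1 \<le> real n + 1" for n by simp
  define e where "e n = (\<lambda>x. f x - R (real n + 1) f x)" for n
  have e: "e n \<in> D" for n unfolding e_def by (intro dom_diff f R_D[OF \<beta> fL])
  obtain C where C: "\<And>\<beta>. 1 \<le> \<beta> \<Longrightarrow> H.nrm (R \<beta> f) \<le> C"
    using R_bounded_energy[OF f] by blast
  have lim: "(\<lambda>n. L2_norm M (e n)) \<longlonglongrightarrow> 0" unfolding e_def by (rule R_tendsto_L2[OF fL])
  have "(\<lambda>n. \<E> (e n) f) \<longlonglongrightarrow> \<E> (\<lambda>x. 0) f"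
  proof (rule form_tendsto_left_weak[OF e dom_zero f])
    show "(\<lambda>n. L2_norm M (\<lambda>x. e n x - 0)) \<longlonglongrightarrow> 0" using lim by simp
    show "H.nrm (e n) \<le> H.nrm f + C" for n
      using H.nrm_triangle[OF f H.V_scale[OF R_D[OF \<beta> fL], of "-1"], of n] C[OF \<beta>, of n]
        H.nrm_scale[OF R_D[OF \<beta> fL], of "-1" n] by (simp add: e_def)
  qed
  moreover have "\<E> (\<lambda>x. 0) f = 0" using form_scale_left[OF f f, of 0] by simp
  ultimately have "(\<lambda>n. \<E> (e n) f + (L2_norm M (e n))\<^sup>2) \<longlonglongrightarrow> 0 + 0\<^sup>2"
    by (intro tendsto_intros lim) simp
  then have l: "(\<lambda>n. \<E> (e n) f + (L2_norm M (e n))\<^sup>2) \<longlonglongrightarrow> 0" by simp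
  have le: "(H.nrm (e n))\<^sup>2 \<le> \<E> (e n) f + (L2_norm M (e n))\<^sup>2" for n
  proof -
    have "\<E> (e n) (R (real n + 1) f) = (real n + 1) * L2_inner M (e n) (e n)"
      using R_eq[OF \<beta> fL e] by (simp add: e_def)
    then have "0 \<le> \<E> (e n) (R (real n + 1) f)" using L2.B_nonneg[OF D_L2[OF e]] by simp
    moreover have "\<E> (e n) (e n) = \<E> (e n) f - \<E> (e n) (R (real n + 1) f)"
      using form_diff_right[OF f R_D[OF \<beta> fL] e] by (simp add: e_def)
    ultimately show ?thesis by (simp add: nrm_sq e)
  qed
  have "(\<lambda>n. (H.nrm (e n))\<^sup>2) \<longlonglongrightarrow> 0"
    by (rule Lim_null_comparison[OF _ l]) (use le in simp)
  then have "(\<lambda>n. H.nrm (e n)) \<longlonglongrightarrow> 0" by simp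
  then show ?thesis
    using H.nrm_minus_commute[OF f R_D[OF \<beta> fL]] by (simp add: e_def)
qed

lemma form_lower_semicontinuous:
  assumes us: "\<And>n. us n \<in> D" and w: "w \<in> L2_space M"
    and lim: "(\<lambda>n. L2_norm M (\<lambda>x. us n x - w x)) \<longlonglongrightarrow> 0"
    and bdd: "(\<lambda>n. c n) \<longlonglongrightarrow> K" "\<And>n. \<E> (us n) (us n) \<le> c n"
  shows "w \<in> D" and "\<E> w w \<le> K"
proof -
  have *: "w \<in> D \<and> (H.nrm w)\<^sup>2 \<le> K + (L2_norm M w)\<^sup>2 + \<eta>" if \<eta>: "0 < \<eta>" for \<eta>
  proof -
    have "(\<lambda>n. L2_norm M (us n)) \<longlonglongrightarrow> L2_norm M w"
      using L2.nrm_tendsto[of us M w] lim us D_L2 w by (simp add: L2_norm_eq)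
    then have "(\<lambda>n. c n + (L2_norm M (us n))\<^sup>2) \<longlonglongrightarrow> K + (L2_norm M w)\<^sup>2"
      by (intro tendsto_intros bdd)
    then have ev: "\<forall>\<^sub>F n in sequentially. c n + (L2_norm M (us n))\<^sup>2 < K + (L2_norm M w)\<^sup>2 + \<eta>"
      by (rule order_tendstoD) (use \<eta> in simp)
    have "\<exists>u\<in>D. L2_norm M (\<lambda>x. u x - w x) \<le> \<epsilon> \<and> (H.nrm u)\<^sup>2 \<le> K + (L2_norm M w)\<^sup>2 + \<eta>"
      if \<epsilon>: "0 < \<epsilon>" for \<epsilon>
    proof -
      obtain n where "c n + (L2_norm M (us n))\<^sup>2 < K + (L2_norm M w)\<^sup>2 + \<eta>"
        "L2_norm M (\<lambda>x. us n x - w x) < \<epsilon>"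
        using eventually_happens'[OF sequentially_bot eventually_conj[OF ev order_tendstoD(2)[OF lim \<epsilon>]]] by blast
      then show ?thesis using us[of n] bdd(2)[of n] by (intro bexI[of _ "us n"]) (auto simp: nrm_sq)
    qed
    then show ?thesis
      using energy_bounded_limit(1,2)[of D w "K + (L2_norm M w)\<^sup>2 + \<eta>"] D_comb w by blast
  qed
  show wD: "w \<in> D" using *[of 1] by simp
  show "\<E> w w \<le> K"
  proof (rule field_le_epsilon)
    fix \<eta> :: real assume "0 < \<eta>"
    then show "\<E> w w \<le> K + \<eta>" using *[of \<eta>] nrm_sq[OF wD] by simp
  qed
qed

text \<open>The form is the limit of the bounded forms attached to \<open>R\<close>, to which pointwise inequalities apply.\<close>

lemma R_form_tendsto:
  assumes f: "f \<in> D" and v: "v \<in> D"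
  shows "(\<lambda>n. (real n + 1) * L2_inner M v (\<lambda>x. f x - R (real n + 1) f x)) \<longlonglongrightarrow> \<E> v f"
proof -
  have \<beta>: "1 \<le> real n + 1" for n by simp
  have "(\<lambda>n. \<E> v (R (real n + 1) f)) \<longlonglongrightarrow> \<E> v f"
    by (rule form_tendsto[OF R_D[OF \<beta> D_L2[OF f]] f v R_tendsto_form[OF f]])
  then show ?thesis using R_eq[OF \<beta> D_L2[OF f] v] by simp
qed

end

section \<open>Positivity of the kernel of the resolvent\<close>

context prob_space
begin

definition bdd_meas :: "('a \<Rightarrow> real) \<Rightarrow> bool" where
  "bdd_meas f \<longleftrightarrow> f \<in> borel_measurable M \<and> (\<exists>C. \<forall>x\<in>space M. \<bar>f x\<bar> \<le> C)"

lemma bdd_measI: "\<lbrakk>f \<in> borel_measurable M; \<And>x. x \<in> space M \<Longrightarrow> \<bar>f x\<bar> \<le> C\<rbrakk> \<Longrightarrow> bdd_meas f"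
  by (auto simp: bdd_meas_def)

lemma bdd_meas_L2: "bdd_meas f \<Longrightarrow> f \<in> L2_space M"
  by (auto simp: bdd_meas_def intro!: L2_bounded)

lemma bdd_meas_const: "bdd_meas (\<lambda>x. c)"
  by (auto simp: bdd_meas_def)

lemma bdd_meas_add: assumes "bdd_meas f" "bdd_meas g" shows "bdd_meas (\<lambda>x. f x + g x)"
proof -
  obtain C C' where C: "\<And>x. x \<in> space M \<Longrightarrow> \<bar>f x\<bar> \<le> C" "\<And>x. x \<in> space M \<Longrightarrow> \<bar>g x\<bar> \<le> C'"
    using assms by (auto simp: bdd_meas_def)
  show ?thesis
    by (rule bdd_measI[where C="C + C'"])
      (use assms C in \<open>auto simp: bdd_meas_def intro: order_trans[OF abs_triangle_ineq] add_mono\<close>)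
qed

lemma bdd_meas_mult: assumes "bdd_meas f" "bdd_meas g" shows "bdd_meas (\<lambda>x. f x * g x)"
proof -
  obtain C C' where C: "\<And>x. x \<in> space M \<Longrightarrow> \<bar>f x\<bar> \<le> C" "\<And>x. x \<in> space M \<Longrightarrow> \<bar>g x\<bar> \<le> C'"
    using assms by (auto simp: bdd_meas_def)
  have "\<bar>f x * g x\<bar> \<le> C * C'" if "x \<in> space M" for x
    unfolding abs_mult using C(1)[OF that] C(2)[OF that] by (intro mult_mono) auto
  then show ?thesis
    by (intro bdd_measI[where C="C * C'"]) (use assms in \<open>auto simp: bdd_meas_def\<close>)
qed

lemma bdd_meas_minus: "bdd_meas f \<Longrightarrow> bdd_meas (\<lambda>x. - f x)"
  using bdd_meas_mult[OF bdd_meas_const[of "-1"], of f] by simp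

lemma bdd_meas_diff: "\<lbrakk>bdd_meas f; bdd_meas g\<rbrakk> \<Longrightarrow> bdd_meas (\<lambda>x. f x - g x)"
  using bdd_meas_add[OF _ bdd_meas_minus, of f g] by simp

lemma bdd_meas_power2: "bdd_meas f \<Longrightarrow> bdd_meas (\<lambda>x. (f x)\<^sup>2)"
  using bdd_meas_mult[of f f] by (simp add: power2_eq_square)

lemmas bdd_meas_intros = bdd_meas_const bdd_meas_add bdd_meas_mult bdd_meas_minus bdd_meas_diff
  bdd_meas_power2

end

context associated_form
begin

lemma R_sum:
  fixes m :: nat
  assumes \<beta>: "1 \<le> \<beta>" and b: "\<And>i. i < m \<Longrightarrow> b i \<in> L2_space M"
  shows "AE x in M. R \<beta> (\<lambda>y. \<Sum>i<m. c i * b i y) x = (\<Sum>i<m. c i * R \<beta> (b i) x)"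
    and "(\<lambda>y. \<Sum>i<m. c i * b i y) \<in> L2_space M"
proof -
  have "(\<lambda>y. \<Sum>i<m. c i * b i y) \<in> L2_space M \<and>
    (AE x in M. R \<beta> (\<lambda>y. \<Sum>i<m. c i * b i y) x = (\<Sum>i<m. c i * R \<beta> (b i) x))"
    using b
  proof (induction m)
    case 0
    then show ?case using R_const[OF \<beta>, of 0] L2_const by simp
  next
    case (Suc m)
    then have L: "(\<lambda>y. \<Sum>i<m. c i * b i y) \<in> L2_space M" "b m \<in> L2_space M"
      and ae: "AE x in M. R \<beta> (\<lambda>y. \<Sum>i<m. c i * b i y) x = (\<Sum>i<m. c i * R \<beta> (b i) x)" by auto
    have "AE x in M. R \<beta> (\<lambda>y. 1 * (\<Sum>i<m. c i * b i y) + c m * b m y) x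
        = 1 * R \<beta> (\<lambda>y. \<Sum>i<m. c i * b i y) x + c m * R \<beta> (b m) x"
      by (rule R_comb[OF \<beta> L])
    then have "AE x in M. R \<beta> (\<lambda>y. \<Sum>i<Suc m. c i * b i y) x = (\<Sum>i<Suc m. c i * R \<beta> (b i) x)"
      using ae by eventually_elim simp
    then show ?case using L2_comb[OF L, of 1 "c m"] by simp
  qed
  then show "AE x in M. R \<beta> (\<lambda>y. \<Sum>i<m. c i * b i y) x = (\<Sum>i<m. c i * R \<beta> (b i) x)"
    and "(\<lambda>y. \<Sum>i<m. c i * b i y) \<in> L2_space M" by auto
qed

text \<open>Freeze the coefficients \<open>a\<^sub>i(x)\<close>: for fixed numbers \<open>c\<^sub>i\<close>, a lower bound on \<open>\<Sum>\<^sub>i c\<^sub>i b\<^sub>i\<close> passes to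
  \<open>\<Sum>\<^sub>i c\<^sub>i R b\<^sub>i\<close> almost everywhere. The exceptional set depends on the \<open>c\<^sub>i\<close>, so they are restricted to the
  countable grid of multiples of \<open>1 / (k + 1)\<close>; rounding \<open>a\<^sub>i(x)\<close> down to the grid costs at most \<open>e k\<close>,
  which tends to 0.\<close>

lemma kernel_positivity_indexed:
  fixes m :: nat
  assumes \<beta>: "1 \<le> \<beta>"
    and meas: "\<And>i. i < m \<Longrightarrow> a i \<in> borel_measurable M" "\<And>i. i < m \<Longrightarrow> b i \<in> borel_measurable M"
    and bdd: "\<And>i x. \<lbrakk>i < m; x \<in> space M\<rbrakk> \<Longrightarrow> \<bar>a i x\<bar> \<le> C" "\<And>i x. \<lbrakk>i < m; x \<in> space M\<rbrakk> \<Longrightarrow> \<bar>b i x\<bar> \<le> C"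
    and pos: "\<And>x y. \<lbrakk>x \<in> space M; y \<in> space M\<rbrakk> \<Longrightarrow> 0 \<le> (\<Sum>i<m. a i x * b i y)"
    and C: "0 \<le> C"
  shows "0 \<le> (\<Sum>i<m. L2_inner M (a i) (R \<beta> (b i)))"
proof -
  have aL: "a i \<in> L2_space M" and bL: "b i \<in> L2_space M" if "i < m" for i
    using that by (auto intro!: L2_bounded[where C=C] meas bdd)
  define e where "e k = real m * C / (real k + 1)" for k :: nat
  define q where "q z k i = real_of_int (z ! i) / (real k + 1)" for z :: "int list" and k i :: nat
  have zk: "AE x in M. (\<forall>y\<in>space M. - e k \<le> (\<Sum>i<m. q z k i * b i y)) \<longrightarrow>
      - e k \<le> (\<Sum>i<m. q z k i * R \<beta> (b i) x)" for z k
  proof (cases "\<forall>y\<in>space M. - e k \<le> (\<Sum>i<m. q z k i * b i y)")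
    case True
    define B where "B = (\<Sum>i<m. \<bar>q z k i\<bar> * C)"
    have "(\<Sum>i<m. q z k i * b i y) \<le> B" if "y \<in> space M" for y
      unfolding B_def
    proof (rule sum_mono)
      fix i assume "i \<in> {..<m}"
      then have "\<bar>q z k i * b i y\<bar> \<le> \<bar>q z k i\<bar> * C"
        using bdd(2)[of i y] that by (simp add: abs_mult mult_left_mono)
      then show "q z k i * b i y \<le> \<bar>q z k i\<bar> * C" by linarith
    qed
    then have "AE x in M. - e k \<le> R \<beta> (\<lambda>y. \<Sum>i<m. q z k i * b i y) x \<and> R \<beta> (\<lambda>y. \<Sum>i<m. q z k i * b i y) x \<le> B"
      using True by (intro R_between \<beta> R_sum(2) bL) auto
    moreover have "AE x in M. R \<beta> (\<lambda>y. \<Sum>i<m. q z k i * b i y) x = (\<Sum>i<m. q z k i * R \<beta> (b i) x)"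
      by (intro R_sum \<beta> bL)
    ultimately show ?thesis by eventually_elim simp
  next
    case False
    then have "\<And>x. (\<forall>y\<in>space M. - e k \<le> (\<Sum>i<m. q z k i * b i y)) \<longrightarrow>
      - e k \<le> (\<Sum>i<m. q z k i * R \<beta> (b i) x)" by blast
    then show ?thesis by (intro AE_I2)
  qed
  have ae1: "AE x in M. \<forall>z k. (\<forall>y\<in>space M. - e k \<le> (\<Sum>i<m. q z k i * b i y)) \<longrightarrow>
      - e k \<le> (\<Sum>i<m. q z k i * R \<beta> (b i) x)"
    unfolding AE_all_countable using zk by blast
  have "AE x in M. i < m \<longrightarrow> \<bar>R \<beta> (b i) x\<bar> \<le> C" for i
    using R_abs_le[OF \<beta> bL, of i C] bdd(2)[of i] by (cases "i < m") auto
  then have ae2: "AE x in M. \<forall>i. i < m \<longrightarrow> \<bar>R \<beta> (b i) x\<bar> \<le> C"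
    unfolding AE_all_countable by blast
  have "AE x in M. 0 \<le> (\<Sum>i<m. a i x * R \<beta> (b i) x)"
    using ae1 ae2 AE_space
  proof eventually_elim
    fix x
    assume h1: "\<forall>z k. (\<forall>y\<in>space M. - e k \<le> (\<Sum>i<m. q z k i * b i y)) \<longrightarrow>
        - e k \<le> (\<Sum>i<m. q z k i * R \<beta> (b i) x)"
      and h2: "\<forall>i. i < m \<longrightarrow> \<bar>R \<beta> (b i) x\<bar> \<le> C" and x: "x \<in> space M"
    have key: "- 2 * e k \<le> (\<Sum>i<m. a i x * R \<beta> (b i) x)" for k
    proof -
      define z where "z = map (\<lambda>i. \<lfloor>(real k + 1) * a i x\<rfloor>) [0..<m]"
      have close: "\<bar>q z k i - a i x\<bar> \<le> 1 / (real k + 1)" if "i < m" for i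
      proof -
        have "q z k i - a i x = (real_of_int \<lfloor>(real k + 1) * a i x\<rfloor> - (real k + 1) * a i x) / (real k + 1)"
          using that by (simp add: q_def z_def diff_divide_distrib)
        moreover have "\<bar>real_of_int \<lfloor>(real k + 1) * a i x\<rfloor> - (real k + 1) * a i x\<bar> \<le> 1" by linarith
        ultimately show ?thesis by (simp add: divide_right_mono)
      qed
      have err: "\<bar>(\<Sum>i<m. q z k i * s i) - (\<Sum>i<m. a i x * s i)\<bar> \<le> e k"
        if s: "\<And>i. i < m \<Longrightarrow> \<bar>s i\<bar> \<le> C" for s
      proof -
        have "\<bar>\<Sum>i<m. (q z k i - a i x) * s i\<bar> \<le> (\<Sum>i<m. \<bar>(q z k i - a i x) * s i\<bar>)" by (rule sum_abs)
        also have "\<dots> \<le> (\<Sum>i<m. 1 / (real k + 1) * C)"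
          unfolding abs_mult by (intro sum_mono mult_mono) (use close s in auto)
        also have "\<dots> = e k" by (simp add: e_def)
        finally show ?thesis by (simp add: left_diff_distrib sum_subtractf)
      qed
      have "- e k \<le> (\<Sum>i<m. q z k i * b i y)" if y: "y \<in> space M" for y
        using err[of "\<lambda>i. b i y"] bdd(2)[OF _ y] pos[OF x y] by (simp add: abs_le_iff)
      then have "- e k \<le> (\<Sum>i<m. q z k i * R \<beta> (b i) x)" using h1 by blast
      moreover have "\<bar>(\<Sum>i<m. q z k i * R \<beta> (b i) x) - (\<Sum>i<m. a i x * R \<beta> (b i) x)\<bar> \<le> e k"
        by (rule err) (use h2 in blast)
      ultimately show ?thesis by linarith
    qed
    have "(\<lambda>k. - 2 * (real m * C) * (1 / (real k + 1))) \<longlonglongrightarrow> - 2 * (real m * C) * 0"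
      by (intro tendsto_mult tendsto_const) (use LIMSEQ_inverse_real_of_nat in \<open>simp add: inverse_eq_divide add.commute\<close>)
    then have "(\<lambda>k. - 2 * e k) \<longlonglongrightarrow> 0" by (simp add: e_def)
    then show "0 \<le> (\<Sum>i<m. a i x * R \<beta> (b i) x)"
      by (rule LIMSEQ_le_const2) (use key in blast)
  qed
  then have "0 \<le> (\<integral>x. (\<Sum>i<m. a i x * R \<beta> (b i) x) \<partial>M)" by (rule integral_nonneg_AE)
  also have "\<dots> = (\<Sum>i<m. L2_inner M (a i) (R \<beta> (b i)))"
    unfolding L2_inner_def
    by (rule Bochner_Integration.integral_sum) (auto intro!: L2_integrable_mult aL bL R_L2[OF \<beta>])
  finally show ?thesis .
qed

lemma kernel_positivity:
  assumes \<beta>: "1 \<le> \<beta>"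
    and bdd: "\<And>a b. (a, b) \<in> set l \<Longrightarrow> bdd_meas a \<and> bdd_meas b"
    and pos: "\<And>x y. \<lbrakk>x \<in> space M; y \<in> space M\<rbrakk> \<Longrightarrow> 0 \<le> (\<Sum>(a, b)\<leftarrow>l. a x * b y)"
  shows "0 \<le> (\<Sum>(a, b)\<leftarrow>l. L2_inner M a (R \<beta> b))"
proof -
  have "\<forall>p\<in>set l. \<exists>C. \<forall>x\<in>space M. \<bar>fst p x\<bar> \<le> C \<and> \<bar>snd p x\<bar> \<le> C"
  proof
    fix p assume "p \<in> set l"
    then have "bdd_meas (fst p)" "bdd_meas (snd p)" using bdd[of "fst p" "snd p"] by auto
    then obtain C C' where "\<And>x. x \<in> space M \<Longrightarrow> \<bar>fst p x\<bar> \<le> C" "\<And>x. x \<in> space M \<Longrightarrow> \<bar>snd p x\<bar> \<le> C'"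
      by (auto simp: bdd_meas_def)
    then show "\<exists>C. \<forall>x\<in>space M. \<bar>fst p x\<bar> \<le> C \<and> \<bar>snd p x\<bar> \<le> C"
      by (intro exI[of _ "max C C'"]) (auto simp: le_max_iff_disj)
  qed
  then obtain C where C: "\<And>p x. \<lbrakk>p \<in> set l; x \<in> space M\<rbrakk> \<Longrightarrow> \<bar>fst p x\<bar> \<le> C p \<and> \<bar>snd p x\<bar> \<le> C p" by metis
  define K where "K = (\<Sum>p\<in>set l. \<bar>C p\<bar>)"
  have K: "C p \<le> K" if "p \<in> set l" for p
  proof -
    have "\<bar>C p\<bar> \<le> K" unfolding K_def by (rule member_le_sum) (use that in auto)
    then show ?thesis by linarith
  qed
  have nth: "l ! i \<in> set l" if "i < length l" for i using that by simp
  have "0 \<le> (\<Sum>i<length l. L2_inner M (fst (l ! i)) (R \<beta> (snd (l ! i))))"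
  proof (rule kernel_positivity_indexed[OF \<beta>, where C=K])
    fix i assume i: "i < length l"
    show "fst (l ! i) \<in> borel_measurable M" "snd (l ! i) \<in> borel_measurable M"
      using bdd[of "fst (l ! i)" "snd (l ! i)"] nth[OF i] by (auto simp: bdd_meas_def)
    fix x assume x: "x \<in> space M"
    show "\<bar>fst (l ! i) x\<bar> \<le> K" "\<bar>snd (l ! i) x\<bar> \<le> K"
      using C[OF nth[OF i] x] K[OF nth[OF i]] by auto
  next
    fix x y assume "x \<in> space M" "y \<in> space M"
    from pos[OF this] show "0 \<le> (\<Sum>i<length l. fst (l ! i) x * snd (l ! i) y)"
      by (simp add: sum_list_sum_nth case_prod_beta atLeast0LessThan)
  next
    show "0 \<le> K" by (simp add: K_def sum_nonneg)
  qed
  then show ?thesis by (simp add: sum_list_sum_nth case_prod_beta atLeast0LessThan)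
qed

lemma R_one_right: "\<lbrakk>1 \<le> \<beta>; f \<in> L2_space M\<rbrakk> \<Longrightarrow> L2_inner M f (R \<beta> (\<lambda>x. 1)) = (\<integral>x. f x \<partial>M)"
  using L2_inner_cong_AE[OF AE_I2[of M "\<lambda>x. f x = f x"] R_const[of \<beta> 1]]
  by (simp add: L2_spaceD R_meas L2_const L2_inner_const_right)

lemma R_one_left: "\<lbrakk>1 \<le> \<beta>; f \<in> L2_space M\<rbrakk> \<Longrightarrow> L2_inner M (\<lambda>x. 1) (R \<beta> f) = (\<integral>x. f x \<partial>M)"
  by (simp add: L2_inner_const R_mean)

text \<open>The four products in the list add up to \<open>L\<^sup>2 (u(x) - u(y))\<^sup>2 - (w(x) - w(y))\<^sup>2\<close>. The kernel has both
  marginals equal to \<open>\<mu>\<close>, since \<open>R\<close> fixes 1 and preserves means.\<close>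

lemma kernel_contraction:
  assumes \<beta>: "1 \<le> \<beta>" and u: "bdd_meas u" and w: "bdd_meas w"
    and le: "\<And>x y. \<lbrakk>x \<in> space M; y \<in> space M\<rbrakk> \<Longrightarrow> \<bar>w x - w y\<bar> \<le> L * \<bar>u x - u y\<bar>"
  shows "L2_inner M w (\<lambda>x. w x - R \<beta> w x) \<le> L\<^sup>2 * L2_inner M u (\<lambda>x. u x - R \<beta> u x)"
proof -
  note uL = bdd_meas_L2[OF u] and wL = bdd_meas_L2[OF w]
  define d where "d = (\<lambda>x. L\<^sup>2 * (u x * u x) - w x * w x)"
  have d: "bdd_meas d" unfolding d_def by (intro bdd_meas_intros u w)
  have "0 \<le> (\<Sum>(a, b)\<leftarrow>[(d, \<lambda>x. 1), (\<lambda>x. 1, d), (\<lambda>x. (- 2 * L\<^sup>2) * u x, u), (\<lambda>x. 2 * w x, w)].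
      L2_inner M a (R \<beta> b))"
  proof (rule kernel_positivity[OF \<beta>])
    fix x y assume "x \<in> space M" "y \<in> space M"
    then have "\<bar>w x - w y\<bar>\<^sup>2 \<le> (L * \<bar>u x - u y\<bar>)\<^sup>2" by (intro power_mono le) auto
    then show "0 \<le> (\<Sum>(a, b)\<leftarrow>[(d, \<lambda>x. 1), (\<lambda>x. 1, d), (\<lambda>x. (- 2 * L\<^sup>2) * u x, u), (\<lambda>x. 2 * w x, w)]. a x * b y)"
      by (simp add: d_def power_mult_distrib power2_diff algebra_simps power2_eq_square)
  qed (auto intro!: bdd_meas_intros d u w)
  then have "0 \<le> 2 * (\<integral>x. d x \<partial>M) - 2 * L\<^sup>2 * L2_inner M u (R \<beta> u) + 2 * L2_inner M w (R \<beta> w)"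
    using R_one_right[OF \<beta> bdd_meas_L2[OF d]] R_one_left[OF \<beta> bdd_meas_L2[OF d]]
    by (simp only: list.map sum_list.Cons sum_list.Nil prod.case
        L2.B_scale_left[OF uL R_L2[OF \<beta> uL]] L2.B_scale_left[OF wL R_L2[OF \<beta> wL]])
  also have "(\<integral>x. d x \<partial>M) = L\<^sup>2 * L2_inner M u u - L2_inner M w w"
    unfolding d_def L2_inner_def using L2_integrable_mult[OF uL uL] L2_integrable_mult[OF wL wL] by simp
  finally show ?thesis
    unfolding L2.B_diff_right[OF wL R_L2[OF \<beta> wL] wL] L2.B_diff_right[OF uL R_L2[OF \<beta> uL] uL]
    by (simp add: algebra_simps)
qed

lemma form_contraction_pointwise:
  assumes u: "u \<in> D" "bdd_meas u" and w: "bdd_meas w"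
    and le: "\<And>x y. \<lbrakk>x \<in> space M; y \<in> space M\<rbrakk> \<Longrightarrow> \<bar>w x - w y\<bar> \<le> L * \<bar>u x - u y\<bar>"
  shows "w \<in> D" "\<E> w w \<le> L\<^sup>2 * \<E> u u"
proof -
  note wL = bdd_meas_L2[OF w]
  have \<beta>: "1 \<le> real n + 1" for n by simp
  have 1: "R (real n + 1) w \<in> D" for n by (rule R_D[OF \<beta> wL])
  have 2: "(\<lambda>n. L2_norm M (\<lambda>x. R (real n + 1) w x - w x)) \<longlonglongrightarrow> 0"
    using R_tendsto_L2[OF wL] L2.nrm_minus_commute[OF wL R_L2[OF \<beta> wL]] by (simp add: L2_norm_eq)
  have 3: "(\<lambda>n. L\<^sup>2 * ((real n + 1) * L2_inner M u (\<lambda>x. u x - R (real n + 1) u x))) \<longlonglongrightarrow> L\<^sup>2 * \<E> u u"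
    by (intro tendsto_mult_left R_form_tendsto u)
  have 4: "\<E> (R (real n + 1) w) (R (real n + 1) w)
      \<le> L\<^sup>2 * ((real n + 1) * L2_inner M u (\<lambda>x. u x - R (real n + 1) u x))" for n
  proof -
    note R_energy_le[OF \<beta> wL, of n]
    also have "(real n + 1) * L2_inner M w (\<lambda>x. w x - R (real n + 1) w x)
        \<le> (real n + 1) * (L\<^sup>2 * L2_inner M u (\<lambda>x. u x - R (real n + 1) u x))"
      by (intro mult_left_mono kernel_contraction[OF \<beta> u(2) w le]) auto
    finally show ?thesis by (simp only: mult.left_commute)
  qed
  show "w \<in> D" "\<E> w w \<le> L\<^sup>2 * \<E> u u"
    using form_lower_semicontinuous[OF 1 wL 2 3 4] by auto
qed

definition clamp_to :: "real \<Rightarrow> real \<Rightarrow> real \<Rightarrow> real" where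
  "clamp_to a b t = max a (min b t)"

lemma clamp_to_mem: "a \<le> b \<Longrightarrow> clamp_to a b t \<in> {a..b}"
  by (auto simp: clamp_to_def)

lemma clamp_to_id: "t \<in> {a..b} \<Longrightarrow> clamp_to a b t = t"
  by (auto simp: clamp_to_def)

text \<open>Pointwise inequalities are used at every point, so a function with values in an interval almost everywhere
  is replaced by one with values there everywhere.\<close>

lemma clamp_representative:
  assumes u: "u \<in> D" and ab: "AE x in M. a \<le> u x \<and> u x \<le> b"
  shows "(\<lambda>x. clamp_to a b (u x)) \<in> D" "AE x in M. u x = clamp_to a b (u x)"
    "bdd_meas (\<lambda>x. clamp_to a b (u x))"
proof -
  have le: "a \<le> b" by (rule AE_interval_nonempty[OF ab])
  have m: "(\<lambda>x. clamp_to a b (u x)) \<in> borel_measurable M"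
    using D_meas[OF u] unfolding clamp_to_def by measurable
  show ae: "AE x in M. u x = clamp_to a b (u x)"
    using ab by eventually_elim (simp add: clamp_to_id)
  show "(\<lambda>x. clamp_to a b (u x)) \<in> D" by (rule dom_AE[OF u m ae])
  have "\<bar>clamp_to a b (u x)\<bar> \<le> \<bar>a\<bar> + \<bar>b\<bar>" for x using clamp_to_mem[OF le, of "u x"] by auto
  then show "bdd_meas (\<lambda>x. clamp_to a b (u x))" using m by (intro bdd_measI)
qed

lemma form_contraction:
  assumes u: "u \<in> D" and ab: "AE x in M. a \<le> u x \<and> u x \<le> b"
    and \<phi>: "\<phi> \<in> borel_measurable borel"
    and lip: "\<And>s t. \<lbrakk>s \<in> {a..b}; t \<in> {a..b}\<rbrakk> \<Longrightarrow> \<bar>\<phi> s - \<phi> t\<bar> \<le> L * \<bar>s - t\<bar>"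
  shows "(\<lambda>x. \<phi> (u x)) \<in> D" "\<E> (\<lambda>x. \<phi> (u x)) (\<lambda>x. \<phi> (u x)) \<le> L\<^sup>2 * \<E> u u"
proof -
  have le: "a \<le> b" by (rule AE_interval_nonempty[OF ab])
  define v where "v = (\<lambda>x. clamp_to a b (u x))"
  note v = clamp_representative[OF u ab, folded v_def]
  have v2: "AE x in M. u x = v x" using v(2) by (simp add: v_def)
  have v_mem: "v x \<in> {a..b}" for x using clamp_to_mem[OF le] by (simp add: v_def)
  have m: "(\<lambda>x. \<phi> (v x)) \<in> borel_measurable M" "(\<lambda>x. \<phi> (u x)) \<in> borel_measurable M"
    using D_meas[OF v(1)] D_meas[OF u] \<phi> by measurable
  have w: "bdd_meas (\<lambda>x. \<phi> (v x))"
  proof (rule bdd_measI[OF m(1)])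
    fix x
    have "\<bar>\<phi> (v x) - \<phi> a\<bar> \<le> L * \<bar>v x - a\<bar>" using lip[OF v_mem, of a x] le by simp
    also have "\<dots> \<le> \<bar>L\<bar> * (b - a)" using v_mem[of x] by (intro mult_mono) auto
    finally show "\<bar>\<phi> (v x)\<bar> \<le> \<bar>\<phi> a\<bar> + \<bar>L\<bar> * (b - a)" by linarith
  qed
  have c: "(\<lambda>x. \<phi> (v x)) \<in> D" "\<E> (\<lambda>x. \<phi> (v x)) (\<lambda>x. \<phi> (v x)) \<le> L\<^sup>2 * \<E> v v"
    using form_contraction_pointwise[OF v(1,3) w, of L] lip v_mem by blast+
  have ae: "AE x in M. \<phi> (v x) = \<phi> (u x)" using v2 by eventually_elim simp
  show D: "(\<lambda>x. \<phi> (u x)) \<in> D" by (rule dom_AE[OF c(1) m(2) ae])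
  show "\<E> (\<lambda>x. \<phi> (u x)) (\<lambda>x. \<phi> (u x)) \<le> L\<^sup>2 * \<E> u u"
    using c(2) form_AE[OF c(1) D c(1) D ae ae] form_AE[OF u v(1) u v(1) v2 v2] by simp
qed

lemma form_square:
  assumes u: "u \<in> D" and C: "AE x in M. \<bar>u x\<bar> \<le> C"
  shows "(\<lambda>x. (u x)\<^sup>2) \<in> D" "\<E> (\<lambda>x. (u x)\<^sup>2) (\<lambda>x. (u x)\<^sup>2) \<le> 4 * C\<^sup>2 * \<E> u u"
proof -
  have ab: "AE x in M. - C \<le> u x \<and> u x \<le> C" using C by eventually_elim (simp add: abs_le_iff)
  have lip: "\<bar>s\<^sup>2 - t\<^sup>2\<bar> \<le> (2 * C) * \<bar>s - t\<bar>" if "s \<in> {-C..C}" "t \<in> {-C..C}" for s t :: real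
  proof -
    have "s\<^sup>2 - t\<^sup>2 = (s + t) * (s - t)" by (simp add: power2_eq_square algebra_simps)
    then show ?thesis using that by (auto simp: abs_mult intro!: mult_right_mono)
  qed
  show "(\<lambda>x. (u x)\<^sup>2) \<in> D" "\<E> (\<lambda>x. (u x)\<^sup>2) (\<lambda>x. (u x)\<^sup>2) \<le> 4 * C\<^sup>2 * \<E> u u"
    using form_contraction[OF u ab, of "\<lambda>t. t\<^sup>2" "2 * C"] lip by (simp_all add: power_mult_distrib)
qed

lemma form_mult:
  assumes u: "u \<in> D" "AE x in M. \<bar>u x\<bar> \<le> C" and v: "v \<in> D" "AE x in M. \<bar>v x\<bar> \<le> C"
  shows "(\<lambda>x. u x * v x) \<in> D" "\<E> (\<lambda>x. u x * v x) (\<lambda>x. u x * v x) \<le> 4 * C\<^sup>2 * (\<E> u u + \<E> v v)"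
proof -
  define p where "p = (\<lambda>x. u x + v x)"
  define m where "m = (\<lambda>x. u x - v x)"
  have p: "p \<in> D" and m: "m \<in> D" unfolding p_def m_def by (intro dom_add dom_diff u v)+
  have pC: "AE x in M. \<bar>p x\<bar> \<le> 2 * C" and mC: "AE x in M. \<bar>m x\<bar> \<le> 2 * C"
    using u(2) v(2) by (eventually_elim, simp add: p_def m_def)+
  note sp = form_square[OF p pC] and sm = form_square[OF m mC]
  (* Polarisation reduces products to squares, which are Lipschitz functions on bounded ranges. *)
  have eq: "(\<lambda>x. u x * v x) = (\<lambda>x. 1/4 * (p x)\<^sup>2 + (-1/4) * (m x)\<^sup>2)"
    by (rule ext) (simp add: p_def m_def power2_eq_square algebra_simps)
  show "(\<lambda>x. u x * v x) \<in> D" unfolding eq by (rule D_comb[OF sp(1) sm(1)])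
  have "\<E> (\<lambda>x. u x * v x) (\<lambda>x. u x * v x)
      \<le> 2 * ((1/4)\<^sup>2 * \<E> (\<lambda>x. (p x)\<^sup>2) (\<lambda>x. (p x)\<^sup>2)) + 2 * ((-1/4)\<^sup>2 * \<E> (\<lambda>x. (m x)\<^sup>2) (\<lambda>x. (m x)\<^sup>2))"
    using form_sum_le[OF dom_scale[OF sp(1)] dom_scale[OF sm(1)]]
    unfolding eq form_scale_both[OF sp(1)] form_scale_both[OF sm(1)] .
  also have "\<dots> \<le> 2 * ((1/4)\<^sup>2 * (4 * (2 * C)\<^sup>2 * \<E> p p)) + 2 * ((-1/4)\<^sup>2 * (4 * (2 * C)\<^sup>2 * \<E> m m))"
    using sp(2) sm(2) by (intro add_mono mult_left_mono) auto
  also have "\<dots> = 2 * C\<^sup>2 * (\<E> p p + \<E> m m)" by (simp add: power2_eq_square algebra_simps)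
  also have "\<E> p p + \<E> m m = 2 * (\<E> u u + \<E> v v)"
    unfolding p_def m_def using u v
    by (simp add: form_add_left form_add_right form_diff_left form_diff_right dom_add dom_diff)
  finally show "\<E> (\<lambda>x. u x * v x) (\<lambda>x. u x * v x) \<le> 4 * C\<^sup>2 * (\<E> u u + \<E> v v)" by (simp add: algebra_simps)
qed

text \<open>Integrating \<open>w(x)\<^sup>2 (u(x) - u(y))\<^sup>2\<close> against the kernel of \<open>R\<close> gives
  \<open>2 \<mu>(w\<^sup>2 u (u - R u)) - \<mu>(w\<^sup>2 (u\<^sup>2 - R u\<^sup>2))\<close>, and after multiplication by \<open>\<beta>\<close> this tends to the
  bracket on the right: the integral of \<open>w\<^sup>2\<close> against twice the energy measure of \<open>u\<close>. In both terms of the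
  bracket the small function \<open>w\<^sup>2\<close> is in the first argument, where weak convergence is available.\<close>

lemma form_four_point:
  assumes u: "u \<in> D" "bdd_meas u" and w: "w \<in> D" "bdd_meas w" and F: "F \<in> D" "bdd_meas F"
    and le: "\<And>x y. \<lbrakk>x \<in> space M; y \<in> space M\<rbrakk>
      \<Longrightarrow> (F x - F y)\<^sup>2 \<le> A * (w x - w y)\<^sup>2 + B * ((w x)\<^sup>2 * (u x - u y)\<^sup>2)"
    and w2: "(\<lambda>x. (w x)\<^sup>2) \<in> D" "(\<lambda>x. (u x)\<^sup>2) \<in> D" "(\<lambda>x. (w x)\<^sup>2 * u x) \<in> D"
  shows "2 * \<E> F F \<le> 2 * A * \<E> w w + B * (2 * \<E> (\<lambda>x. (w x)\<^sup>2 * u x) u - \<E> (\<lambda>x. (w x)\<^sup>2) (\<lambda>x. (u x)\<^sup>2))"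
proof -
  have \<beta>n: "1 \<le> real n + 1" for n by simp
  have main: "2 * L2_inner M F (\<lambda>x. F x - R \<beta> F x) \<le> 2 * A * L2_inner M w (\<lambda>x. w x - R \<beta> w x)
      + B * (2 * L2_inner M (\<lambda>x. (w x)\<^sup>2 * u x) (\<lambda>x. u x - R \<beta> u x)
        - L2_inner M (\<lambda>x. (w x)\<^sup>2) (\<lambda>x. (u x)\<^sup>2 - R \<beta> (\<lambda>x. (u x)\<^sup>2) x))" if \<beta>: "1 \<le> \<beta>" for \<beta>
  proof -
    define d1 where "d1 = (\<lambda>x. A * (w x * w x) + B * ((w x)\<^sup>2 * u x * u x) - F x * F x)"
    define d2 where "d2 = (\<lambda>x. A * (w x * w x) - F x * F x)"
    define W where "W = (\<lambda>x. (w x)\<^sup>2)"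
    define U where "U = (\<lambda>x. (u x)\<^sup>2)"
    define Wu where "Wu = (\<lambda>x. (w x)\<^sup>2 * u x)"
    have d: "bdd_meas d1" "bdd_meas d2" unfolding d1_def d2_def by (intro bdd_meas_intros u w F)+
    have b: "bdd_meas W" "bdd_meas U" "bdd_meas Wu" unfolding W_def U_def Wu_def by (intro bdd_meas_intros u w)+
    note L = bdd_meas_L2[OF u(2)] bdd_meas_L2[OF w(2)] bdd_meas_L2[OF F(2)] bdd_meas_L2[OF b(1)]
      bdd_meas_L2[OF b(2)] bdd_meas_L2[OF b(3)]
    have "0 \<le> (\<Sum>(a, b)\<leftarrow>[(d1, \<lambda>x. 1), (\<lambda>x. 1, d2), (\<lambda>x. (- 2 * A) * w x, w), (\<lambda>x. 2 * F x, F),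
        (\<lambda>x. (- 2 * B) * Wu x, u), (\<lambda>x. B * W x, U)]. L2_inner M a (R \<beta> b))"
    proof (rule kernel_positivity[OF \<beta>])
      fix x y assume "x \<in> space M" "y \<in> space M"
      from le[OF this]
      show "0 \<le> (\<Sum>(a, b)\<leftarrow>[(d1, \<lambda>x. 1), (\<lambda>x. 1, d2), (\<lambda>x. (- 2 * A) * w x, w), (\<lambda>x. 2 * F x, F),
        (\<lambda>x. (- 2 * B) * Wu x, u), (\<lambda>x. B * W x, U)]. a x * b y)"
        by (simp add: d1_def d2_def W_def U_def Wu_def power2_diff algebra_simps power2_eq_square)
    qed (auto intro!: bdd_meas_intros d b u w F)
    then have "0 \<le> (\<integral>x. d1 x \<partial>M) + (\<integral>x. d2 x \<partial>M) - 2 * A * L2_inner M w (R \<beta> w) + 2 * L2_inner M F (R \<beta> F)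
        - 2 * B * L2_inner M Wu (R \<beta> u) + B * L2_inner M W (R \<beta> U)"
      using R_one_right[OF \<beta> bdd_meas_L2[OF d(1)]] R_one_left[OF \<beta> bdd_meas_L2[OF d(2)]]
      by (simp only: list.map sum_list.Cons sum_list.Nil prod.case L2.B_scale_left[OF L(2) R_L2[OF \<beta> L(2)]]
          L2.B_scale_left[OF L(3) R_L2[OF \<beta> L(3)]] L2.B_scale_left[OF L(6) R_L2[OF \<beta> L(1)]]
          L2.B_scale_left[OF L(4) R_L2[OF \<beta> L(5)]])
    also have "(\<integral>x. d1 x \<partial>M) = A * L2_inner M w w + B * L2_inner M Wu u - L2_inner M F F"
      unfolding d1_def L2_inner_def Wu_def
      using L2_integrable_mult[OF L(2,2)] L2_integrable_mult[OF L(6,1)] L2_integrable_mult[OF L(3,3)]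
      by (simp add: Wu_def)
    also have "(\<integral>x. d2 x \<partial>M) = A * L2_inner M w w - L2_inner M F F"
      unfolding d2_def L2_inner_def
      using L2_integrable_mult[OF L(2,2)] L2_integrable_mult[OF L(3,3)] by simp
    finally have "0 \<le> 2 * A * L2_inner M w w + B * L2_inner M Wu u - 2 * L2_inner M F F
        - 2 * A * L2_inner M w (R \<beta> w) + 2 * L2_inner M F (R \<beta> F)
        - 2 * B * L2_inner M Wu (R \<beta> u) + B * L2_inner M W (R \<beta> U)" by simp
    moreover have "L2_inner M W U = L2_inner M Wu u"
      by (simp add: L2_inner_def W_def U_def Wu_def power2_eq_square mult_ac)
    ultimately have "2 * L2_inner M F (\<lambda>x. F x - R \<beta> F x) \<le> 2 * A * L2_inner M w (\<lambda>x. w x - R \<beta> w x)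
      + B * (2 * L2_inner M Wu (\<lambda>x. u x - R \<beta> u x) - L2_inner M W (\<lambda>x. U x - R \<beta> U x))"
      by (simp add: L2.B_diff_right L R_L2[OF \<beta>] algebra_simps)
    then show ?thesis by (simp add: W_def U_def Wu_def)
  qed
  have l1: "(\<lambda>n. 2 * ((real n + 1) * L2_inner M F (\<lambda>x. F x - R (real n + 1) F x))) \<longlonglongrightarrow> 2 * \<E> F F"
    by (intro tendsto_intros R_form_tendsto F)
  have l2: "(\<lambda>n. 2 * A * ((real n + 1) * L2_inner M w (\<lambda>x. w x - R (real n + 1) w x))
      + B * (2 * ((real n + 1) * L2_inner M (\<lambda>x. (w x)\<^sup>2 * u x) (\<lambda>x. u x - R (real n + 1) u x))
        - (real n + 1) * L2_inner M (\<lambda>x. (w x)\<^sup>2) (\<lambda>x. (u x)\<^sup>2 - R (real n + 1) (\<lambda>x. (u x)\<^sup>2) x)))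
      \<longlonglongrightarrow> 2 * A * \<E> w w + B * (2 * \<E> (\<lambda>x. (w x)\<^sup>2 * u x) u - \<E> (\<lambda>x. (w x)\<^sup>2) (\<lambda>x. (u x)\<^sup>2))"
    by (intro tendsto_intros R_form_tendsto u w w2)
  show ?thesis
  proof (rule LIMSEQ_le[OF l1 l2], intro exI allI impI)
    fix n :: nat
    show "2 * ((real n + 1) * L2_inner M F (\<lambda>x. F x - R (real n + 1) F x))
      \<le> 2 * A * ((real n + 1) * L2_inner M w (\<lambda>x. w x - R (real n + 1) w x))
      + B * (2 * ((real n + 1) * L2_inner M (\<lambda>x. (w x)\<^sup>2 * u x) (\<lambda>x. u x - R (real n + 1) u x))
        - (real n + 1) * L2_inner M (\<lambda>x. (w x)\<^sup>2) (\<lambda>x. (u x)\<^sup>2 - R (real n + 1) (\<lambda>x. (u x)\<^sup>2) x))"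
      using mult_left_mono[OF main[OF \<beta>n[of n]], of "real n + 1"] by (simp only: distrib_left right_diff_distrib mult_ac)
  qed
qed

end

section \<open>Smooth functions operate continuously on the form domain\<close>

lemma derivative_bound_lipschitz:
  fixes \<phi> \<phi>' :: "real \<Rightarrow> real"
  assumes der: "\<And>t. t \<in> {a..b} \<Longrightarrow> (\<phi> has_real_derivative \<phi>' t) (at t)"
    and bd: "\<And>t. t \<in> {a..b} \<Longrightarrow> \<bar>\<phi>' t\<bar> \<le> L"
    and st: "s \<in> {a..b}" "t \<in> {a..b}"
  shows "\<bar>\<phi> s - \<phi> t\<bar> \<le> L * \<bar>s - t\<bar>"
proof -
  have *: "\<bar>\<phi> s - \<phi> t\<bar> \<le> L * \<bar>s - t\<bar>" if lt: "s < t" and in_ab: "s \<in> {a..b}" "t \<in> {a..b}" for s t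
  proof -
    obtain z where z: "s < z" "z < t" "\<phi> t - \<phi> s = (t - s) * \<phi>' z"
      using MVT2[OF lt, of \<phi> \<phi>'] der in_ab by auto
    then have "\<bar>\<phi> t - \<phi> s\<bar> = \<bar>t - s\<bar> * \<bar>\<phi>' z\<bar>" by (simp add: abs_mult)
    also have "\<dots> \<le> \<bar>t - s\<bar> * L" using bd[of z] z in_ab by (intro mult_left_mono) auto
    finally show ?thesis by (simp add: abs_minus_commute mult.commute)
  qed
  show ?thesis
    using *[of s t] *[of t s] st by (cases s t rule: linorder_cases) (auto simp: abs_minus_commute)
qed

text \<open>Apply the mean value theorem to \<open>\<xi> \<mapsto> \<phi>(x + \<xi> (x' - x)) - \<phi>(y + \<xi> (y' - y))\<close>. With values of
  \<open>u\<close> and \<open>u + w\<close> at two points in place of \<open>x\<close>, \<open>x'\<close> and of \<open>y\<close>, \<open>y'\<close>, the result has exactly the two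
  terms that \<open>form_four_point\<close> can integrate.\<close>

lemma four_point_bound:
  fixes \<phi> \<phi>' :: "real \<Rightarrow> real"
  assumes der: "\<And>t. t \<in> {a..b} \<Longrightarrow> (\<phi> has_real_derivative \<phi>' t) (at t)"
    and L1: "\<And>t. t \<in> {a..b} \<Longrightarrow> \<bar>\<phi>' t\<bar> \<le> L1"
    and L2: "\<And>s t. \<lbrakk>s \<in> {a..b}; t \<in> {a..b}\<rbrakk> \<Longrightarrow> \<bar>\<phi>' s - \<phi>' t\<bar> \<le> L2 * \<bar>s - t\<bar>"
    and L2_nonneg: "0 \<le> L2"
    and ab: "x \<in> {a..b}" "x' \<in> {a..b}" "y \<in> {a..b}" "y' \<in> {a..b}"
  shows "((\<phi> x' - \<phi> x) - (\<phi> y' - \<phi> y))\<^sup>2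
     \<le> 2 * (L1 + L2 * (b - a))\<^sup>2 * ((x' - x) - (y' - y))\<^sup>2 + 2 * L2\<^sup>2 * ((x' - x)\<^sup>2 * (x - y)\<^sup>2)"
proof -
  define w where "w = x' - x"
  define v where "v = y' - y"
  have mem: "z + \<xi> * (z' - z) \<in> {a..b}" if "z \<in> {a..b}" "z' \<in> {a..b}" "0 \<le> \<xi>" "\<xi> \<le> 1" for z z' \<xi>
  proof -
    have "(1 - \<xi>) * z + \<xi> * z' \<in> {a..b}"
      using convexD[of "{a..b}" z z' "1 - \<xi>" \<xi>] that by simp
    then show ?thesis by (simp add: algebra_simps)
  qed
  have "\<exists>\<xi>. 0 < \<xi> \<and> \<xi> < 1 \<and> (\<phi> (x + 1 * w) - \<phi> (y + 1 * v)) - (\<phi> (x + 0 * w) - \<phi> (y + 0 * v))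
      = (1 - 0) * (\<phi>' (x + \<xi> * w) * w - \<phi>' (y + \<xi> * v) * v)"
  proof (rule MVT2)
    fix \<xi> :: real assume "0 \<le> \<xi>" "\<xi> \<le> 1"
    then have "x + \<xi> * w \<in> {a..b}" "y + \<xi> * v \<in> {a..b}"
      using mem[of x x' \<xi>] mem[of y y' \<xi>] ab by (auto simp: w_def v_def)
    then show "((\<lambda>\<xi>. \<phi> (x + \<xi> * w) - \<phi> (y + \<xi> * v)) has_real_derivative
        (\<phi>' (x + \<xi> * w) * w - \<phi>' (y + \<xi> * v) * v)) (at \<xi>)"
      by (auto intro!: derivative_eq_intros DERIV_chain2[OF der])
  qed simp
  then obtain \<xi> where \<xi>: "0 < \<xi>" "\<xi> < 1"
    and eq: "(\<phi> x' - \<phi> x) - (\<phi> y' - \<phi> y) = \<phi>' (x + \<xi> * w) * w - \<phi>' (y + \<xi> * v) * v"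
    by (auto simp: w_def v_def algebra_simps)
  have in1: "x + \<xi> * w \<in> {a..b}" "y + \<xi> * v \<in> {a..b}"
    using mem[of x x' \<xi>] mem[of y y' \<xi>] ab \<xi> by (auto simp: w_def v_def)
  have wab: "\<bar>w\<bar> \<le> b - a" using ab by (auto simp: w_def)
  have "(\<phi> x' - \<phi> x) - (\<phi> y' - \<phi> y)
      = \<phi>' (y + \<xi> * v) * (w - v) + w * (\<phi>' (x + \<xi> * w) - \<phi>' (y + \<xi> * v))"
    unfolding eq by (simp add: algebra_simps)
  then have "\<bar>(\<phi> x' - \<phi> x) - (\<phi> y' - \<phi> y)\<bar>
      \<le> \<bar>\<phi>' (y + \<xi> * v)\<bar> * \<bar>w - v\<bar> + \<bar>w\<bar> * \<bar>\<phi>' (x + \<xi> * w) - \<phi>' (y + \<xi> * v)\<bar>"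
    by (metis abs_mult abs_triangle_ineq)
  also have "\<dots> \<le> L1 * \<bar>w - v\<bar> + \<bar>w\<bar> * (L2 * (\<bar>x - y\<bar> + \<bar>w - v\<bar>))"
  proof (intro add_mono mult_right_mono mult_left_mono)
    show "\<bar>\<phi>' (y + \<xi> * v)\<bar> \<le> L1" by (rule L1[OF in1(2)])
    have "\<bar>\<phi>' (x + \<xi> * w) - \<phi>' (y + \<xi> * v)\<bar> \<le> L2 * \<bar>(x + \<xi> * w) - (y + \<xi> * v)\<bar>" by (rule L2[OF in1])
    also have "\<dots> \<le> L2 * (\<bar>x - y\<bar> + \<bar>w - v\<bar>)"
    proof (rule mult_left_mono[OF _ L2_nonneg])
      have "(x + \<xi> * w) - (y + \<xi> * v) = (x - y) + \<xi> * (w - v)" by (simp add: algebra_simps)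
      then have "\<bar>(x + \<xi> * w) - (y + \<xi> * v)\<bar> \<le> \<bar>x - y\<bar> + \<bar>\<xi> * (w - v)\<bar>"
        by (simp only: abs_triangle_ineq)
      also have "\<bar>\<xi> * (w - v)\<bar> \<le> 1 * \<bar>w - v\<bar>"
        unfolding abs_mult using \<xi> by (intro mult_right_mono) auto
      finally show "\<bar>(x + \<xi> * w) - (y + \<xi> * v)\<bar> \<le> \<bar>x - y\<bar> + \<bar>w - v\<bar>" by simp
    qed
    finally show "\<bar>\<phi>' (x + \<xi> * w) - \<phi>' (y + \<xi> * v)\<bar> \<le> L2 * (\<bar>x - y\<bar> + \<bar>w - v\<bar>)" .
  qed auto
  also have "\<dots> \<le> (L1 + L2 * (b - a)) * \<bar>w - v\<bar> + L2 * \<bar>w\<bar> * \<bar>x - y\<bar>"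
  proof -
    have "L2 * \<bar>w - v\<bar> * \<bar>w\<bar> \<le> L2 * \<bar>w - v\<bar> * (b - a)" using wab L2_nonneg by (intro mult_left_mono) auto
    then show ?thesis by (simp add: algebra_simps)
  qed
  finally have "((\<phi> x' - \<phi> x) - (\<phi> y' - \<phi> y))\<^sup>2
      \<le> ((L1 + L2 * (b - a)) * \<bar>w - v\<bar> + L2 * \<bar>w\<bar> * \<bar>x - y\<bar>)\<^sup>2"
    by (metis abs_ge_zero power2_abs power_mono)
  also have "\<dots> \<le> 2 * ((L1 + L2 * (b - a)) * \<bar>w - v\<bar>)\<^sup>2 + 2 * (L2 * \<bar>w\<bar> * \<bar>x - y\<bar>)\<^sup>2"
  proof -
    have "(p + q)\<^sup>2 \<le> 2 * p\<^sup>2 + 2 * q\<^sup>2" for p q :: real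
      using zero_le_power2[of "p - q"] by (simp add: power2_sum power2_diff)
    then show ?thesis .
  qed
  finally show ?thesis by (simp add: power_mult_distrib w_def v_def)
qed

lemma continuous_bounded_on_interval:
  fixes f :: "real \<Rightarrow> real"
  assumes "continuous_on {a..b} f"
  shows "\<exists>L\<ge>0. \<forall>t\<in>{a..b}. \<bar>f t\<bar> \<le> L"
proof -
  have "bounded (f ` {a..b})"
    using compact_continuous_image[OF assms compact_Icc] by (rule compact_imp_bounded)
  then obtain L where "\<forall>t\<in>{a..b}. \<bar>f t\<bar> \<le> L" by (auto simp: bounded_iff)
  then show ?thesis by (intro exI[of _ "max L 0"]) (auto simp: le_max_iff_disj)
qed

lemma c2_constants:
  fixes \<phi> \<phi>' \<phi>'' :: "real \<Rightarrow> real"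
  assumes "\<And>t. t \<in> {a..b} \<Longrightarrow> (\<phi> has_real_derivative \<phi>' t) (at t)"
    and "\<And>t. t \<in> {a..b} \<Longrightarrow> (\<phi>' has_real_derivative \<phi>'' t) (at t)"
    and "continuous_on {a..b} \<phi>''"
  obtains L0 L1 L2 where "0 \<le> L0" "0 \<le> L1" "0 \<le> L2"
    "\<And>t. t \<in> {a..b} \<Longrightarrow> \<bar>\<phi> t\<bar> \<le> L0"
    "\<And>t. t \<in> {a..b} \<Longrightarrow> \<bar>\<phi>' t\<bar> \<le> L1"
    "\<And>s t. \<lbrakk>s \<in> {a..b}; t \<in> {a..b}\<rbrakk> \<Longrightarrow> \<bar>\<phi> s - \<phi> t\<bar> \<le> L1 * \<bar>s - t\<bar>"
    "\<And>s t. \<lbrakk>s \<in> {a..b}; t \<in> {a..b}\<rbrakk> \<Longrightarrow> \<bar>\<phi>' s - \<phi>' t\<bar> \<le> L2 * \<bar>s - t\<bar>"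
proof -
  have c: "continuous_on {a..b} \<phi>" "continuous_on {a..b} \<phi>'"
    by (meson assms(1,2) DERIV_isCont continuous_at_imp_continuous_on)+
  obtain L0 where L0: "0 \<le> L0" "\<And>t. t \<in> {a..b} \<Longrightarrow> \<bar>\<phi> t\<bar> \<le> L0"
    using continuous_bounded_on_interval[OF c(1)] by blast
  obtain L1 where L1: "0 \<le> L1" "\<And>t. t \<in> {a..b} \<Longrightarrow> \<bar>\<phi>' t\<bar> \<le> L1"
    using continuous_bounded_on_interval[OF c(2)] by blast
  obtain L2 where L2: "0 \<le> L2" "\<And>t. t \<in> {a..b} \<Longrightarrow> \<bar>\<phi>'' t\<bar> \<le> L2"
    using continuous_bounded_on_interval[OF assms(3)] by blast
  show ?thesis
    by (rule that[OF L0(1) L1(1) L2(1) L0(2) L1(2) derivative_bound_lipschitz[OF assms(1) L1(2)]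
          derivative_bound_lipschitz[OF assms(2) L2(2)]])
qed

context prob_space
begin

lemma L2_norm_mono:
  assumes f: "f \<in> L2_space M" and g: "g \<in> L2_space M" and k: "0 \<le> k"
    and le: "AE x in M. \<bar>f x\<bar> \<le> k * \<bar>g x\<bar>"
  shows "L2_norm M f \<le> k * L2_norm M g"
proof -
  have "L2_inner M f f \<le> L2_inner M (\<lambda>x. k * g x) (\<lambda>x. k * g x)"
    unfolding L2_inner_def
  proof (rule integral_mono_AE)
    show "AE x in M. f x * f x \<le> k * g x * (k * g x)"
      using le
    proof eventually_elim
      fix x assume "\<bar>f x\<bar> \<le> k * \<bar>g x\<bar>"
      then have "\<bar>f x\<bar>\<^sup>2 \<le> (k * \<bar>g x\<bar>)\<^sup>2" by (intro power_mono) auto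
      then show "f x * f x \<le> k * g x * (k * g x)" by (simp add: power2_eq_square abs_mult mult_ac)
    qed
  qed (intro L2_integrable_mult f L2.V_scale g)+
  then have "L2_norm M f \<le> L2_norm M (\<lambda>x. k * g x)" by (simp add: L2_norm_def)
  also have "\<dots> = k * L2_norm M g" using L2.nrm_scale[OF g, of k] k by (simp add: L2_norm_eq)
  finally show ?thesis .
qed

lemma L2_norm_le_bound:
  assumes f: "f \<in> borel_measurable M" and le: "AE x in M. \<bar>f x\<bar> \<le> C"
  shows "L2_norm M f \<le> \<bar>C\<bar>"
proof -
  have "AE x in M. \<bar>f x\<bar> \<le> \<bar>C\<bar> * \<bar>1\<bar>" using le by eventually_elim simp
  from L2_norm_mono[OF L2_bounded[OF f le] L2_const[of 1] _ this] show ?thesis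
    by (simp add: L2_norm_const)
qed

end

context associated_form
begin

lemma nrm_le: assumes "u \<in> D" "\<E> u u \<le> e" "L2_norm M u \<le> l" shows "H.nrm u \<le> sqrt (e + l\<^sup>2)"
proof -
  have "(L2_norm M u)\<^sup>2 \<le> l\<^sup>2"
    using assms L2.nrm_nonneg[OF D_L2[OF assms(1)]] by (intro power_mono) (auto simp: L2_norm_eq)
  then have "(H.nrm u)\<^sup>2 \<le> e + l\<^sup>2" using nrm_sq[OF assms(1)] assms(2) by simp
  then show ?thesis by (rule real_le_rsqrt)
qed

text \<open>Let \<open>w = us n - u\<close>. By \<open>four_point_bound\<close> and \<open>form_four_point\<close> the energy of \<open>\<phi>(u + w) - \<phi>(u)\<close> is
  bounded by the energy of \<open>w\<close> and by \<open>2 \<E>(w\<^sup>2 u, u) - \<E>(w\<^sup>2, u\<^sup>2)\<close>. The functions \<open>w\<^sup>2 u\<close> and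
  \<open>w\<^sup>2\<close> tend to 0 in \<open>L\<^sup>2\<close> with bounded energy, hence weakly in the form domain.\<close>

lemma form_compose_tendsto_pointwise:
  assumes us: "\<And>n. us n \<in> D" "\<And>n x. us n x \<in> {a..b}" and u: "u \<in> D" "\<And>x. u x \<in> {a..b}"
    and \<phi>: "\<phi> \<in> borel_measurable borel"
    and der: "\<And>t. t \<in> {a..b} \<Longrightarrow> (\<phi> has_real_derivative \<phi>' t) (at t)"
      "\<And>t. t \<in> {a..b} \<Longrightarrow> (\<phi>' has_real_derivative \<phi>'' t) (at t)" "continuous_on {a..b} \<phi>''"
    and lim: "(\<lambda>n. H.nrm (\<lambda>x. us n x - u x)) \<longlonglongrightarrow> 0"
  shows "(\<lambda>n. \<E> (\<lambda>x. \<phi> (us n x)) (\<lambda>x. \<phi> (us n x))) \<longlonglongrightarrow> \<E> (\<lambda>x. \<phi> (u x)) (\<lambda>x. \<phi> (u x))"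
proof -
  obtain L0 L1 L2 where L: "0 \<le> L0" "0 \<le> L1" "0 \<le> L2" "\<And>t. t \<in> {a..b} \<Longrightarrow> \<bar>\<phi> t\<bar> \<le> L0"
    "\<And>t. t \<in> {a..b} \<Longrightarrow> \<bar>\<phi>' t\<bar> \<le> L1"
    "\<And>s t. \<lbrakk>s \<in> {a..b}; t \<in> {a..b}\<rbrakk> \<Longrightarrow> \<bar>\<phi> s - \<phi> t\<bar> \<le> L1 * \<bar>s - t\<bar>"
    "\<And>s t. \<lbrakk>s \<in> {a..b}; t \<in> {a..b}\<rbrakk> \<Longrightarrow> \<bar>\<phi>' s - \<phi>' t\<bar> \<le> L2 * \<bar>s - t\<bar>"
    using c2_constants[OF der] by blast
  define W where "W = b - a"
  define K where "K = \<bar>a\<bar> + \<bar>b\<bar>"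
  have W: "0 \<le> W" using u(2) by (auto simp: W_def intro: order_trans)
  have K: "0 \<le> K" by (simp add: K_def)
  define w where "w n = (\<lambda>x. us n x - u x)" for n
  have wW: "\<bar>w n x\<bar> \<le> W" for n x using us(2)[of n x] u(2)[of x] by (auto simp: w_def W_def)
  have uK: "\<bar>u x\<bar> \<le> K" for x using u(2)[of x] by (auto simp: K_def)
  have wD: "w n \<in> D" for n unfolding w_def by (rule dom_diff[OF us(1) u(1)])
  have wb: "bdd_meas (w n)" for n by (rule bdd_measI[OF D_meas[OF wD] wW])
  have ub: "bdd_meas u" by (rule bdd_measI[OF D_meas[OF u(1)] uK])
  have w0: "(\<lambda>n. H.nrm (w n)) \<longlonglongrightarrow> 0" using lim by (simp add: w_def)
  obtain c where "0 < c" "\<forall>n. norm (H.nrm (w n)) \<le> c"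
    using convergent_imp_Bseq[OF convergentI[OF w0]] by (rule BseqE)
  then have c: "H.nrm (w n) \<le> c" for n by (simp add: abs_le_iff)
  have wL0: "(\<lambda>n. L2_norm M (w n)) \<longlonglongrightarrow> 0" and wE0: "(\<lambda>n. \<E> (w n) (w n)) \<longlonglongrightarrow> 0"
    using form_tendsto_diag[of w "\<lambda>x. 0"] wD dom_zero w0 form_scale_left[OF dom_zero dom_zero, of 0] by simp_all
  have wE: "\<E> (w n) (w n) \<le> c\<^sup>2" for n
    using form_le_nrm[OF wD, of n] power_mono[OF c, of n 2] wD by (simp add: order_trans)
  note sqw = form_square[OF wD AE_I2[OF wW]]
  note squ = form_square[OF u(1) AE_I2[OF uK]]
  define C where "C = W\<^sup>2 + K"
  have w2C: "\<bar>(w n x)\<^sup>2\<bar> \<le> W\<^sup>2" for n x using power_mono[OF wW, of n x 2] by simp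
  have mw: "(\<lambda>x. (w n x)\<^sup>2 * u x) \<in> D"
    "\<E> (\<lambda>x. (w n x)\<^sup>2 * u x) (\<lambda>x. (w n x)\<^sup>2 * u x) \<le> 4 * C\<^sup>2 * (\<E> (\<lambda>x. (w n x)\<^sup>2) (\<lambda>x. (w n x)\<^sup>2) + \<E> u u)" for n
  proof -
    have "\<bar>(w n x)\<^sup>2\<bar> \<le> C" "\<bar>u x\<bar> \<le> C" for x
      using w2C[of n x] K uK[of x] zero_le_power2[of W] unfolding C_def by linarith+
    then have "AE x in M. \<bar>(w n x)\<^sup>2\<bar> \<le> C" "AE x in M. \<bar>u x\<bar> \<le> C" by auto
    then show "(\<lambda>x. (w n x)\<^sup>2 * u x) \<in> D"
      "\<E> (\<lambda>x. (w n x)\<^sup>2 * u x) (\<lambda>x. (w n x)\<^sup>2 * u x) \<le> 4 * C\<^sup>2 * (\<E> (\<lambda>x. (w n x)\<^sup>2) (\<lambda>x. (w n x)\<^sup>2) + \<E> u u)"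
      using form_mult[OF sqw(1) _ u(1)] by auto
  qed
  have E2: "\<E> (\<lambda>x. (w n x)\<^sup>2) (\<lambda>x. (w n x)\<^sup>2) \<le> 4 * W\<^sup>2 * c\<^sup>2" for n
    using sqw(2)[of n] mult_left_mono[OF wE[of n], of "4 * W\<^sup>2"] by simp
  have E3: "\<E> (\<lambda>x. (w n x)\<^sup>2 * u x) (\<lambda>x. (w n x)\<^sup>2 * u x) \<le> 4 * C\<^sup>2 * (4 * W\<^sup>2 * c\<^sup>2 + \<E> u u)" for n
    using mw(2)[of n] mult_left_mono[OF add_right_mono[OF E2[of n]], of "4 * C\<^sup>2" "\<E> u u"] by simp
  have N2: "L2_norm M (\<lambda>x. (w n x)\<^sup>2) \<le> W * L2_norm M (w n)" for n
  proof (rule L2_norm_mono[OF D_L2[OF sqw(1)] D_L2[OF wD] W])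
    have "\<bar>(w n x)\<^sup>2\<bar> \<le> W * \<bar>w n x\<bar>" for x
      using mult_right_mono[OF wW[of n x], of "\<bar>w n x\<bar>"] by (simp add: power2_eq_square abs_mult)
    then show "AE x in M. \<bar>(w n x)\<^sup>2\<bar> \<le> W * \<bar>w n x\<bar>" by simp
  qed
  have N3: "L2_norm M (\<lambda>x. (w n x)\<^sup>2 * u x) \<le> (W * K) * L2_norm M (w n)" for n
  proof (rule L2_norm_mono[OF D_L2[OF mw(1)] D_L2[OF wD]])
    have "\<bar>(w n x)\<^sup>2 * u x\<bar> \<le> W * K * \<bar>w n x\<bar>" for x
    proof -
      have "\<bar>w n x\<bar> * \<bar>u x\<bar> \<le> W * K" using wW[of n x] uK[of x] W by (intro mult_mono) auto
      then have "\<bar>w n x\<bar> * \<bar>u x\<bar> * \<bar>w n x\<bar> \<le> W * K * \<bar>w n x\<bar>" by (rule mult_right_mono) simp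
      then show ?thesis by (simp add: power2_eq_square abs_mult mult_ac)
    qed
    then show "AE x in M. \<bar>(w n x)\<^sup>2 * u x\<bar> \<le> W * K * \<bar>w n x\<bar>" by simp
  qed (use W K in simp)
  have L2c: "L2_norm M (w n) \<le> c" for n using L2_norm_le_nrm[OF wD, of n] c[of n] by linarith
  have zero: "\<E> (\<lambda>x. 0) g = 0" if "g \<in> D" for g using form_scale_left[OF dom_zero that, of 0] by simp
  have T1: "(\<lambda>n. \<E> (\<lambda>x. (w n x)\<^sup>2 * u x) u) \<longlonglongrightarrow> \<E> (\<lambda>x. 0) u"
  proof (rule form_tendsto_left_weak[OF mw(1) dom_zero u(1)])
    show "(\<lambda>n. L2_norm M (\<lambda>x. (w n x)\<^sup>2 * u x - 0)) \<longlonglongrightarrow> 0"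
      by (rule Lim_null_comparison[OF _ tendsto_mult_right_zero[OF wL0, of "W * K"]])
        (use N3 L2.nrm_nonneg[OF D_L2[OF mw(1)]] in \<open>simp add: L2_norm_eq\<close>)
    show "H.nrm (\<lambda>x. (w n x)\<^sup>2 * u x) \<le> sqrt (4 * C\<^sup>2 * (4 * W\<^sup>2 * c\<^sup>2 + \<E> u u) + (W * K * c)\<^sup>2)" for n
      by (rule nrm_le[OF mw(1) E3 order_trans[OF N3 mult_left_mono[OF L2c]]]) (use W K in simp)
  qed
  have T2: "(\<lambda>n. \<E> (\<lambda>x. (w n x)\<^sup>2) (\<lambda>x. (u x)\<^sup>2)) \<longlonglongrightarrow> \<E> (\<lambda>x. 0) (\<lambda>x. (u x)\<^sup>2)"
  proof (rule form_tendsto_left_weak[OF sqw(1) dom_zero squ(1)])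
    show "(\<lambda>n. L2_norm M (\<lambda>x. (w n x)\<^sup>2 - 0)) \<longlonglongrightarrow> 0"
      by (rule Lim_null_comparison[OF _ tendsto_mult_right_zero[OF wL0, of W]])
        (use N2 L2.nrm_nonneg[OF D_L2[OF sqw(1)]] in \<open>simp add: L2_norm_eq\<close>)
    show "H.nrm (\<lambda>x. (w n x)\<^sup>2) \<le> sqrt (4 * W\<^sup>2 * c\<^sup>2 + (W * c)\<^sup>2)" for n
      by (rule nrm_le[OF sqw(1) E2 order_trans[OF N2 mult_left_mono[OF L2c W]]])
  qed
  define F where "F n = (\<lambda>x. \<phi> (us n x) - \<phi> (u x))" for n
  have u_ab: "AE x in M. a \<le> u x \<and> u x \<le> b" and us_ab: "AE x in M. a \<le> us n x \<and> us n x \<le> b" for n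
    using u(2) us(2) by auto
  have \<phi>u: "(\<lambda>x. \<phi> (u x)) \<in> D" and \<phi>us: "(\<lambda>x. \<phi> (us n x)) \<in> D" for n
    by (rule form_contraction(1)[OF u(1) u_ab \<phi> L(6)], assumption+)
      (rule form_contraction(1)[OF us(1) us_ab \<phi> L(6)], assumption+)
  have F: "F n \<in> D" for n unfolding F_def by (rule dom_diff[OF \<phi>us \<phi>u])
  have Fb: "bdd_meas (F n)" for n
  proof (rule bdd_measI[OF D_meas[OF F]])
    show "\<bar>F n x\<bar> \<le> L0 + L0" for x using L(4)[OF us(2), of n x] L(4)[OF u(2), of x] by (simp add: F_def)
  qed
  define A where "A = 2 * (L1 + L2 * (b - a))\<^sup>2"
  define B where "B = 2 * L2\<^sup>2"
  have FE: "2 * \<E> (F n) (F n) \<le> 2 * A * \<E> (w n) (w n) + B * (2 * \<E> (\<lambda>x. (w n x)\<^sup>2 * u x) u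
      - \<E> (\<lambda>x. (w n x)\<^sup>2) (\<lambda>x. (u x)\<^sup>2))" for n
  proof (rule form_four_point[OF u(1) ub wD wb F Fb _ sqw(1) squ(1) mw(1)])
    fix x y
    show "(F n x - F n y)\<^sup>2 \<le> A * (w n x - w n y)\<^sup>2 + B * ((w n x)\<^sup>2 * (u x - u y)\<^sup>2)"
      unfolding F_def A_def B_def w_def
      by (rule four_point_bound[OF der(1) L(5) L(7) L(3) u(2) us(2) u(2) us(2)])
  qed
  have "(\<lambda>n. 2 * A * \<E> (w n) (w n) + B * (2 * \<E> (\<lambda>x. (w n x)\<^sup>2 * u x) u - \<E> (\<lambda>x. (w n x)\<^sup>2) (\<lambda>x. (u x)\<^sup>2)))
      \<longlonglongrightarrow> 2 * A * 0 + B * (2 * \<E> (\<lambda>x. 0) u - \<E> (\<lambda>x. 0) (\<lambda>x. (u x)\<^sup>2))"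
    by (intro tendsto_intros wE0 T1 T2)
  then have "(\<lambda>n. 2 * A * \<E> (w n) (w n) + B * (2 * \<E> (\<lambda>x. (w n x)\<^sup>2 * u x) u - \<E> (\<lambda>x. (w n x)\<^sup>2) (\<lambda>x. (u x)\<^sup>2)))
      \<longlonglongrightarrow> 0" using zero[OF u(1)] zero[OF squ(1)] by simp
  then have "(\<lambda>n. 2 * \<E> (F n) (F n)) \<longlonglongrightarrow> 0"
    by (rule Lim_null_comparison[rotated]) (use FE form_nonneg[OF F] in simp)
  then have FE0: "(\<lambda>n. \<E> (F n) (F n)) \<longlonglongrightarrow> 0" using tendsto_mult_right_zero[of _ _ "1/2"] by force
  have "(\<lambda>n. L2_norm M (F n)) \<longlonglongrightarrow> 0"
  proof (rule Lim_null_comparison[OF _ tendsto_mult_right_zero[OF wL0, of L1]])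
    have "L2_norm M (F n) \<le> L1 * L2_norm M (w n)" for n
      by (rule L2_norm_mono[OF D_L2[OF F] D_L2[OF wD] L(2)]) (use L(6)[OF us(2) u(2)] in \<open>simp add: F_def w_def\<close>)
    then show "\<forall>\<^sub>F n in sequentially. norm (L2_norm M (F n)) \<le> L1 * L2_norm M (w n)"
      using L2.nrm_nonneg[OF D_L2[OF F]] by (simp add: L2_norm_eq)
  qed
  then have "(\<lambda>n. \<E> (F n) (F n) + (L2_norm M (F n))\<^sup>2) \<longlonglongrightarrow> 0 + 0\<^sup>2" by (intro tendsto_intros FE0)
  then have "(\<lambda>n. (H.nrm (F n))\<^sup>2) \<longlonglongrightarrow> 0" using F by (simp add: nrm_sq)
  then have "(\<lambda>n. H.nrm (F n)) \<longlonglongrightarrow> 0" by simp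
  then show ?thesis using form_tendsto_diag(2)[OF \<phi>us \<phi>u] by (simp add: F_def)
qed

lemma form_compose_tendsto:
  assumes us: "\<And>n. us n \<in> D" "\<And>n. AE x in M. a \<le> us n x \<and> us n x \<le> b"
    and u: "u \<in> D" "AE x in M. a \<le> u x \<and> u x \<le> b"
    and \<phi>: "\<phi> \<in> borel_measurable borel"
    and der: "\<And>t. t \<in> {a..b} \<Longrightarrow> (\<phi> has_real_derivative \<phi>' t) (at t)"
      "\<And>t. t \<in> {a..b} \<Longrightarrow> (\<phi>' has_real_derivative \<phi>'' t) (at t)" "continuous_on {a..b} \<phi>''"
    and lim: "(\<lambda>n. H.nrm (\<lambda>x. us n x - u x)) \<longlonglongrightarrow> 0"
  shows "(\<lambda>n. \<E> (\<lambda>x. \<phi> (us n x)) (\<lambda>x. \<phi> (us n x))) \<longlonglongrightarrow> \<E> (\<lambda>x. \<phi> (u x)) (\<lambda>x. \<phi> (u x))"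
proof -
  have le: "a \<le> b" by (rule AE_interval_nonempty[OF u(2)])
  define c where "c = clamp_to a b"
  have c: "c t \<in> {a..b}" for t unfolding c_def by (rule clamp_to_mem[OF le])
  note cu = clamp_representative[OF u, folded c_def]
  note cus = clamp_representative[OF us(1,2), folded c_def]
  obtain L1 where L: "\<And>s t. \<lbrakk>s \<in> {a..b}; t \<in> {a..b}\<rbrakk> \<Longrightarrow> \<bar>\<phi> s - \<phi> t\<bar> \<le> L1 * \<bar>s - t\<bar>"
    by (rule c2_constants[OF der], assumption+, rule that, assumption)
  have E_eq: "\<E> (\<lambda>x. \<phi> (c (v x))) (\<lambda>x. \<phi> (c (v x))) = \<E> (\<lambda>x. \<phi> (v x)) (\<lambda>x. \<phi> (v x))"
    if v: "v \<in> D" "AE x in M. a \<le> v x \<and> v x \<le> b" for v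
  proof -
    note cv = clamp_representative[OF v, folded c_def]
    have 1: "(\<lambda>x. \<phi> (v x)) \<in> D" by (rule form_contraction(1)[OF v \<phi> L])
    have 2: "(\<lambda>x. \<phi> (c (v x))) \<in> D" by (rule form_contraction(1)[OF cv(1) _ \<phi> L]) (use c in auto)
    have ae: "AE x in M. \<phi> (c (v x)) = \<phi> (v x)" using cv(2) by eventually_elim simp
    show ?thesis by (rule form_AE[OF 2 1 2 1 ae ae])
  qed
  have "H.nrm (\<lambda>x. c (us n x) - c (u x)) = H.nrm (\<lambda>x. us n x - u x)" for n
    by (rule nrm_cong_AE[OF dom_diff[OF cus(1) cu(1)] dom_diff[OF us(1) u(1)]])
      (use cus(2)[of n] cu(2) in \<open>eventually_elim, simp\<close>)
  then have "(\<lambda>n. \<E> (\<lambda>x. \<phi> (c (us n x))) (\<lambda>x. \<phi> (c (us n x)))) \<longlonglongrightarrow> \<E> (\<lambda>x. \<phi> (c (u x))) (\<lambda>x. \<phi> (c (u x)))"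
    using lim by (intro form_compose_tendsto_pointwise[OF cus(1) c cu(1) c \<phi> der]) auto
  then show ?thesis using E_eq[OF us] E_eq[OF u] by simp
qed

section \<open>Symmetric semigroups\<close>

lemma generates_inner_tendsto:
  assumes g: "generates M P f f'" and h: "h \<in> L2_space M"
  shows "((\<lambda>t. L2_inner M h (\<lambda>x. (P t f x - f x) / t)) \<longlongrightarrow> L2_inner M h f') (at_right 0)"
proof -
  have f: "f \<in> L2_space M" and f': "f' \<in> L2_space M"
    and lim: "((\<lambda>t. L2_norm M (\<lambda>x. (P t f x - f x) / t - f' x)) \<longlongrightarrow> 0) (at_right 0)"
    using g by (auto simp: generates_def)
  have "((\<lambda>t. L2_inner M h (\<lambda>x. (P t f x - f x) / t) - L2_inner M h f') \<longlongrightarrow> 0) (at_right 0)"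
  proof (rule Lim_null_comparison[OF _ tendsto_mult_right_zero[OF lim, of "L2_norm M h"]])
    show "\<forall>\<^sub>F t in at_right 0. norm (L2_inner M h (\<lambda>x. (P t f x - f x) / t) - L2_inner M h f')
        \<le> L2_norm M h * L2_norm M (\<lambda>x. (P t f x - f x) / t - f' x)"
      unfolding eventually_at_filter
    proof (rule always_eventually, intro allI impI)
      fix t :: real assume "t \<noteq> 0" "t \<in> {0<..}"
      then have "(\<lambda>x. (P t f x - f x) / t) \<in> L2_space M"
        using L2.V_scale[OF L2.V_diff[OF P_L2[OF _ f] f], of t "1/t"] by simp
      then show "norm (L2_inner M h (\<lambda>x. (P t f x - f x) / t) - L2_inner M h f')
        \<le> L2_norm M h * L2_norm M (\<lambda>x. (P t f x - f x) / t - f' x)"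
        using L2.cauchy_schwarz[OF h L2.V_diff[OF _ f'], of "\<lambda>x. (P t f x - f x) / t"] h f'
        by (simp add: L2.B_diff_right L2_norm_eq)
    qed
  qed
  then show ?thesis by (simp add: LIM_zero_iff)
qed

text \<open>Differentiating the symmetry of \<open>P t\<close> at 0 makes the generator symmetric, hence its resolvents.\<close>

lemma R_symmetric:
  assumes sym: "symmetric_semigroup M P" and \<beta>: "1 \<le> \<beta>" and f: "f \<in> L2_space M" and g: "g \<in> L2_space M"
  shows "L2_inner M (R \<beta> f) g = L2_inner M f (R \<beta> g)"
proof -
  define u where "u = R \<beta> f"
  define v where "v = R \<beta> g"
  have uL: "u \<in> L2_space M" and vL: "v \<in> L2_space M" unfolding u_def v_def by (intro R_L2 \<beta> f g)+
  note gu = R_generates[OF \<beta> f, folded u_def] and gv = R_generates[OF \<beta> g, folded v_def]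
  have "L2_inner M u (\<lambda>x. \<beta> * (v x - g x)) = L2_inner M v (\<lambda>x. \<beta> * (u x - f x))"
  proof (rule tendsto_unique[OF _ generates_inner_tendsto[OF gv uL]])
    have "\<forall>\<^sub>F t in at_right 0. L2_inner M v (\<lambda>x. (P t u x - u x) / t) = L2_inner M u (\<lambda>x. (P t v x - v x) / t)"
      unfolding eventually_at_filter
    proof (rule always_eventually, intro allI impI)
      fix t :: real assume "t \<noteq> 0" "t \<in> {0<..}"
      then have t: "0 \<le> t" by simp
      note Pu = P_L2[OF t uL] and Pv = P_L2[OF t vL]
      have *: "L2_inner M a (\<lambda>x. (P t b x - b x) / t) = (L2_inner M a (P t b) - L2_inner M a b) / t"
        if "a \<in> L2_space M" "b \<in> L2_space M" for a b
        using L2.B_scale_right[OF L2.V_diff[OF P_L2[OF t that(2)] that(2)] that(1), of "1/t"]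
          L2.B_diff_right[OF P_L2[OF t that(2)] that(2,1)] by simp
      have "L2_inner M (P t u) v = L2_inner M u (P t v)"
        using sym t uL vL unfolding symmetric_semigroup_def by blast
      then show "L2_inner M v (\<lambda>x. (P t u x - u x) / t) = L2_inner M u (\<lambda>x. (P t v x - v x) / t)"
        unfolding *[OF vL uL] *[OF uL vL]
        using L2.B_commute[OF vL Pu] L2.B_commute[OF vL uL] by simp
    qed
    then show "((\<lambda>t. L2_inner M u (\<lambda>x. (P t v x - v x) / t)) \<longlongrightarrow> L2_inner M v (\<lambda>x. \<beta> * (u x - f x))) (at_right 0)"
      by (rule Lim_transform_eventually[OF generates_inner_tendsto[OF gu vL]])
  qed simp
  then have "\<beta> * (L2_inner M u v - L2_inner M u g) = \<beta> * (L2_inner M v u - L2_inner M v f)"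
    using uL vL f g by (simp only: L2.B_scale_right L2.V_diff L2.B_diff_right)
  then have "L2_inner M u g = L2_inner M v f"
    using \<beta> L2.B_commute[OF uL vL] by simp
  then show ?thesis using L2.B_commute[OF vL f] by (simp add: u_def v_def)
qed

text \<open>Expanding the product on the right of the assumption gives the two cross terms \<open>\<mu>(h R u)\<close> and \<open>\<mu>(u R h)\<close>;
  by symmetry they agree.\<close>

lemma symmetric_kernel_inequality:
  assumes sym: "symmetric_semigroup M P" and \<beta>: "1 \<le> \<beta>"
    and b: "bdd_meas h" "bdd_meas u" "bdd_meas w"
    and le: "\<And>x y. \<lbrakk>x \<in> space M; y \<in> space M\<rbrakk> \<Longrightarrow> 2 * (w x - w y)\<^sup>2 \<le> (h x - h y) * (u x - u y)"
  shows "2 * L2_inner M w (\<lambda>x. w x - R \<beta> w x) \<le> L2_inner M h (\<lambda>x. u x - R \<beta> u x)"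
proof -
  note L = bdd_meas_L2[OF b(1)] bdd_meas_L2[OF b(2)] bdd_meas_L2[OF b(3)]
  define d where "d = (\<lambda>x. h x * u x + (-2) * (w x * w x))"
  have d: "bdd_meas d" unfolding d_def by (intro bdd_meas_intros b)
  have "0 \<le> (\<Sum>(a, b)\<leftarrow>[(d, \<lambda>x. 1), (\<lambda>x. 1, d), (\<lambda>x. (-1) * h x, u), (\<lambda>x. (-1) * u x, h), (\<lambda>x. 4 * w x, w)].
      L2_inner M a (R \<beta> b))"
  proof (rule kernel_positivity[OF \<beta>])
    fix x y assume "x \<in> space M" "y \<in> space M"
    from le[OF this]
    show "0 \<le> (\<Sum>(a, b)\<leftarrow>[(d, \<lambda>x. 1), (\<lambda>x. 1, d), (\<lambda>x. (-1) * h x, u), (\<lambda>x. (-1) * u x, h), (\<lambda>x. 4 * w x, w)]. a x * b y)"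
      by (simp add: d_def power2_diff algebra_simps power2_eq_square)
  qed (auto intro!: bdd_meas_intros d b)
  then have "0 \<le> 2 * (\<integral>x. d x \<partial>M) - L2_inner M h (R \<beta> u) - L2_inner M u (R \<beta> h) + 4 * L2_inner M w (R \<beta> w)"
    using R_one_right[OF \<beta> bdd_meas_L2[OF d]] R_one_left[OF \<beta> bdd_meas_L2[OF d]]
    by (simp only: list.map sum_list.Cons sum_list.Nil prod.case L2.B_scale_left[OF L(1) R_L2[OF \<beta> L(2)]]
        L2.B_scale_left[OF L(2) R_L2[OF \<beta> L(1)]] L2.B_scale_left[OF L(3) R_L2[OF \<beta> L(3)]])
  moreover have "L2_inner M u (R \<beta> h) = L2_inner M h (R \<beta> u)"
    using R_symmetric[OF sym \<beta> L(2,1)] L2.B_commute[OF R_L2[OF \<beta> L(2)] L(1)] by simp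
  moreover have "(\<integral>x. d x \<partial>M) = L2_inner M h u - 2 * L2_inner M w w"
    unfolding d_def L2_inner_def using L2_integrable_mult[OF L(1,2)] L2_integrable_mult[OF L(3,3)] by simp
  ultimately show ?thesis
    unfolding L2.B_diff_right[OF L(2) R_L2[OF \<beta> L(2)] L(1)] L2.B_diff_right[OF L(3) R_L2[OF \<beta> L(3)] L(3)]
    by simp
qed

lemma symmetric_form_inequality:
  assumes sym: "symmetric_semigroup M P" and u: "u \<in> D" "AE x in M. a \<le> u x \<and> u x \<le> b"
    and h: "h \<in> borel_measurable borel" "\<And>s t. \<lbrakk>s \<in> {a..b}; t \<in> {a..b}\<rbrakk> \<Longrightarrow> \<bar>h s - h t\<bar> \<le> L * \<bar>s - t\<bar>"
    and \<psi>: "\<psi> \<in> borel_measurable borel" "\<And>s t. \<lbrakk>s \<in> {a..b}; t \<in> {a..b}\<rbrakk> \<Longrightarrow> \<bar>\<psi> s - \<psi> t\<bar> \<le> L' * \<bar>s - t\<bar>"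
    and le: "\<And>s t. \<lbrakk>s \<in> {a..b}; t \<in> {a..b}\<rbrakk> \<Longrightarrow> 2 * (\<psi> s - \<psi> t)\<^sup>2 \<le> (h s - h t) * (s - t)"
  shows "2 * \<E> (\<lambda>x. \<psi> (u x)) (\<lambda>x. \<psi> (u x)) \<le> \<E> (\<lambda>x. h (u x)) u"
proof -
  have ab: "a \<le> b" by (rule AE_interval_nonempty[OF u(2)])
  define v where "v = (\<lambda>x. clamp_to a b (u x))"
  note v = clamp_representative[OF u, folded v_def]
  have v2: "AE x in M. u x = v x" using v(2) by (simp add: v_def)
  have v_mem: "v x \<in> {a..b}" for x using clamp_to_mem[OF ab] by (simp add: v_def)
  have comp: "bdd_meas (\<lambda>x. \<phi> (v x))" if "\<phi> \<in> borel_measurable borel"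
    "\<And>s t. \<lbrakk>s \<in> {a..b}; t \<in> {a..b}\<rbrakk> \<Longrightarrow> \<bar>\<phi> s - \<phi> t\<bar> \<le> L * \<bar>s - t\<bar>" for \<phi> L
  proof (rule bdd_measI)
    show "(\<lambda>x. \<phi> (v x)) \<in> borel_measurable M" using D_meas[OF v(1)] that(1) by measurable
    fix x
    have "\<bar>\<phi> (v x) - \<phi> a\<bar> \<le> L * \<bar>v x - a\<bar>" using that(2)[OF v_mem, of a x] ab by simp
    also have "\<dots> \<le> \<bar>L\<bar> * (b - a)" using v_mem[of x] by (intro mult_mono) auto
    finally show "\<bar>\<phi> (v x)\<bar> \<le> \<bar>\<phi> a\<bar> + \<bar>L\<bar> * (b - a)" by linarith
  qed
  have vab: "AE x in M. a \<le> v x \<and> v x \<le> b" using v_mem by auto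
  have hv: "(\<lambda>x. h (v x)) \<in> D" and \<psi>v: "(\<lambda>x. \<psi> (v x)) \<in> D"
    using form_contraction(1)[OF v(1) vab h] form_contraction(1)[OF v(1) vab \<psi>] by auto
  have hu: "(\<lambda>x. h (u x)) \<in> D" and \<psi>u: "(\<lambda>x. \<psi> (u x)) \<in> D"
    using form_contraction(1)[OF u h] form_contraction(1)[OF u \<psi>] by auto
  have \<beta>: "1 \<le> real n + 1" for n by simp
  have "2 * \<E> (\<lambda>x. \<psi> (v x)) (\<lambda>x. \<psi> (v x)) \<le> \<E> (\<lambda>x. h (v x)) v"
  proof (rule LIMSEQ_le[OF tendsto_mult_left[OF R_form_tendsto[OF \<psi>v \<psi>v], of 2] R_form_tendsto[OF v(1) hv]],
      intro exI allI impI)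
    fix n :: nat
    have "2 * L2_inner M (\<lambda>x. \<psi> (v x)) (\<lambda>x. \<psi> (v x) - R (real n + 1) (\<lambda>x. \<psi> (v x)) x)
        \<le> L2_inner M (\<lambda>x. h (v x)) (\<lambda>x. v x - R (real n + 1) v x)"
      by (rule symmetric_kernel_inequality[OF sym \<beta> comp[OF h] v(3) comp[OF \<psi>] le[OF v_mem v_mem]])
    from mult_left_mono[OF this, of "real n + 1"]
    show "2 * ((real n + 1) * L2_inner M (\<lambda>x. \<psi> (v x)) (\<lambda>x. \<psi> (v x) - R (real n + 1) (\<lambda>x. \<psi> (v x)) x))
        \<le> (real n + 1) * L2_inner M (\<lambda>x. h (v x)) (\<lambda>x. v x - R (real n + 1) v x)"
      by (simp only: mult.left_commute)
  qed
  moreover have "\<E> (\<lambda>x. \<psi> (v x)) (\<lambda>x. \<psi> (v x)) = \<E> (\<lambda>x. \<psi> (u x)) (\<lambda>x. \<psi> (u x))"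
    by (rule form_AE[OF \<psi>v \<psi>u \<psi>v \<psi>u]) (use v2 in \<open>eventually_elim, simp\<close>)+
  moreover have "\<E> (\<lambda>x. h (v x)) v = \<E> (\<lambda>x. h (u x)) u"
    by (rule form_AE[OF hv hu v(1) u(1)]) (use v2 in \<open>eventually_elim, simp\<close>)+
  ultimately show ?thesis by simp
qed

end

section \<open>Differentiating integrals along the semigroup\<close>

lemma L2_norm_cong_AE:
  assumes "AE x in M. f x = g x" "f \<in> borel_measurable M" "g \<in> borel_measurable M"
  shows "L2_norm M f = L2_norm M g"
  unfolding L2_norm_def using L2_inner_cong_AE[OF assms(1,1) assms(2,3,2,3)] by simp

context associated_form
begin

lemma P_diff:
  assumes "0 \<le> t" "f \<in> L2_space M" "g \<in> L2_space M"
  shows "AE x in M. P t (\<lambda>y. f y - g y) x = P t f x - P t g x"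
  using P_comb[OF assms, of 1 "-1"] by simp

lemma P_dist:
  assumes t: "0 \<le> t" and f: "f \<in> L2_space M" and g: "g \<in> L2_space M"
  shows "L2_norm M (\<lambda>x. P t f x - P t g x) \<le> L2_norm M (\<lambda>x. f x - g x)"
proof -
  have "L2_norm M (\<lambda>x. P t f x - P t g x) = L2_norm M (P t (\<lambda>x. f x - g x))"
    by (rule L2_norm_cong_AE)
      (use P_diff[OF t f g] in auto, intro L2_spaceD(1)[of _ M] L2.V_diff P_L2 t f g,
        intro P_meas t L2.V_diff f g)
  then show ?thesis using P_contraction[OF t L2.V_diff[OF f g]] by simp
qed

lemma P_between:
  assumes t: "0 \<le> t" and f: "f \<in> L2_space M" and ab: "AE x in M. a \<le> f x \<and> f x \<le> b"
  shows "AE x in M. a \<le> P t f x \<and> P t f x \<le> b"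
proof -
  note one = L2_const[of 1]
  have "AE x in M. 0 \<le> 1 * f x + (- a) * 1" using ab by eventually_elim simp
  then have "AE x in M. 0 \<le> P t (\<lambda>x. 1 * f x + (- a) * 1) x" by (rule P_nonneg[OF t L2_comb[OF f one]])
  moreover have "AE x in M. 0 \<le> (-1) * f x + b * 1" using ab by eventually_elim simp
  then have "AE x in M. 0 \<le> P t (\<lambda>x. (-1) * f x + b * 1) x" by (rule P_nonneg[OF t L2_comb[OF f one]])
  ultimately show ?thesis
    using P_comb[OF t f one, of 1 "- a"] P_comb[OF t f one, of "-1" b] P_one[OF t]
    by eventually_elim simp
qed

lemma P_increment:
  assumes m: "0 \<le> m" and h: "0 < h" and f: "f \<in> L2_space M"
  shows "L2_norm M (\<lambda>x. P (m + h) f x - P m f x) \<le> L2_norm M (\<lambda>x. P h f x - f x)"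
proof -
  have h0: "0 \<le> h" "0 \<le> m + h" using h m by auto
  note Ph = P_L2[OF h0(1) f]
  have "L2_norm M (\<lambda>x. P (m + h) f x - P m f x) = L2_norm M (\<lambda>x. P m (P h f) x - P m f x)"
  proof (rule L2_norm_cong_AE)
    show "AE x in M. P (m + h) f x - P m f x = P m (P h f) x - P m f x"
      using P_semigroup[OF m h0(1) f] by eventually_elim simp
  qed (intro borel_measurable_diff P_meas h0 m f Ph)+
  also have "\<dots> \<le> L2_norm M (\<lambda>x. P h f x - f x)" by (rule P_dist[OF m Ph f])
  finally show ?thesis .
qed

text \<open>Difference quotients along the orbit are controlled by those at time 0, since \<open>P m\<close> is a contraction. For
  backward differences the derivative is first taken at the earlier time, and \<open>\<sigma>\<close> accounts for moving it to
  the later one.\<close>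

lemma P_orbit_estimates:
  assumes gen: "generates M P g g'"
  defines "\<rho> \<equiv> \<lambda>h. L2_norm M (\<lambda>x. (P h g x - g x) / h - g' x)"
    and "\<sigma> \<equiv> \<lambda>h. L2_norm M (\<lambda>x. P h g' x - g' x)"
  assumes s: "0 \<le> s" and t: "0 \<le> t" and ne: "s \<noteq> t"
  shows "L2_norm M (\<lambda>x. P s g x - P t g x) \<le> \<bar>s - t\<bar> * (L2_norm M g' + \<rho> \<bar>s - t\<bar>)"
    and "L2_norm M (\<lambda>x. P s g x - P t g x - (s - t) * P t g' x) \<le> \<bar>s - t\<bar> * (\<rho> \<bar>s - t\<bar> + \<sigma> \<bar>s - t\<bar>)"
proof -
  have g: "g \<in> L2_space M" and g': "g' \<in> L2_space M" using gen by (auto simp: generates_def)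
  define h where "h = \<bar>s - t\<bar>"
  have h: "0 < h" "0 \<le> h" using ne by (auto simp: h_def)
  note Ph = P_L2[OF h(2) g]
  define r where "r = (\<lambda>x. (P h g x - g x) / h - g' x)"
  have r: "r \<in> L2_space M" unfolding r_def
    using L2.V_diff[OF L2.V_scale[OF L2.V_diff[OF Ph g], of "1/h"] g'] by simp
  have Pg_eq: "(\<lambda>x. P h g x - g x) = (\<lambda>x. h * g' x + h * r x)"
    using h(1) by (simp add: r_def field_simps fun_eq_iff)
  have norm_inc: "L2_norm M (\<lambda>x. P h g x - g x) \<le> h * (L2_norm M g' + \<rho> h)"
    unfolding Pg_eq
    using L2.nrm_triangle[OF L2.V_scale[OF g', of h] L2.V_scale[OF r, of h]]
      L2.nrm_scale[OF g', of h] L2.nrm_scale[OF r, of h] h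
    by (simp add: L2_norm_eq \<rho>_def r_def algebra_simps)
  have fwd: "L2_norm M (\<lambda>x. P (m + h) g x - P m g x - h * P m g' x) \<le> h * \<rho> h" if m: "0 \<le> m" for m
  proof -
    have mh: "0 \<le> m + h" using m h by simp
    have "AE x in M. P m (\<lambda>x. 1 * (P h g x - g x) + (- h) * g' x) x
        = 1 * P m (\<lambda>x. P h g x - g x) x + (- h) * P m g' x"
      by (rule P_comb[OF m L2.V_diff[OF Ph g] g'])
    then have ae: "AE x in M. P (m + h) g x - P m g x - h * P m g' x
        = P m (\<lambda>x. 1 * (P h g x - g x) + (- h) * g' x) x"
      using P_diff[OF m Ph g] P_semigroup[OF m h(2) g] by eventually_elim simp
    have "L2_norm M (\<lambda>x. P (m + h) g x - P m g x - h * P m g' x)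
        = L2_norm M (P m (\<lambda>x. 1 * (P h g x - g x) + (- h) * g' x))"
    proof (rule L2_norm_cong_AE[OF ae])
      show "(\<lambda>x. P (m + h) g x - P m g x - h * P m g' x) \<in> borel_measurable M"
        by (intro borel_measurable_diff borel_measurable_times borel_measurable_const P_meas mh m g g')
      show "P m (\<lambda>x. 1 * (P h g x - g x) + (- h) * g' x) \<in> borel_measurable M"
        by (intro P_meas m L2_comb L2.V_diff Ph g g')
    qed
    also have "\<dots> \<le> L2_norm M (\<lambda>x. 1 * (P h g x - g x) + (- h) * g' x)"
      by (rule P_contraction[OF m L2_comb[OF L2.V_diff[OF Ph g] g']])
    also have "(\<lambda>x. 1 * (P h g x - g x) + (- h) * g' x) = (\<lambda>x. h * r x)"
      using h(1) by (simp add: r_def field_simps fun_eq_iff)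
    also have "L2_norm M (\<lambda>x. h * r x) = h * \<rho> h"
      using L2.nrm_scale[OF r, of h] h by (simp add: L2_norm_eq \<rho>_def r_def)
    finally show ?thesis .
  qed
  have \<sigma>0: "0 \<le> \<sigma> h" unfolding \<sigma>_def
    using L2.nrm_nonneg[OF L2.V_diff[OF P_L2[OF h(2) g'] g']] by (simp add: L2_norm_eq)
  note Psg = P_L2[OF s g] and Ptg = P_L2[OF t g] and Psg' = P_L2[OF s g'] and Ptg' = P_L2[OF t g']
  have "L2_norm M (\<lambda>x. P s g x - P t g x) \<le> h * (L2_norm M g' + \<rho> h)
    \<and> L2_norm M (\<lambda>x. P s g x - P t g x - (s - t) * P t g' x) \<le> h * (\<rho> h + \<sigma> h)"
  proof (cases "t < s")
    case True
    then have sh: "s = t + h" "s - t = h" by (auto simp: h_def)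
    have "L2_norm M (\<lambda>x. P s g x - P t g x) \<le> h * (L2_norm M g' + \<rho> h)"
      using P_increment[OF t h(1) g] norm_inc unfolding sh(1) by linarith
    moreover have "L2_norm M (\<lambda>x. P s g x - P t g x - (s - t) * P t g' x) \<le> h * \<rho> h"
      using fwd[OF t] unfolding sh(2) unfolding sh(1) .
    moreover have "h * \<rho> h \<le> h * (\<rho> h + \<sigma> h)" using \<sigma>0 h by simp
    ultimately show ?thesis by linarith
  next
    case False
    then have sh: "t = s + h" "s - t = - h" using ne by (auto simp: h_def)
    have "L2_norm M (\<lambda>x. P s g x - P t g x) = L2_norm M (\<lambda>x. P t g x - P s g x)"
      using L2.nrm_minus_commute[OF Psg Ptg] by (simp add: L2_norm_eq)
    also have "\<dots> \<le> h * (L2_norm M g' + \<rho> h)"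
      using P_increment[OF s h(1) g] norm_inc unfolding sh(1) by linarith
    finally have 1: "L2_norm M (\<lambda>x. P s g x - P t g x) \<le> h * (L2_norm M g' + \<rho> h)" .
    define A where "A = (\<lambda>x. P t g x - P s g x - h * P s g' x)"
    define B where "B = (\<lambda>x. P t g' x - P s g' x)"
    have A: "A \<in> L2_space M" and B: "B \<in> L2_space M"
      unfolding A_def B_def by (intro L2.V_diff L2.V_scale Psg Ptg Psg' Ptg')+
    have eq: "(\<lambda>x. P s g x - P t g x - (s - t) * P t g' x) = (\<lambda>x. (-1) * A x + h * B x)"
      unfolding sh(2) by (simp add: A_def B_def algebra_simps fun_eq_iff)
    have "L2_norm M (\<lambda>x. P s g x - P t g x - (s - t) * P t g' x) \<le> L2_norm M A + h * L2_norm M B"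
      unfolding eq using L2.nrm_triangle[OF L2.V_scale[OF A, of "-1"] L2.V_scale[OF B, of h]]
        L2.nrm_scale[OF A, of "-1"] L2.nrm_scale[OF B, of h] h by (simp add: L2_norm_eq)
    also have "L2_norm M A \<le> h * \<rho> h" unfolding A_def using fwd[OF s] by (simp only: sh(1))
    also have "L2_norm M B \<le> \<sigma> h" unfolding B_def \<sigma>_def using P_increment[OF s h(1) g'] by (simp only: sh(1))
    finally show ?thesis using 1 h by (simp add: algebra_simps)
  qed
  then show "L2_norm M (\<lambda>x. P s g x - P t g x) \<le> \<bar>s - t\<bar> * (L2_norm M g' + \<rho> \<bar>s - t\<bar>)"
    and "L2_norm M (\<lambda>x. P s g x - P t g x - (s - t) * P t g' x) \<le> \<bar>s - t\<bar> * (\<rho> \<bar>s - t\<bar> + \<sigma> \<bar>s - t\<bar>)"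
    by (auto simp: h_def)
qed

lemma generates_P:
  assumes gen: "generates M P g g'" and t: "0 \<le> t"
  shows "generates M P (P t g) (P t g')"
proof -
  have g: "g \<in> L2_space M" and g': "g' \<in> L2_space M"
    and lim: "((\<lambda>h. L2_norm M (\<lambda>x. (P h g x - g x) / h - g' x)) \<longlongrightarrow> 0) (at_right 0)"
    using gen by (auto simp: generates_def)
  note Ptg = P_L2[OF t g] and Ptg' = P_L2[OF t g']
  have "((\<lambda>h. L2_norm M (\<lambda>x. (P h g x - g x) / h - g' x) + L2_norm M (\<lambda>x. P h g' x - g' x)) \<longlongrightarrow> 0 + 0) (at_right 0)"
    by (intro tendsto_add lim P_continuous g')
  then have lim': "((\<lambda>h. L2_norm M (\<lambda>x. (P h g x - g x) / h - g' x) + L2_norm M (\<lambda>x. P h g' x - g' x)) \<longlongrightarrow> 0) (at_right 0)"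
    by simp
  have "((\<lambda>h. L2_norm M (\<lambda>x. (P h (P t g) x - P t g x) / h - P t g' x)) \<longlongrightarrow> 0) (at_right 0)"
  proof (rule Lim_null_comparison[OF _ lim'])
    show "\<forall>\<^sub>F h in at_right 0. norm (L2_norm M (\<lambda>x. (P h (P t g) x - P t g x) / h - P t g' x))
        \<le> L2_norm M (\<lambda>x. (P h g x - g x) / h - g' x) + L2_norm M (\<lambda>x. P h g' x - g' x)"
      unfolding eventually_at_filter
    proof (rule always_eventually, intro allI impI)
      fix h :: real assume "h \<noteq> 0" "h \<in> {0<..}"
      then have h: "0 < h" "0 \<le> h" "0 \<le> t + h" "0 \<le> h + t" using t by auto
      define d where "d = (\<lambda>x. P (t + h) g x - P t g x - (t + h - t) * P t g' x)"
      have d: "d \<in> L2_space M" unfolding d_def by (intro L2.V_diff L2.V_scale P_L2 h t g g')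
      have "AE x in M. (P h (P t g) x - P t g x) / h - P t g' x = (1 / h) * d x"
        using P_semigroup[OF h(2) t g]
        by eventually_elim (use h(1) in \<open>simp add: d_def add.commute field_simps\<close>)
      then have "L2_norm M (\<lambda>x. (P h (P t g) x - P t g x) / h - P t g' x) = L2_norm M (\<lambda>x. (1 / h) * d x)"
      proof (rule L2_norm_cong_AE)
        show "(\<lambda>x. (P h (P t g) x - P t g x) / h - P t g' x) \<in> borel_measurable M"
          by (intro borel_measurable_diff borel_measurable_divide borel_measurable_const P_meas h t g g' Ptg)
        show "(\<lambda>x. (1 / h) * d x) \<in> borel_measurable M" by (rule L2_spaceD(1)[OF L2.V_scale[OF d]])
      qed
      also have "\<dots> = (1 / h) * L2_norm M d" using L2.nrm_scale[OF d, of "1/h"] h by (simp add: L2_norm_eq)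
      also have "\<dots> \<le> (1 / h) * (h * (L2_norm M (\<lambda>x. (P h g x - g x) / h - g' x) + L2_norm M (\<lambda>x. P h g' x - g' x)))"
        using P_orbit_estimates(2)[OF gen h(3) t] h(1) unfolding d_def by (intro mult_left_mono) auto
      finally have "L2_norm M (\<lambda>x. (P h (P t g) x - P t g x) / h - P t g' x)
          \<le> L2_norm M (\<lambda>x. (P h g x - g x) / h - g' x) + L2_norm M (\<lambda>x. P h g' x - g' x)"
        using h(1) by simp
      moreover have q: "(\<lambda>x. (P h (P t g) x - P t g x) / h - P t g' x) \<in> L2_space M"
        using L2.V_diff[OF L2.V_scale[OF L2.V_diff[OF P_L2[OF h(2) Ptg] Ptg], of "1/h"] Ptg'] by simp
      ultimately show "norm (L2_norm M (\<lambda>x. (P h (P t g) x - P t g x) / h - P t g' x))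
          \<le> L2_norm M (\<lambda>x. (P h g x - g x) / h - g' x) + L2_norm M (\<lambda>x. P h g' x - g' x)"
        using L2.nrm_nonneg[OF q] by (simp add: L2_norm_eq)
    qed
  qed
  then show ?thesis using Ptg Ptg' by (simp add: generates_def)
qed

text \<open>The second-order error is quadratic in the \<open>L\<^sup>2\<close>-distance; this is why differentiability of an orbit in
  \<open>L\<^sup>2\<close>, with its range confined to an interval, suffices to differentiate integrals along it.\<close>

lemma integral_taylor:
  assumes u: "u \<in> L2_space M" "AE x in M. a \<le> u x \<and> u x \<le> b"
    and v: "v \<in> L2_space M" "AE x in M. a \<le> v x \<and> v x \<le> b"
    and m: "\<Phi> \<in> borel_measurable borel" "\<Phi>' \<in> borel_measurable borel"
    and der: "\<And>t. t \<in> {a..b} \<Longrightarrow> (\<Phi> has_real_derivative \<Phi>' t) (at t)"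
    and bd: "\<And>t. t \<in> {a..b} \<Longrightarrow> \<bar>\<Phi> t\<bar> \<le> L0" "\<And>t. t \<in> {a..b} \<Longrightarrow> \<bar>\<Phi>' t\<bar> \<le> L1"
    and L2: "\<And>s t. \<lbrakk>s \<in> {a..b}; t \<in> {a..b}\<rbrakk> \<Longrightarrow> \<bar>\<Phi>' s - \<Phi>' t\<bar> \<le> L2 * \<bar>s - t\<bar>" and L20: "0 \<le> L2"
  shows "\<bar>(\<integral>x. \<Phi> (v x) \<partial>M) - (\<integral>x. \<Phi> (u x) \<partial>M) - L2_inner M (\<lambda>x. \<Phi>' (u x)) (\<lambda>x. v x - u x)\<bar>
      \<le> L2 * (L2_norm M (\<lambda>x. v x - u x))\<^sup>2"
    and "(\<lambda>x. \<Phi>' (u x)) \<in> L2_space M"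
proof -
  have pt: "\<bar>\<Phi> q - \<Phi> p - \<Phi>' p * (q - p)\<bar> \<le> L2 * (q - p)\<^sup>2" if pq: "p \<in> {a..b}" "q \<in> {a..b}" for p q
  proof -
    have ex: "\<exists>z\<in>{a..b}. \<bar>z - p\<bar> \<le> \<bar>q - p\<bar> \<and> \<Phi> q - \<Phi> p = \<Phi>' z * (q - p)"
    proof (cases p q rule: linorder_cases)
      case less
      then obtain z where "p < z" "z < q" "\<Phi> q - \<Phi> p = (q - p) * \<Phi>' z"
        using MVT2[OF less, of \<Phi> \<Phi>'] der pq by auto
      then show ?thesis using pq by (intro bexI[of _ z]) auto
    next
      case equal
      then show ?thesis using pq by (intro bexI[of _ p]) auto
    next
      case greater
      then obtain z where "q < z" "z < p" "\<Phi> p - \<Phi> q = (p - q) * \<Phi>' z"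
        using MVT2[OF greater, of \<Phi> \<Phi>'] der pq by auto
      then show ?thesis using pq by (intro bexI[of _ z]) (auto simp: algebra_simps)
    qed
    then obtain z where z: "z \<in> {a..b}" "\<bar>z - p\<bar> \<le> \<bar>q - p\<bar>" "\<Phi> q - \<Phi> p = \<Phi>' z * (q - p)" by blast
    have "\<Phi> q - \<Phi> p - \<Phi>' p * (q - p) = (\<Phi>' z - \<Phi>' p) * (q - p)" using z(3) by (simp add: algebra_simps)
    then have "\<bar>\<Phi> q - \<Phi> p - \<Phi>' p * (q - p)\<bar> = \<bar>\<Phi>' z - \<Phi>' p\<bar> * \<bar>q - p\<bar>" by (simp add: abs_mult)
    also have "\<dots> \<le> L2 * \<bar>q - p\<bar> * \<bar>q - p\<bar>"
      using L2[OF z(1) pq(1)] mult_left_mono[OF z(2) L20] by (intro mult_right_mono) auto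
    finally show ?thesis by (simp add: power2_eq_square mult.assoc)
  qed
  have mu: "u \<in> borel_measurable M" "v \<in> borel_measurable M" using u v L2_spaceD by auto
  have mm: "(\<lambda>x. \<Phi> (u x)) \<in> borel_measurable M" "(\<lambda>x. \<Phi> (v x)) \<in> borel_measurable M"
    "(\<lambda>x. \<Phi>' (u x)) \<in> borel_measurable M"
    using mu m by measurable
  show \<Phi>'u: "(\<lambda>x. \<Phi>' (u x)) \<in> L2_space M"
    by (rule L2_bounded[OF mm(3), of L1]) (use u(2) in \<open>eventually_elim, use bd in auto\<close>)
  have i: "integrable M (\<lambda>x. \<Phi> (u x))" "integrable M (\<lambda>x. \<Phi> (v x))"
    by (rule L2_integrable, rule L2_bounded[OF mm(1), of L0], use u(2) in \<open>eventually_elim, use bd in auto\<close>)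
      (rule L2_integrable, rule L2_bounded[OF mm(2), of L0], use v(2) in \<open>eventually_elim, use bd in auto\<close>)
  have d: "(\<lambda>x. v x - u x) \<in> L2_space M" by (rule L2.V_diff[OF v(1) u(1)])
  note i' = L2_integrable_mult[OF \<Phi>'u d]
  have "(\<integral>x. \<Phi> (v x) \<partial>M) - (\<integral>x. \<Phi> (u x) \<partial>M) - L2_inner M (\<lambda>x. \<Phi>' (u x)) (\<lambda>x. v x - u x)
      = (\<integral>x. \<Phi> (v x) - \<Phi> (u x) - \<Phi>' (u x) * (v x - u x) \<partial>M)"
    using i i' by (simp add: L2_inner_def)
  also have "\<bar>\<dots>\<bar> \<le> (\<integral>x. \<bar>\<Phi> (v x) - \<Phi> (u x) - \<Phi>' (u x) * (v x - u x)\<bar> \<partial>M)"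
    by (rule integral_abs_bound)
  also have "\<dots> \<le> (\<integral>x. L2 * (v x - u x)\<^sup>2 \<partial>M)"
  proof (rule integral_mono_AE)
    show "AE x in M. \<bar>\<Phi> (v x) - \<Phi> (u x) - \<Phi>' (u x) * (v x - u x)\<bar> \<le> L2 * (v x - u x)\<^sup>2"
      using u(2) v(2) by eventually_elim (use pt in auto)
  qed (use i i' L2_spaceD(2)[OF d] in auto)
  also have "\<dots> = L2 * (L2_norm M (\<lambda>x. v x - u x))\<^sup>2"
    using L2.nrm_square[OF d] by (simp add: L2_norm_eq L2_inner_def power2_eq_square)
  finally show "\<bar>(\<integral>x. \<Phi> (v x) \<partial>M) - (\<integral>x. \<Phi> (u x) \<partial>M) - L2_inner M (\<lambda>x. \<Phi>' (u x)) (\<lambda>x. v x - u x)\<bar>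
      \<le> L2 * (L2_norm M (\<lambda>x. v x - u x))\<^sup>2" .
qed

lemma orbit_integral_derivative:
  assumes gen: "generates M P g g'" and ab: "AE x in M. a \<le> g x \<and> g x \<le> b"
    and m: "\<Phi> \<in> borel_measurable borel" "\<Phi>' \<in> borel_measurable borel"
    and der: "\<And>t. t \<in> {a..b} \<Longrightarrow> (\<Phi> has_real_derivative \<Phi>' t) (at t)"
      "\<And>t. t \<in> {a..b} \<Longrightarrow> (\<Phi>' has_real_derivative \<Phi>'' t) (at t)" "continuous_on {a..b} \<Phi>''"
    and t: "0 \<le> t"
  shows "((\<lambda>t. \<integral>x. \<Phi> (P t g x) \<partial>M) has_real_derivative L2_inner M (\<lambda>x. \<Phi>' (P t g x)) (P t g'))
      (at t within {0..})"
proof -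
  have g: "g \<in> L2_space M" and g': "g' \<in> L2_space M"
    and lim: "((\<lambda>h. L2_norm M (\<lambda>x. (P h g x - g x) / h - g' x)) \<longlongrightarrow> 0) (at_right 0)"
    using gen by (auto simp: generates_def)
  obtain L0 L1 L2 where L: "0 \<le> L0" "0 \<le> L1" "0 \<le> L2" "\<And>t. t \<in> {a..b} \<Longrightarrow> \<bar>\<Phi> t\<bar> \<le> L0"
    "\<And>t. t \<in> {a..b} \<Longrightarrow> \<bar>\<Phi>' t\<bar> \<le> L1"
    "\<And>s t. \<lbrakk>s \<in> {a..b}; t \<in> {a..b}\<rbrakk> \<Longrightarrow> \<bar>\<Phi> s - \<Phi> t\<bar> \<le> L1 * \<bar>s - t\<bar>"
    "\<And>s t. \<lbrakk>s \<in> {a..b}; t \<in> {a..b}\<rbrakk> \<Longrightarrow> \<bar>\<Phi>' s - \<Phi>' t\<bar> \<le> L2 * \<bar>s - t\<bar>"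
    using c2_constants[OF der] by blast
  define \<rho> where "\<rho> h = L2_norm M (\<lambda>x. (P h g x - g x) / h - g' x)" for h
  define \<sigma> where "\<sigma> h = L2_norm M (\<lambda>x. P h g' x - g' x)" for h
  define G where "G h = L2 * (h * (L2_norm M g' + \<rho> h)\<^sup>2) + L1 * (\<rho> h + \<sigma> h)" for h
  define y where "y t = (\<integral>x. \<Phi> (P t g x) \<partial>M)" for t
  define Y where "Y = L2_inner M (\<lambda>x. \<Phi>' (P t g x)) (P t g')"
  have "(G \<longlongrightarrow> L2 * (0 * (L2_norm M g' + 0)\<^sup>2) + L1 * (0 + 0)) (at_right 0)"
    unfolding G_def
    by (intro tendsto_intros) (use lim P_continuous[OF g'] in \<open>auto simp: \<rho>_def[abs_def] \<sigma>_def[abs_def]\<close>)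
  then have G0: "(G \<longlongrightarrow> 0) (at_right 0)" by simp
  have abs_lim: "filterlim (\<lambda>s. \<bar>s - t\<bar>) (at_right 0) (at t within {0..})"
    unfolding filterlim_at
  proof
    have "((\<lambda>s. \<bar>s - t\<bar>) \<longlongrightarrow> \<bar>t - t\<bar>) (at t within {0..})" by (intro tendsto_intros)
    then show "((\<lambda>s. \<bar>s - t\<bar>) \<longlongrightarrow> 0) (at t within {0..})" by simp
  qed (simp add: eventually_at_filter)
  have "((\<lambda>s. (y s - y t) / (s - t) - Y) \<longlongrightarrow> 0) (at t within {0..})"
  proof (rule Lim_null_comparison[OF _ filterlim_compose[OF G0 abs_lim]])
    show "\<forall>\<^sub>F s in at t within {0..}. norm ((y s - y t) / (s - t) - Y) \<le> G \<bar>s - t\<bar>"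
      unfolding eventually_at_filter
    proof (rule always_eventually, intro allI impI)
      fix s assume ne: "s \<noteq> t" and "s \<in> {0..}"
      then have s: "0 \<le> s" by simp
      define h where "h = \<bar>s - t\<bar>"
      have h: "0 < h" using ne by (simp add: h_def)
      note Ps = P_L2[OF s g] P_between[OF s g ab] and Pt = P_L2[OF t g] P_between[OF t g ab]
      note tay = integral_taylor[OF Pt Ps m der(1) L(4,5,7,3)]
      define d where "d = (\<lambda>x. P s g x - P t g x)"
      define e where "e = (\<lambda>x. P s g x - P t g x - (s - t) * P t g' x)"
      define F where "F = (\<lambda>x. \<Phi>' (P t g x))"
      have F: "F \<in> L2_space M" unfolding F_def by (rule tay(2))
      have dL: "d \<in> L2_space M" and eL: "e \<in> L2_space M"
        unfolding d_def e_def by (intro L2.V_diff L2.V_scale Ps Pt P_L2[OF t g'])+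
      have est: "L2_norm M d \<le> h * (L2_norm M g' + \<rho> h)" "L2_norm M e \<le> h * (\<rho> h + \<sigma> h)"
        using P_orbit_estimates[OF gen s t ne] by (simp_all add: h_def \<rho>_def \<sigma>_def d_def e_def)
      have "L2_inner M F e = L2_inner M F d - (s - t) * Y"
        using L2.B_diff_right[OF dL L2.V_scale[OF P_L2[OF t g'], of "s - t"] F]
          L2.B_scale_right[OF P_L2[OF t g'] F, of "s - t"]
        by (simp add: e_def d_def Y_def F_def)
      then have "y s - y t - (s - t) * Y = (y s - y t - L2_inner M F d) + L2_inner M F e" by simp
      moreover have "\<bar>y s - y t - L2_inner M F d\<bar> \<le> L2 * (L2_norm M d)\<^sup>2"
        using tay(1) by (simp add: y_def F_def d_def)
      moreover have "\<bar>L2_inner M F e\<bar> \<le> L1 * L2_norm M e"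
      proof -
        have "L2_norm M F \<le> \<bar>L1\<bar>"
          by (rule L2_norm_le_bound[OF L2_spaceD(1)[OF F]])
            (use Pt(2) in \<open>eventually_elim, use L(5) in \<open>auto simp: F_def\<close>\<close>)
        then have "L2_norm M F * L2_norm M e \<le> L1 * L2_norm M e"
          using L(2) L2.nrm_nonneg[OF eL] by (intro mult_right_mono) (auto simp: L2_norm_eq)
        then show ?thesis using L2.cauchy_schwarz[OF F eL] by (simp add: L2_norm_eq)
      qed
      moreover have "L2 * (L2_norm M d)\<^sup>2 \<le> L2 * (h * (L2_norm M g' + \<rho> h))\<^sup>2"
        using est(1) L(3) L2.nrm_nonneg[OF dL] by (intro mult_left_mono power_mono) (auto simp: L2_norm_eq)
      moreover have "L1 * L2_norm M e \<le> L1 * (h * (\<rho> h + \<sigma> h))"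
        using est(2) L(2) by (rule mult_left_mono)
      ultimately have "\<bar>y s - y t - (s - t) * Y\<bar> \<le> L2 * (h * (L2_norm M g' + \<rho> h))\<^sup>2 + L1 * (h * (\<rho> h + \<sigma> h))"
        by linarith
      also have "\<dots> = h * G h" by (simp add: G_def power2_eq_square algebra_simps)
      finally have le: "\<bar>y s - y t - (s - t) * Y\<bar> \<le> h * G h" .
      have "(y s - y t) / (s - t) - Y = (y s - y t - (s - t) * Y) / (s - t)"
        using ne by (simp add: field_simps)
      then have "\<bar>(y s - y t) / (s - t) - Y\<bar> = \<bar>y s - y t - (s - t) * Y\<bar> / h"
        by (simp add: abs_divide h_def)
      also have "\<dots> \<le> G h" using le h by (simp add: pos_divide_le_eq mult.commute)
      finally show "norm ((y s - y t) / (s - t) - Y) \<le> G \<bar>s - t\<bar>" by (simp add: h_def)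
    qed
  qed
  then have "((\<lambda>s. (y s - y t) / (s - t)) \<longlongrightarrow> Y) (at t within {0..})" by (simp add: LIM_zero_iff)
  then show ?thesis by (simp add: has_field_derivative_iff y_def Y_def)
qed

end

section \<open>The functions behind the entropies\<close>

text \<open>Normalised so that \<open>\<Psi>\<^sub>p(F powr (1/p)) = \<mu>(\<Phi>(F)) - \<Phi>(\<mu>(F))\<close>; see \<open>Psi_powr\<close>.\<close>

definition Phi :: "real \<Rightarrow> real \<Rightarrow> real" where
  "Phi p x = (if p = 2 then x * ln x / 2 else x powr (2 / p) / (2 - p))"

definition dPhi :: "real \<Rightarrow> real \<Rightarrow> real" where
  "dPhi p x = (if p = 2 then (ln x + 1) / 2 else 2 / (p * (2 - p)) * x powr (2 / p - 1))"

definition ddPhi :: "real \<Rightarrow> real \<Rightarrow> real" where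
  "ddPhi p x = 2 / p\<^sup>2 * x powr (2 / p - 2)"

lemma Phi_measurable: "Phi p \<in> borel_measurable borel" "dPhi p \<in> borel_measurable borel"
  unfolding Phi_def dPhi_def by measurable

lemma powr_derivative2:
  fixes x m :: real
  assumes "0 < x"
  shows "((\<lambda>x. x powr m) has_real_derivative m * x powr (m - 1)) (at x)"
    "((\<lambda>x. m * x powr (m - 1)) has_real_derivative m * ((m - 1) * x powr (m - 2))) (at x)"
  using assms by (auto intro!: derivative_eq_intros DERIV_cmult simp: algebra_simps)

lemma Phi_derivative:
  assumes p: "1 \<le> p" "p \<le> 2" and x: "0 < x"
  shows "(Phi p has_real_derivative dPhi p x) (at x)" "(dPhi p has_real_derivative ddPhi p x) (at x)"
proof -
  show "(Phi p has_real_derivative dPhi p x) (at x)"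
  proof (cases "p = 2")
    case True
    then show ?thesis
      using x unfolding Phi_def[abs_def] dPhi_def
      by (auto intro!: derivative_eq_intros simp: field_simps)
  next
    case False
    have "((\<lambda>x. x powr (2 / p) / (2 - p)) has_real_derivative 2 / p * x powr (2 / p - 1) / (2 - p)) (at x)"
      by (rule DERIV_cdivide[OF powr_derivative2(1)[OF x]])
    then show ?thesis using False unfolding Phi_def[abs_def] dPhi_def by simp
  qed
  show "(dPhi p has_real_derivative ddPhi p x) (at x)"
  proof (cases "p = 2")
    case True
    then show ?thesis
      using x unfolding dPhi_def[abs_def] ddPhi_def
      by (auto intro!: derivative_eq_intros simp: field_simps powr_minus)
  next
    case False
    have e: "2 / (p * (2 - p)) * ((2 / p - 1) * x powr (2 / p - 1 - 1)) = 2 / p\<^sup>2 * x powr (2 / p - 2)"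
    proof -
      have "2 / (p * (2 - p)) * (2 / p - 1) = 2 / p\<^sup>2"
        using False p by (simp add: field_simps power2_eq_square)
      then show ?thesis by (simp add: mult.assoc[symmetric])
    qed
    have "((\<lambda>x. 2 / (p * (2 - p)) * x powr (2 / p - 1)) has_real_derivative
        2 / (p * (2 - p)) * ((2 / p - 1) * x powr (2 / p - 1 - 1))) (at x)"
      by (rule DERIV_cmult[OF powr_derivative2(1)[OF x]])
    then show ?thesis using False unfolding e dPhi_def[abs_def] ddPhi_def by simp
  qed
qed

lemma ddPhi_continuous: "0 < a \<Longrightarrow> continuous_on {a..b} (ddPhi p)"
  unfolding ddPhi_def[abs_def] by (intro continuous_intros) auto

lemma powr_dd_continuous: "0 < (a::real) \<Longrightarrow> continuous_on {a..b} (\<lambda>x. m * ((m - 1) * x powr (m - 2)))"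
  by (intro continuous_intros) auto

lemma powr_lipschitz:
  fixes a b :: real
  assumes "0 < a"
  obtains L where "\<And>s t. \<lbrakk>s \<in> {a..b}; t \<in> {a..b}\<rbrakk> \<Longrightarrow> \<bar>s powr m - t powr m\<bar> \<le> L * \<bar>s - t\<bar>"
proof (rule c2_constants[of a b "\<lambda>x. x powr m" "\<lambda>x. m * x powr (m - 1)" "\<lambda>x. m * ((m - 1) * x powr (m - 2))"])
  show "((\<lambda>x. x powr m) has_real_derivative m * t powr (m - 1)) (at t)"
    "((\<lambda>x. m * x powr (m - 1)) has_real_derivative m * ((m - 1) * t powr (m - 2))) (at t)" if "t \<in> {a..b}" for t
    using powr_derivative2 that assms by auto
  show "continuous_on {a..b} (\<lambda>x. m * ((m - 1) * x powr (m - 2)))" by (rule powr_dd_continuous[OF assms])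
  fix L0 L1 L2 :: real
  assume "\<And>s t. \<lbrakk>s \<in> {a..b}; t \<in> {a..b}\<rbrakk> \<Longrightarrow> \<bar>s powr m - t powr m\<bar> \<le> L1 * \<bar>s - t\<bar>"
  then show thesis by (rule that)
qed

lemma dPhi_lipschitz:
  fixes a b :: real
  assumes "1 \<le> p" "p \<le> 2" "0 < a"
  obtains L where "\<And>s t. \<lbrakk>s \<in> {a..b}; t \<in> {a..b}\<rbrakk> \<Longrightarrow> \<bar>dPhi p s - dPhi p t\<bar> \<le> L * \<bar>s - t\<bar>"
proof -
  obtain L where L: "\<forall>t\<in>{a..b}. \<bar>ddPhi p t\<bar> \<le> L"
    using continuous_bounded_on_interval[OF ddPhi_continuous[OF assms(3)]] by blast
  show ?thesis
    by (rule that, rule derivative_bound_lipschitz[of a b "dPhi p" "ddPhi p"])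
      (use L assms Phi_derivative in auto)
qed

text \<open>With \<open>\<psi>(x) = x powr (1/p)\<close> one has \<open>\<Phi>'' = 2 \<psi>'\<^sup>2\<close>, so this is the Cauchy--Schwarz inequality for the
  integral of \<open>\<psi>'\<close> from \<open>t\<close> to \<open>s\<close>. It is proved by integrating \<open>2 (\<psi>' - k)\<^sup>2 \<ge> 0\<close>, where \<open>k\<close> is the
  mean of \<open>\<psi>'\<close>.\<close>

lemma dPhi_powr_inequality:
  assumes p: "1 \<le> p" "p \<le> 2" and st: "0 < s" "0 < t"
  shows "2 * (s powr (1 / p) - t powr (1 / p))\<^sup>2 \<le> (dPhi p s - dPhi p t) * (s - t)"
proof -
  have *: "2 * (s powr (1 / p) - t powr (1 / p))\<^sup>2 \<le> (dPhi p s - dPhi p t) * (s - t)"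
    if st: "0 < t" "t < s" for s t
  proof -
    define k where "k = (s powr (1 / p) - t powr (1 / p)) / (s - t)"
    define h where "h x = dPhi p x - 4 * k * x powr (1 / p) + 2 * k\<^sup>2 * x" for x
    have "h t \<le> h s"
    proof (rule DERIV_nonneg_imp_nondecreasing[OF less_imp_le[OF st(2)]])
      fix x assume "t \<le> x" "x \<le> s"
      then have x: "0 < x" using st by simp
      have "(h has_real_derivative ddPhi p x - 4 * k * (1 / p * x powr (1 / p - 1)) + 2 * k\<^sup>2) (at x)"
        unfolding h_def using x
        by (auto intro!: derivative_eq_intros Phi_derivative(2)[OF p x] powr_derivative2(1)[OF x])
      moreover have "ddPhi p x = 2 * (1 / p * x powr (1 / p - 1))\<^sup>2"
      proof -
        have "(x powr (1 / p - 1))\<^sup>2 = x powr (2 / p - 2)"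
          using x by (simp add: power2_eq_square flip: powr_add)
        then show ?thesis by (simp add: ddPhi_def power_mult_distrib power_divide)
      qed
      then have "ddPhi p x - 4 * k * (1 / p * x powr (1 / p - 1)) + 2 * k\<^sup>2
          = 2 * (1 / p * x powr (1 / p - 1) - k)\<^sup>2"
        by (simp add: power2_diff)
      ultimately show "\<exists>y. (h has_real_derivative y) (at x) \<and> 0 \<le> y" by force
    qed
    then have "4 * k * (s powr (1 / p) - t powr (1 / p)) - 2 * k\<^sup>2 * (s - t) \<le> dPhi p s - dPhi p t"
      by (simp add: h_def algebra_simps)
    moreover have kd: "s powr (1 / p) - t powr (1 / p) = k * (s - t)" using st by (simp add: k_def)
    ultimately have "2 * k\<^sup>2 * (s - t) \<le> dPhi p s - dPhi p t" by (simp add: power2_eq_square)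
    then have "2 * k\<^sup>2 * (s - t) * (s - t) \<le> (dPhi p s - dPhi p t) * (s - t)"
      using st by (intro mult_right_mono) auto
    then show ?thesis unfolding kd by (simp add: power2_eq_square mult_ac)
  qed
  show ?thesis
  proof (cases s t rule: linorder_cases)
    case less
    then show ?thesis using *[OF st(1) less] by (simp add: power2_commute algebra_simps)
  qed (use *[of t s] st in auto)
qed

lemma Psi_powr:
  assumes p: "1 \<le> p" "p \<le> 2" and m: "F \<in> borel_measurable M" and nn: "AE x in M. 0 \<le> F x"
  shows "Psi M p (\<lambda>x. F x powr (1 / p)) = (\<integral>x. Phi p (F x) \<partial>M) - Phi p (\<integral>x. F x \<partial>M)"
proof (cases "p = 2")
  case True
  have sq: "AE x in M. (F x powr (1 / 2))\<^sup>2 = F x"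
    using nn by eventually_elim (simp add: powr_half_sqrt)
  have "(\<integral>x. (F x powr (1 / 2))\<^sup>2 * ln ((F x powr (1 / 2))\<^sup>2) \<partial>M) = (\<integral>x. F x * ln (F x) \<partial>M)"
    by (rule integral_cong_AE) (use m sq in \<open>auto elim: eventually_mono\<close>)
  moreover have "(\<integral>x. (F x powr (1 / 2))\<^sup>2 \<partial>M) = (\<integral>x. F x \<partial>M)"
    by (rule integral_cong_AE) (use m sq in auto)
  ultimately show ?thesis using True by (simp add: Psi_def Ent_def Phi_def diff_divide_distrib)
next
  case False
  have "(\<integral>x. (F x powr (1 / p))\<^sup>2 \<partial>M) = (\<integral>x. F x powr (2 / p) \<partial>M)"
    by (rule Bochner_Integration.integral_cong) (auto simp: power2_eq_square simp flip: powr_add)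
  moreover have "(\<integral>x. (F x powr (1 / p)) powr p \<partial>M) = (\<integral>x. F x \<partial>M)"
    by (rule integral_cong_AE) (use m nn p in \<open>auto simp: powr_powr elim!: eventually_mono\<close>)
  ultimately show ?thesis using False by (simp add: Psi_def Phi_def diff_divide_distrib)
qed

context associated_form
begin

lemma Psi_orbit_derivative:
  assumes p: "1 \<le> p" "p \<le> 2" and gen: "generates M P g g'"
    and ab: "AE x in M. a \<le> g x \<and> g x \<le> b" and a: "0 < a" and t: "0 \<le> t"
  shows "((\<lambda>t. Psi M p (\<lambda>x. P t g x powr (1 / p))) has_real_derivative
      - \<E> (\<lambda>x. dPhi p (P t g x)) (P t g)) (at t within {0..})"
proof -
  have g: "g \<in> L2_space M" using gen by (simp add: generates_def)
  have Psi_eq: "Psi M p (\<lambda>x. P t g x powr (1 / p)) = (\<integral>x. Phi p (P t g x) \<partial>M) - Phi p (\<integral>x. g x \<partial>M)"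
    if t: "0 \<le> t" for t
  proof -
    have "AE x in M. 0 \<le> P t g x" using P_between[OF t g ab] by eventually_elim (use a in auto)
    then show ?thesis using Psi_powr[OF p P_meas[OF t g]] P_mean[OF t g] by simp
  qed
  note gP = generates_P[OF gen t]
  have D: "P t g \<in> D" using gP by (simp add: generates_iff)
  obtain L where "\<And>s t. \<lbrakk>s \<in> {a..b}; t \<in> {a..b}\<rbrakk> \<Longrightarrow> \<bar>dPhi p s - dPhi p t\<bar> \<le> L * \<bar>s - t\<bar>"
    using dPhi_lipschitz[OF p a] by blast
  then have dD: "(\<lambda>x. dPhi p (P t g x)) \<in> D"
    by (rule form_contraction(1)[OF D P_between[OF t g ab] Phi_measurable(2)])
  have E: "L2_inner M (\<lambda>x. dPhi p (P t g x)) (P t g') = - \<E> (\<lambda>x. dPhi p (P t g x)) (P t g)"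
    using gP dD by (simp add: generates_iff)
  have "((\<lambda>t. \<integral>x. Phi p (P t g x) \<partial>M) has_real_derivative L2_inner M (\<lambda>x. dPhi p (P t g x)) (P t g'))
      (at t within {0..})"
    by (rule orbit_integral_derivative[OF gen ab Phi_measurable _ _ ddPhi_continuous[OF a, of b p] t])
      (use Phi_derivative[OF p] a in auto)
  then have "((\<lambda>t. (\<integral>x. Phi p (P t g x) \<partial>M) - Phi p (\<integral>x. g x \<partial>M)) has_real_derivative
      - \<E> (\<lambda>x. dPhi p (P t g x)) (P t g)) (at t within {0..})"
    unfolding E by (auto intro!: derivative_eq_intros)
  then show ?thesis
    by (rule has_field_derivative_transform_within[where d=1]) (use Psi_eq t in auto)
qed

end

section \<open>Oscillation and continuity of the entropies\<close>

context prob_space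
begin

text \<open>The essential supremum is itself an almost sure bound, and it is finite because \<open>\<mu>\<close> is not the zero
  measure.\<close>

lemma Osc_attained:
  assumes m: "f \<in> borel_measurable M" and ab: "AE x in M. a \<le> f x \<and> f x \<le> b"
  obtains c d where "AE x in M. c \<le> f x \<and> f x \<le> d" "Osc M f = d - c" "c \<le> d" "a \<le> c" "d \<le> b"
proof -
  have between: "\<exists>d. esssup M (\<lambda>x. ereal (g x)) = ereal d \<and> (AE x in M. g x \<le> d) \<and> d \<le> b"
    if g: "g \<in> borel_measurable M" "AE x in M. a \<le> g x \<and> g x \<le> b" for g :: "'a \<Rightarrow> real" and a b
  proof -
    define S where "S = esssup M (\<lambda>x. ereal (g x))"
    have gm: "(\<lambda>x. ereal (g x)) \<in> borel_measurable M" using g(1) by measurable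
    have up: "S \<le> ereal b" unfolding S_def
      by (rule esssup_I[OF gm]) (use g(2) in \<open>auto elim: eventually_mono\<close>)
    have ae: "AE x in M. ereal (g x) \<le> S" unfolding S_def by (rule esssup_AE)
    have "ereal a \<le> S"
    proof (rule ccontr)
      assume "\<not> ereal a \<le> S"
      have "AE x in M. False"
        using ae g(2) by eventually_elim (use \<open>\<not> ereal a \<le> S\<close> in \<open>meson dual_order.trans ereal_less_eq(3)\<close>)
      then show False by simp
    qed
    then obtain d where d: "S = ereal d" using up by (cases S) auto
    show ?thesis using ae up unfolding S_def[symmetric] d by auto
  qed
  obtain d where d: "esssup M (\<lambda>x. ereal (f x)) = ereal d" "AE x in M. f x \<le> d" "d \<le> b"
    using between[OF m ab] by blast
  have ab': "AE x in M. - b \<le> - f x \<and> - f x \<le> - a" using ab by eventually_elim simp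
  obtain c where c: "esssup M (\<lambda>x. ereal (- f x)) = ereal c" "AE x in M. - f x \<le> c" "c \<le> - a"
    using between[OF borel_measurable_uminus[OF m] ab'] by blast
  have cd: "AE x in M. - c \<le> f x \<and> f x \<le> d" using c(2) d(2) by eventually_elim simp
  show ?thesis
    by (rule that[OF cd]) (use c d AE_interval_nonempty[OF cd] in \<open>auto simp: Osc_def essinf_def\<close>)
qed

lemma Osc_bounds:
  assumes "f \<in> borel_measurable M" "AE x in M. a \<le> f x \<and> f x \<le> b"
  shows "0 \<le> Osc M f" "Osc M f \<le> b - a"
proof -
  obtain c d where "Osc M f = d - c" "c \<le> d" "a \<le> c" "d \<le> b" by (rule Osc_attained[OF assms])
  then show "0 \<le> Osc M f" "Osc M f \<le> b - a" by auto
qed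

text \<open>A continuous function on a compact interval satisfies \<open>\<bar>\<Phi> s - \<Phi> t\<bar> \<le> \<epsilon> / 2 + K (s - t)\<^sup>2\<close> for a suitable
  \<open>K\<close>.\<close>

lemma integral_compose_tendsto:
  fixes \<Phi> :: "real \<Rightarrow> real"
  assumes us: "\<And>n. us n \<in> L2_space M" "\<And>n. AE x in M. a \<le> us n x \<and> us n x \<le> b"
    and u: "u \<in> L2_space M" "AE x in M. a \<le> u x \<and> u x \<le> b"
    and \<Phi>: "\<Phi> \<in> borel_measurable borel" "continuous_on {a..b} \<Phi>"
    and lim: "(\<lambda>n. L2_norm M (\<lambda>x. us n x - u x)) \<longlonglongrightarrow> 0"
  shows "(\<lambda>n. \<integral>x. \<Phi> (us n x) \<partial>M) \<longlonglongrightarrow> (\<integral>x. \<Phi> (u x) \<partial>M)"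
proof (rule LIMSEQ_I)
  fix \<epsilon> :: real assume \<epsilon>: "0 < \<epsilon>"
  obtain L where L: "0 \<le> L" "\<forall>t\<in>{a..b}. \<bar>\<Phi> t\<bar> \<le> L" using continuous_bounded_on_interval[OF \<Phi>(2)] by blast
  have "uniformly_continuous_on {a..b} \<Phi>"
    using compact_uniformly_continuous[OF \<Phi>(2) compact_Icc] .
  then obtain \<delta> where \<delta>: "0 < \<delta>" "\<And>s t. \<lbrakk>s \<in> {a..b}; t \<in> {a..b}; \<bar>s - t\<bar> < \<delta>\<rbrakk> \<Longrightarrow> \<bar>\<Phi> s - \<Phi> t\<bar> < \<epsilon> / 2"
    unfolding uniformly_continuous_on_def dist_real_def using \<epsilon> by (metis half_gt_zero)
  define K where "K = 2 * L / \<delta>\<^sup>2"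
  have K: "0 \<le> K" using L by (simp add: K_def)
  have pt: "\<bar>\<Phi> s - \<Phi> t\<bar> \<le> \<epsilon> / 2 + K * (s - t)\<^sup>2" if st: "s \<in> {a..b}" "t \<in> {a..b}" for s t
  proof (cases "\<bar>s - t\<bar> < \<delta>")
    case True
    then show ?thesis using \<delta>(2)[OF st True] K by (smt (verit) mult_nonneg_nonneg zero_le_power2)
  next
    case False
    then have "\<delta>\<^sup>2 \<le> (s - t)\<^sup>2" using \<delta>(1) by (metis abs_le_square_iff abs_of_pos not_less)
    then have "2 * L \<le> K * (s - t)\<^sup>2"
      unfolding K_def using L(1) \<delta>(1) by (simp add: pos_le_divide_eq mult_left_mono)
    moreover have "\<bar>\<Phi> s - \<Phi> t\<bar> \<le> 2 * L" using L(2) st by (smt (verit))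
    ultimately show ?thesis using \<epsilon> by linarith
  qed
  have "(\<lambda>n. K * (L2_norm M (\<lambda>x. us n x - u x))\<^sup>2) \<longlonglongrightarrow> K * 0\<^sup>2" by (intro tendsto_intros lim)
  then have K0: "(\<lambda>n. K * (L2_norm M (\<lambda>x. us n x - u x))\<^sup>2) \<longlonglongrightarrow> 0" by simp
  obtain N where N: "\<And>n. N \<le> n \<Longrightarrow> norm (K * (L2_norm M (\<lambda>x. us n x - u x))\<^sup>2 - 0) < \<epsilon> / 2"
    using LIMSEQ_D[OF K0 half_gt_zero[OF \<epsilon>]] by blast
  have i: "integrable M (\<lambda>x. \<Phi> (v x))" if v: "v \<in> L2_space M" "AE x in M. a \<le> v x \<and> v x \<le> b" for v
  proof (rule L2_integrable, rule L2_bounded)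
    show "(\<lambda>x. \<Phi> (v x)) \<in> borel_measurable M" using L2_spaceD(1)[OF v(1)] \<Phi>(1) by measurable
    show "AE x in M. \<bar>\<Phi> (v x)\<bar> \<le> L" using v(2) by eventually_elim (use L in auto)
  qed
  have "norm ((\<integral>x. \<Phi> (us n x) \<partial>M) - (\<integral>x. \<Phi> (u x) \<partial>M)) < \<epsilon>" if n: "N \<le> n" for n
  proof -
    have d: "(\<lambda>x. us n x - u x) \<in> L2_space M" by (rule L2.V_diff[OF us(1) u(1)])
    have "(\<integral>x. \<Phi> (us n x) \<partial>M) - (\<integral>x. \<Phi> (u x) \<partial>M) = (\<integral>x. \<Phi> (us n x) - \<Phi> (u x) \<partial>M)"
      using i[OF us] i[OF u] by simp
    also have "\<bar>\<dots>\<bar> \<le> (\<integral>x. \<bar>\<Phi> (us n x) - \<Phi> (u x)\<bar> \<partial>M)" by (rule integral_abs_bound)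
    also have "\<dots> \<le> (\<integral>x. \<epsilon> / 2 + K * (us n x - u x)\<^sup>2 \<partial>M)"
    proof (rule integral_mono_AE)
      show "AE x in M. \<bar>\<Phi> (us n x) - \<Phi> (u x)\<bar> \<le> \<epsilon> / 2 + K * (us n x - u x)\<^sup>2"
        using us(2)[of n] u(2) by eventually_elim (use pt in auto)
    qed (use i[OF us] i[OF u] L2_spaceD(2)[OF d] in auto)
    also have "\<dots> = \<epsilon> / 2 + K * (L2_norm M (\<lambda>x. us n x - u x))\<^sup>2"
      using L2.nrm_square[OF d] L2_spaceD(2)[OF d]
      by (simp add: L2_norm_eq L2_inner_def power2_eq_square prob_space)
    also have "\<dots> < \<epsilon>" using N[OF n] by simp
    finally show ?thesis by simp
  qed
  then show "\<exists>N. \<forall>n\<ge>N. norm ((\<integral>x. \<Phi> (us n x) \<partial>M) - (\<integral>x. \<Phi> (u x) \<partial>M)) < \<epsilon>" by blast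
qed

lemma Phi_continuous: assumes p: "1 \<le> p" "p \<le> 2" shows "continuous_on {0..b} (Phi p)"
proof (cases "p = 2")
  case True
  have "continuous (at t within {0..b}) (\<lambda>x. x * ln x / 2)" if t: "t \<in> {0..b}" for t
  proof (cases "t = 0")
    case True
    have "((\<lambda>x::real. x * ln x / 2) \<longlongrightarrow> 0) (at_right 0)" by real_asymp
    moreover have "at 0 within {0..b} \<le> at_right (0::real)"
    proof -
      have "at 0 within {0..b} = at 0 within ({0..b} - {0})" by (simp add: at_within_def)
      also have "\<dots> \<le> at_right 0" by (rule at_le) auto
      finally show ?thesis .
    qed
    ultimately have "((\<lambda>x::real. x * ln x / 2) \<longlongrightarrow> 0) (at 0 within {0..b})"
      by (rule tendsto_mono[rotated])
    then show ?thesis unfolding True continuous_within by simp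
  next
    case False
    then have "isCont (\<lambda>x. x * ln x / 2) t" using t by (intro continuous_intros) auto
    then show ?thesis by (rule continuous_at_imp_continuous_within)
  qed
  then show ?thesis using True unfolding Phi_def[abs_def] by (simp add: continuous_on_eq_continuous_within)
next
  case False
  then show ?thesis unfolding Phi_def[abs_def]
    using p by (auto intro!: continuous_intros continuous_on_powr')
qed

lemma Psi_tendsto:
  assumes p: "1 \<le> p" "p \<le> 2"
    and us: "\<And>n. us n \<in> L2_space M" "\<And>n. AE x in M. 0 \<le> us n x \<and> us n x \<le> b"
    and u: "u \<in> L2_space M" "AE x in M. 0 \<le> u x \<and> u x \<le> b"
    and lim: "(\<lambda>n. L2_norm M (\<lambda>x. us n x - u x)) \<longlonglongrightarrow> 0"
  shows "(\<lambda>n. Psi M p (\<lambda>x. us n x powr (1 / p))) \<longlonglongrightarrow> Psi M p (\<lambda>x. u x powr (1 / p))"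
proof -
  have b: "0 \<le> b" by (rule AE_interval_nonempty[OF u(2)])
  have mean: "(\<integral>x. v x \<partial>M) \<in> {0..b}" if v: "v \<in> L2_space M" "AE x in M. 0 \<le> v x \<and> v x \<le> b" for v
  proof -
    have "(\<integral>x. 0 \<partial>M) \<le> (\<integral>x. v x \<partial>M)" "(\<integral>x. v x \<partial>M) \<le> (\<integral>x. b \<partial>M)"
      by (rule integral_mono_AE; use L2_integrable[OF v(1)] v(2) in \<open>auto elim: eventually_mono\<close>)+
    then show ?thesis by (simp add: prob_space)
  qed
  have "(\<lambda>n. \<integral>x. us n x \<partial>M) \<longlonglongrightarrow> (\<integral>x. u x \<partial>M)"
    using integral_compose_tendsto[OF us u _ _ lim, of "\<lambda>x. x"] by (simp add: continuous_on_id)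
  then have "(\<lambda>n. Phi p (\<integral>x. us n x \<partial>M)) \<longlonglongrightarrow> Phi p (\<integral>x. u x \<partial>M)"
    by (rule continuous_on_tendsto_compose[OF Phi_continuous[OF p, of b]])
      (use mean[OF us] mean[OF u] in \<open>auto intro: always_eventually\<close>)
  then have "(\<lambda>n. (\<integral>x. Phi p (us n x) \<partial>M) - Phi p (\<integral>x. us n x \<partial>M))
      \<longlonglongrightarrow> (\<integral>x. Phi p (u x) \<partial>M) - Phi p (\<integral>x. u x \<partial>M)"
    by (intro tendsto_diff integral_compose_tendsto[OF us u Phi_measurable(1) Phi_continuous[OF p] lim])
  moreover have "Psi M p (\<lambda>x. v x powr (1 / p)) = (\<integral>x. Phi p (v x) \<partial>M) - Phi p (\<integral>x. v x \<partial>M)"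
    if "v \<in> L2_space M" "AE x in M. 0 \<le> v x \<and> v x \<le> b" for v
    using that L2_spaceD(1)[OF that(1)] by (intro Psi_powr[OF p]) (auto elim: eventually_mono)
  ultimately show ?thesis using us u by simp
qed

lemma Psi_cong_AE:
  assumes "f \<in> borel_measurable M" "g \<in> borel_measurable M" "AE x in M. f x = g x"
  shows "Psi M p f = Psi M p g"
proof -
  have "(\<integral>x. (f x)\<^sup>2 \<partial>M) = (\<integral>x. (g x)\<^sup>2 \<partial>M)" "(\<integral>x. f x powr p \<partial>M) = (\<integral>x. g x powr p \<partial>M)"
    "(\<integral>x. (f x)\<^sup>2 * ln ((f x)\<^sup>2) \<partial>M) = (\<integral>x. (g x)\<^sup>2 * ln ((g x)\<^sup>2) \<partial>M)"
    by (rule integral_cong_AE; use assms in \<open>auto elim: eventually_mono\<close>)+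
  then show ?thesis by (simp add: Psi_def Ent_def)
qed

lemma Psi_const:
  assumes p: "1 \<le> p" "p \<le> 2" and m: "f \<in> borel_measurable M" and c: "0 \<le> c" "AE x in M. f x = c"
  shows "Psi M p (\<lambda>x. f x powr (1 / p)) = 0"
proof -
  have "Psi M p (\<lambda>x. f x powr (1 / p)) = Psi M p (\<lambda>x. c powr (1 / p))"
    by (rule Psi_cong_AE) (use m c in \<open>auto elim: eventually_mono\<close>)
  also have "\<dots> = 0" using Psi_powr[OF p, of "\<lambda>x. c" M] c by (simp add: prob_space)
  finally show ?thesis .
qed

end

text \<open>Concavity of the power: adding \<open>\<delta>\<close> to a nonnegative function does not increase the oscillation of its
  \<open>p\<close>-th root.\<close>

lemma powr_shift_difference:
  fixes x y \<delta> m :: real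
  assumes xy: "0 \<le> x" "x \<le> y" and \<delta>: "0 \<le> \<delta>" and m: "0 < m" "m \<le> 1"
  shows "(y + \<delta>) powr m - (x + \<delta>) powr m \<le> y powr m - x powr m"
proof (cases "x = y")
  case False
  define h where "h z = (z + \<delta>) powr m - z powr m" for z
  have "h y \<le> h x"
  proof (rule DERIV_nonpos_imp_decreasing_open[of x y h])
    show "x \<le> y" by fact
    show "continuous_on {x..y} h" unfolding h_def
      using xy \<delta> m by (intro continuous_intros continuous_on_powr') auto
    fix z assume "x < z" "z < y"
    then have z: "0 < z" using xy by simp
    have "(h has_real_derivative m * (z + \<delta>) powr (m - 1) - m * z powr (m - 1)) (at z)"
      unfolding h_def using z \<delta> by (auto intro!: derivative_eq_intros)
    moreover have "(z + \<delta>) powr (m - 1) \<le> z powr (m - 1)" using z \<delta> m by (intro powr_mono2') auto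
    then have "m * (z + \<delta>) powr (m - 1) - m * z powr (m - 1) \<le> 0" using m by simp
    ultimately show "\<exists>y. (h has_real_derivative y) (at z) \<and> y \<le> 0" by blast
  qed
  then show ?thesis by (simp add: h_def)
qed simp

lemma powr_increment_le:
  fixes x y b p :: real
  assumes xy: "0 \<le> x" "x \<le> y" "y \<le> b" and p: "1 \<le> p"
  shows "y powr p - x powr p \<le> p * b powr (p - 1) * (y - x)"
proof (cases "x = y")
  case False
  define h where "h z = z powr p - p * b powr (p - 1) * z" for z
  have "h y \<le> h x"
  proof (rule DERIV_nonpos_imp_decreasing_open[of x y h])
    show "x \<le> y" by fact
    show "continuous_on {x..y} h" unfolding h_def
      using xy p by (intro continuous_intros continuous_on_powr') auto
    fix z assume z': "x < z" "z < y"
    then have z: "0 < z" using xy by simp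
    have "(h has_real_derivative p * z powr (p - 1) - p * b powr (p - 1)) (at z)"
      unfolding h_def using z by (auto intro!: derivative_eq_intros)
    moreover have "z powr (p - 1) \<le> b powr (p - 1)" using z z' xy p by (intro powr_mono2) auto
    then have "p * z powr (p - 1) - p * b powr (p - 1) \<le> 0" using p by simp
    ultimately show "\<exists>y. (h has_real_derivative y) (at z) \<and> y \<le> 0" by blast
  qed
  then show ?thesis by (simp add: h_def algebra_simps)
qed simp

section \<open>The dissipation under the power identity or symmetry\<close>

context associated_form
begin

lemma powr_D:
  assumes u: "u \<in> D" "AE x in M. a \<le> u x \<and> u x \<le> b" and a: "0 < a"
  shows "(\<lambda>x. u x powr m) \<in> D"
proof -
  obtain L where L: "\<And>s t. \<lbrakk>s \<in> {a..b}; t \<in> {a..b}\<rbrakk> \<Longrightarrow> \<bar>s powr m - t powr m\<bar> \<le> L * \<bar>s - t\<bar>"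
    using powr_lipschitz[OF a, of b m] by blast
  show ?thesis by (rule form_contraction(1)[OF u _ L]) auto
qed

text \<open>Functions with small derivative on the range of \<open>u\<close> have small energy by the contraction property, and a
  common zero controls their size.\<close>

lemma form_small_compose:
  assumes u: "u \<in> D" "AE x in M. a \<le> u x \<and> u x \<le> b"
    and \<phi>: "\<And>n. \<phi> n \<in> borel_measurable borel"
    and der: "\<And>n t. t \<in> {a..b} \<Longrightarrow> (\<phi> n has_real_derivative \<phi>' n t) (at t)"
    and D: "\<And>n. (\<lambda>x. \<phi> n (u x)) \<in> D"
    and small: "\<And>\<epsilon>. 0 < \<epsilon> \<Longrightarrow> \<forall>\<^sub>F n in sequentially. \<forall>t\<in>{a..b}. \<bar>\<phi>' n t\<bar> \<le> \<epsilon>"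
    and x0: "x0 \<in> {a..b}" "\<And>n. \<phi> n x0 = 0"
  shows "(\<lambda>n. H.nrm (\<lambda>x. \<phi> n (u x))) \<longlonglongrightarrow> 0"
proof (rule LIMSEQ_I)
  fix \<epsilon> :: real assume \<epsilon>: "0 < \<epsilon>"
  define C where "C = sqrt (\<E> u u + (b - a)\<^sup>2)"
  have C: "0 \<le> C" using form_nonneg[OF u(1)] by (simp add: C_def)
  define \<eta> where "\<eta> = \<epsilon> / (C + 1)"
  have \<eta>: "0 < \<eta>" using \<epsilon> C by (simp add: \<eta>_def)
  have le: "a \<le> b" by (rule AE_interval_nonempty[OF u(2)])
  obtain N where N: "\<And>n t. \<lbrakk>N \<le> n; t \<in> {a..b}\<rbrakk> \<Longrightarrow> \<bar>\<phi>' n t\<bar> \<le> \<eta>"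
    using small[OF \<eta>] unfolding eventually_sequentially by blast
  have "norm (H.nrm (\<lambda>x. \<phi> n (u x)) - 0) < \<epsilon>" if n: "N \<le> n" for n
  proof -
    have lip: "\<bar>\<phi> n s - \<phi> n t\<bar> \<le> \<eta> * \<bar>s - t\<bar>" if "s \<in> {a..b}" "t \<in> {a..b}" for s t
      by (rule derivative_bound_lipschitz[OF der N[OF n] that])
    have E: "\<E> (\<lambda>x. \<phi> n (u x)) (\<lambda>x. \<phi> n (u x)) \<le> \<eta>\<^sup>2 * \<E> u u"
      by (rule form_contraction(2)[OF u \<phi> lip])
    have "L2_norm M (\<lambda>x. \<phi> n (u x)) \<le> \<bar>\<eta> * (b - a)\<bar>"
    proof (rule L2_norm_le_bound[OF D_meas[OF D]])
      show "AE x in M. \<bar>\<phi> n (u x)\<bar> \<le> \<eta> * (b - a)"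
        using u(2)
      proof eventually_elim
        fix x assume x: "a \<le> u x \<and> u x \<le> b"
        have "\<bar>\<phi> n (u x)\<bar> \<le> \<eta> * \<bar>u x - x0\<bar>" using lip[of "u x" x0] x x0 by simp
        also have "\<dots> \<le> \<eta> * (b - a)" using x x0(1) \<eta> by (intro mult_left_mono) auto
        finally show "\<bar>\<phi> n (u x)\<bar> \<le> \<eta> * (b - a)" .
      qed
    qed
    then have "L2_norm M (\<lambda>x. \<phi> n (u x)) \<le> \<eta> * (b - a)" using \<eta> le by simp
    from nrm_le[OF D E this] have "H.nrm (\<lambda>x. \<phi> n (u x)) \<le> sqrt (\<eta>\<^sup>2 * (\<E> u u + (b - a)\<^sup>2))"
      by (simp add: power_mult_distrib distrib_left)
    also have "\<dots> = \<eta> * C" using \<eta> by (simp add: real_sqrt_mult C_def)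
    also have "\<dots> < \<eta> * (C + 1)" using \<eta> by simp
    also have "\<dots> = \<epsilon>" using C by (simp add: \<eta>_def)
    finally show ?thesis using D by simp
  qed
  then show "\<exists>N. \<forall>n\<ge>N. norm (H.nrm (\<lambda>x. \<phi> n (u x)) - 0) < \<epsilon>" by blast
qed

end

text \<open>The factor \<open>c + d * r\<close> covers both families of derivatives that occur below: that of \<open>t powr r\<close> (\<open>c = 0\<close>,
  \<open>d = 1\<close>) and that of \<open>(t powr r - 1) / r\<close> (\<open>c = 1\<close>, \<open>d = 0\<close>).\<close>

lemma powr_uniform_in_exponent:
  fixes a b c :: real
  assumes a: "0 < a" and r: "r \<longlonglongrightarrow> r0" and \<epsilon>: "0 < \<epsilon>"
  shows "\<forall>\<^sub>F n in sequentially. \<forall>t\<in>{a..b}. \<bar>(c + d * r n) * t powr (r n - 1) - (c + d * r0) * t powr (r0 - 1)\<bar> \<le> \<epsilon>"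
proof -
  define K where "K z = (c + d * fst z) * snd z powr (fst z - 1)" for z :: "real \<times> real"
  define S where "S = {r0 - 1..r0 + 1} \<times> {a..b}"
  have "continuous_on S K" unfolding K_def S_def using a by (intro continuous_intros) auto
  moreover have "compact S" unfolding S_def by (intro compact_Times compact_Icc)
  ultimately have "uniformly_continuous_on S K" by (rule compact_uniformly_continuous)
  then obtain \<delta> where \<delta>: "0 < \<delta>" "\<And>z z'. \<lbrakk>z \<in> S; z' \<in> S; dist z' z < \<delta>\<rbrakk> \<Longrightarrow> dist (K z') (K z) < \<epsilon>"
    using \<epsilon> unfolding uniformly_continuous_on_def by metis
  have "\<forall>\<^sub>F n in sequentially. dist (r n) r0 < min \<delta> 1"
    by (rule tendstoD[OF r]) (use \<delta> in simp)
  then show ?thesis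
  proof eventually_elim
    fix n assume n: "dist (r n) r0 < min \<delta> 1"
    show "\<forall>t\<in>{a..b}. \<bar>(c + d * r n) * t powr (r n - 1) - (c + d * r0) * t powr (r0 - 1)\<bar> \<le> \<epsilon>"
    proof
      fix t assume t: "t \<in> {a..b}"
      have "(r0, t) \<in> S" "(r n, t) \<in> S" using n t by (auto simp: S_def dist_real_def)
      moreover have "dist (r n, t) (r0, t) < \<delta>" using n by (simp add: dist_Pair_Pair)
      ultimately have "dist (K (r n, t)) (K (r0, t)) < \<epsilon>" by (rule \<delta>(2))
      then show "\<bar>(c + d * r n) * t powr (r n - 1) - (c + d * r0) * t powr (r0 - 1)\<bar> \<le> \<epsilon>"
        by (simp add: K_def dist_real_def)
    qed
  qed
qed

context associated_form
begin

text \<open>Divide the power identity by \<open>q\<close> and let \<open>q\<close> tend to 0. Because \<open>\<E> 1 F = 0\<close>, the function \<open>F powr q / q\<close>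
  may be replaced by \<open>(F powr q - 1) / q\<close>, which tends to \<open>ln F\<close>.\<close>

lemma power_identity_entropy:
  assumes pid: "power_identity M \<E> P" and gen: "generates M P F G"
    and ab: "AE x in M. a \<le> F x \<and> F x \<le> b" and a: "0 < a"
  shows "\<E> (\<lambda>x. dPhi 2 (F x)) F = 2 * \<E> (\<lambda>x. F x powr (1/2)) (\<lambda>x. F x powr (1/2))"
proof -
  define a' where "a' = min a 1"
  define b' where "b' = max b 1"
  have a': "0 < a'" and one: "1 \<in> {a'..b'}" using a by (auto simp: a'_def b'_def)
  have ab': "AE x in M. a' \<le> F x \<and> F x \<le> b'" using ab by eventually_elim (auto simp: a'_def b'_def)
  have F: "F \<in> D" and G: "G \<in> L2_space M" and EG: "\<And>v. v \<in> D \<Longrightarrow> \<E> v F = - L2_inner M v G"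
    using gen by (auto simp: generates_iff)
  note pD = powr_D[OF F ab' a']
  have dom: "F \<in> generator_domain M P" using gen by (auto simp: generator_domain_def)
  have bd: "ess_bounded M F" unfolding ess_bounded_def
    by (rule exI[of _ b']) (use ab' in \<open>eventually_elim, use a' in auto\<close>)
  have up: "uniformly_positive M F" unfolding uniformly_positive_def
    using ab' a' by (intro exI[of _ a']) (auto elim: eventually_mono)
  define q where "q n = 1 / (real n + 1)" for n
  have q: "0 < q n" for n by (simp add: q_def)
  have q0: "q \<longlonglongrightarrow> 0" using LIMSEQ_inverse_real_of_nat by (simp add: q_def[abs_def] inverse_eq_divide add.commute)
  have qh: "(\<lambda>n. (1 + q n) / 2) \<longlonglongrightarrow> 1 / 2"
    using tendsto_divide[OF tendsto_add[OF tendsto_const[of 1] q0] tendsto_const[of 2]] by simp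
  have mean0: "(\<integral>x. G x \<partial>M) = 0" by (rule generates_mean_zero[OF gen])
  \<comment> \<open>The difference between \<open>(t powr q - 1) / q\<close> and \<open>ln t\<close> has a zero at 1 and a uniformly small derivative;
    the interval was enlarged to contain 1.\<close>
  define e where "e n t = (t powr q n - 1) / q n" for n t
  define el where "el n t = e n t - ln t" for n t
  obtain L where L: "\<And>s t. \<lbrakk>s \<in> {a'..b'}; t \<in> {a'..b'}\<rbrakk> \<Longrightarrow> \<bar>dPhi 2 s - dPhi 2 t\<bar> \<le> L * \<bar>s - t\<bar>"
    using dPhi_lipschitz[of 2 a' b'] a' by auto
  have dD: "(\<lambda>x. dPhi 2 (F x)) \<in> D" by (rule form_contraction(1)[OF F ab' Phi_measurable(2) L])
  have "(\<lambda>x. 2 * dPhi 2 (F x) + (-1) * 1) \<in> D" by (rule D_comb[OF dD one_D])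
  also have "(\<lambda>x. 2 * dPhi 2 (F x) + (-1) * 1) = (\<lambda>x. ln (F x))"
    by (simp add: dPhi_def add_divide_distrib)
  finally have lnD: "(\<lambda>x. ln (F x)) \<in> D" .
  have "(\<lambda>x. 1 / q n * F x powr q n + (- (1 / q n)) * 1) \<in> D" for n by (rule D_comb[OF pD one_D])
  then have eD: "(\<lambda>x. e n (F x)) \<in> D" for n by (simp add: e_def diff_divide_distrib)
  have elD: "(\<lambda>x. el n (F x)) \<in> D" for n unfolding el_def by (rule dom_diff[OF eD lnD])
  have "(\<lambda>n. H.nrm (\<lambda>x. el n (F x))) \<longlonglongrightarrow> 0"
  proof (rule form_small_compose[OF F ab' _ _ elD])
    show "el n \<in> borel_measurable borel" for n unfolding el_def e_def by measurable
    show "(el n has_real_derivative (1 + 0 * q n) * t powr (q n - 1) - (1 + 0 * 0) * t powr (0 - 1)) (at t)"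
      if "t \<in> {a'..b'}" for n t
    proof -
      have t: "0 < t" using that a' by auto
      have "((\<lambda>t. (t powr q n - 1) / q n - ln t) has_real_derivative (q n * t powr (q n - 1) - 0) / q n - 1 / t) (at t)"
        using t q[of n]
        by (intro DERIV_diff DERIV_cdivide powr_derivative2(1) DERIV_const DERIV_ln_divide) auto
      moreover have "(q n * t powr (q n - 1) - 0) / q n - 1 / t
          = (1 + 0 * q n) * t powr (q n - 1) - (1 + 0 * 0) * t powr (0 - 1)"
        using t q[of n] by (simp add: powr_minus inverse_eq_divide)
      ultimately show ?thesis unfolding el_def[abs_def] e_def by simp
    qed
    show "\<forall>\<^sub>F n in sequentially. \<forall>t\<in>{a'..b'}. \<bar>(1 + 0 * q n) * t powr (q n - 1) - (1 + 0 * 0) * t powr (0 - 1)\<bar> \<le> \<epsilon>"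
      if "0 < \<epsilon>" for \<epsilon> by (rule powr_uniform_in_exponent[OF a' q0 that])
    show "el n 1 = 0" for n by (simp add: el_def e_def)
  qed (rule one)
  then have "(\<lambda>n. H.nrm (\<lambda>x. e n (F x) - ln (F x))) \<longlonglongrightarrow> 0" by (simp add: el_def)
  then have "(\<lambda>n. L2_norm M (\<lambda>x. e n (F x) - ln (F x))) \<longlonglongrightarrow> 0"
    by (rule form_tendsto_diag(1)[OF eD lnD])
  then have "(\<lambda>n. L2_inner M G (\<lambda>x. e n (F x))) \<longlonglongrightarrow> L2_inner M G (\<lambda>x. ln (F x))"
    by (intro L2.B_tendsto D_L2 eD lnD G) (simp add: L2_norm_eq)
  then have lhs: "(\<lambda>n. - L2_inner M G (\<lambda>x. e n (F x))) \<longlonglongrightarrow> - L2_inner M G (\<lambda>x. ln (F x))"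
    by (rule tendsto_minus)
  \<comment> \<open>The energies of \<open>F powr ((1 + q) / 2)\<close> tend to that of the square root.\<close>
  define r where "r n = (1 + q n) / 2" for n
  define d where "d n t = t powr r n - t powr (1/2)" for n t
  have r0: "r \<longlonglongrightarrow> 1 / 2" using qh by (simp add: r_def[abs_def])
  have dD': "(\<lambda>x. d n (F x)) \<in> D" for n unfolding d_def by (rule dom_diff[OF pD pD])
  have "(\<lambda>n. H.nrm (\<lambda>x. d n (F x))) \<longlonglongrightarrow> 0"
  proof (rule form_small_compose[OF F ab' _ _ dD'])
    show "d n \<in> borel_measurable borel" for n unfolding d_def by measurable
    show "(d n has_real_derivative (0 + 1 * r n) * t powr (r n - 1) - (0 + 1 * (1/2)) * t powr (1/2 - 1)) (at t)"
      if "t \<in> {a'..b'}" for n t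
    proof -
      have t: "0 < t" using that a' by auto
      show ?thesis unfolding d_def[abs_def]
        using DERIV_diff[OF powr_derivative2(1)[OF t, of "r n"] powr_derivative2(1)[OF t, of "1/2"]] by simp
    qed
    show "\<forall>\<^sub>F n in sequentially. \<forall>t\<in>{a'..b'}. \<bar>(0 + 1 * r n) * t powr (r n - 1) - (0 + 1 * (1/2)) * t powr (1/2 - 1)\<bar> \<le> \<epsilon>"
      if "0 < \<epsilon>" for \<epsilon> by (rule powr_uniform_in_exponent[OF a' r0 that])
    show "d n 1 = 0" for n by (simp add: d_def)
  qed (rule one)
  then have "(\<lambda>n. H.nrm (\<lambda>x. F x powr r n - F x powr (1/2))) \<longlonglongrightarrow> 0" by (simp add: d_def)
  then have "(\<lambda>n. \<E> (\<lambda>x. F x powr r n) (\<lambda>x. F x powr r n)) \<longlonglongrightarrow> \<E> (\<lambda>x. F x powr (1/2)) (\<lambda>x. F x powr (1/2))"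
    by (rule form_tendsto_diag(2)[OF pD pD])
  then have "(\<lambda>n. 4 / (1 + q n)\<^sup>2 * \<E> (\<lambda>x. F x powr r n) (\<lambda>x. F x powr r n))
      \<longlonglongrightarrow> 4 / (1 + 0)\<^sup>2 * \<E> (\<lambda>x. F x powr (1/2)) (\<lambda>x. F x powr (1/2))"
    by (intro tendsto_intros q0) auto
  moreover have "4 / (1 + q n)\<^sup>2 * \<E> (\<lambda>x. F x powr r n) (\<lambda>x. F x powr r n) = - L2_inner M G (\<lambda>x. e n (F x))" for n
  proof -
    have "\<E> (\<lambda>x. F x powr q n) F = 4 * q n / (1 + q n)\<^sup>2 * \<E> (\<lambda>x. F x powr r n) (\<lambda>x. F x powr r n)"
      using pid dom bd up q[of n] unfolding power_identity_def r_def by blast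
    then have 1: "4 / (1 + q n)\<^sup>2 * \<E> (\<lambda>x. F x powr r n) (\<lambda>x. F x powr r n) = 1 / q n * \<E> (\<lambda>x. F x powr q n) F"
      using q[of n] by simp
    have "L2_inner M G (\<lambda>x. 1 / q n * F x powr q n + (- (1 / q n)) * 1) = 1 / q n * L2_inner M G (\<lambda>x. F x powr q n)"
      using L2.B_comb_right[OF D_L2[OF pD[of "q n"]] L2_const[of 1] G, of "1 / q n" "- (1 / q n)"] mean0
      by (simp add: L2_inner_const_right)
    then have "L2_inner M G (\<lambda>x. e n (F x)) = 1 / q n * L2_inner M G (\<lambda>x. F x powr q n)"
      by (simp add: e_def diff_divide_distrib)
    then show ?thesis unfolding 1 EG[OF pD] using L2.B_commute[OF D_L2[OF pD[of "q n"]] G] by simp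
  qed
  ultimately have "- L2_inner M G (\<lambda>x. ln (F x)) = 4 * \<E> (\<lambda>x. F x powr (1/2)) (\<lambda>x. F x powr (1/2))"
    using LIMSEQ_unique[OF lhs] by simp
  moreover have "\<E> (\<lambda>x. dPhi 2 (F x)) F = - L2_inner M G (\<lambda>x. ln (F x)) / 2"
  proof -
    have "L2_inner M G (\<lambda>x. 1/2 * ln (F x) + 1/2 * 1) = 1/2 * L2_inner M G (\<lambda>x. ln (F x))"
      using L2.B_comb_right[OF D_L2[OF lnD] L2_const[of 1] G, of "1/2" "1/2"] mean0
      by (simp add: L2_inner_const_right)
    then have "L2_inner M G (\<lambda>x. dPhi 2 (F x)) = L2_inner M G (\<lambda>x. ln (F x)) / 2"
      by (simp add: dPhi_def add_divide_distrib)
    then show ?thesis using EG[OF dD] L2.B_commute[OF D_L2[OF dD] G] by simp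
  qed
  ultimately show ?thesis by simp
qed

lemma power_identity_dissipation:
  assumes pid: "power_identity M \<E> P" and p: "1 \<le> p" "p \<le> 2" and gen: "generates M P F G"
    and ab: "AE x in M. a \<le> F x \<and> F x \<le> b" and a: "0 < a"
  shows "\<E> (\<lambda>x. dPhi p (F x)) F = 2 * \<E> (\<lambda>x. F x powr (1 / p)) (\<lambda>x. F x powr (1 / p))"
proof (cases "p = 2")
  case True
  show ?thesis unfolding True by (rule power_identity_entropy[OF pid gen ab a])
next
  case False
  define q where "q = 2 / p - 1"
  have q: "0 < q" "(1 + q) / 2 = 1 / p" using p False by (auto simp: q_def field_simps)
  have F: "F \<in> D" using gen by (simp add: generates_iff)
  have dom: "F \<in> generator_domain M P" using gen by (auto simp: generator_domain_def)
  have bd: "ess_bounded M F" unfolding ess_bounded_def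
    by (rule exI[of _ b]) (use ab in \<open>eventually_elim, use a in auto\<close>)
  have up: "uniformly_positive M F" unfolding uniformly_positive_def
    using ab a by (intro exI[of _ a]) (auto elim: eventually_mono)
  have "\<E> (\<lambda>x. F x powr q) F = 4 * q / (1 + q)\<^sup>2 * \<E> (\<lambda>x. F x powr (1 / p)) (\<lambda>x. F x powr (1 / p))"
    using pid dom bd up q(1) unfolding power_identity_def q(2)[symmetric] by blast
  moreover have "\<E> (\<lambda>x. dPhi p (F x)) F = 2 / (p * (2 - p)) * \<E> (\<lambda>x. F x powr q) F"
    unfolding dPhi_def using False form_scale_left[OF powr_D[OF F ab a, of q] F, of "2 / (p * (2 - p))"]
    by (simp only: if_False q_def)
  moreover have "2 / (p * (2 - p)) * (4 * q / (1 + q)\<^sup>2) = 2"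
  proof -
    have 1: "1 + q = 2 / p" "q = (2 - p) / p" using p by (simp_all add: q_def diff_divide_distrib)
    have "4 * q / (1 + q)\<^sup>2 = p * (2 - p)" using p False unfolding 1 by (simp add: power2_eq_square field_simps)
    then show ?thesis using p False by simp
  qed
  ultimately show ?thesis by (metis mult.assoc)
qed

text \<open>This is the inequality of Stroock and Varopoulos.\<close>

lemma symmetric_dissipation:
  assumes sym: "symmetric_semigroup M P" and p: "1 \<le> p" "p \<le> 2" and F: "F \<in> D"
    and ab: "AE x in M. a \<le> F x \<and> F x \<le> b" and a: "0 < a"
  shows "2 * \<E> (\<lambda>x. F x powr (1 / p)) (\<lambda>x. F x powr (1 / p)) \<le> \<E> (\<lambda>x. dPhi p (F x)) F"
proof -
  obtain L where L: "\<And>s t. \<lbrakk>s \<in> {a..b}; t \<in> {a..b}\<rbrakk> \<Longrightarrow> \<bar>dPhi p s - dPhi p t\<bar> \<le> L * \<bar>s - t\<bar>"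
    using dPhi_lipschitz[OF p a, of b] by blast
  obtain L' where L': "\<And>s t. \<lbrakk>s \<in> {a..b}; t \<in> {a..b}\<rbrakk> \<Longrightarrow> \<bar>s powr (1 / p) - t powr (1 / p)\<bar> \<le> L' * \<bar>s - t\<bar>"
    using powr_lipschitz[OF a, of b "1 / p"] by blast
  show ?thesis
    by (rule symmetric_form_inequality[OF sym F ab Phi_measurable(2) L _ L' dPhi_powr_inequality[OF p]])
      (use a in auto)
qed

end

section \<open>The two implications\<close>

context associated_form
begin

text \<open>Multiplied by \<open>exp (2 t / \<alpha> s)\<close>, the quantity to be bounded is nonincreasing: its derivative is controlled
  by the weak inequality for \<open>F powr (1 / p)\<close> with \<open>F = P u g\<close>, whose range lies in that of
  \<open>g powr (1 / p)\<close>.\<close>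

lemma weak_inequality_decay_generator:
  assumes W: "weak_inequality M D \<E> p \<alpha>" and p: "1 \<le> p" "p \<le> 2" and \<alpha>: "0 < \<alpha> s" and s: "0 < s"
    and diss: "\<And>F G. \<lbrakk>generates M P F G; AE x in M. a \<le> F x \<and> F x \<le> b\<rbrakk>
      \<Longrightarrow> 2 * \<E> (\<lambda>x. F x powr (1 / p)) (\<lambda>x. F x powr (1 / p)) \<le> \<E> (\<lambda>x. dPhi p (F x)) F"
    and gen: "generates M P g g'" and ab: "AE x in M. a \<le> g x \<and> g x \<le> b" and a: "0 < a"
    and Om: "b powr (1 / p) - a powr (1 / p) \<le> Om" and t: "0 \<le> t"
  shows "Psi M p (\<lambda>x. P t g x powr (1 / p)) - s * Om\<^sup>2
    \<le> exp (- (2 * t / \<alpha> s)) * (Psi M p (\<lambda>x. g x powr (1 / p)) - s * Om\<^sup>2)"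
proof -
  have g: "g \<in> L2_space M" using gen by (simp add: generates_def)
  define k where "k = 2 / \<alpha> s"
  define Y where "Y u = Psi M p (\<lambda>x. P u g x powr (1 / p)) - s * Om\<^sup>2" for u
  define I where "I u = \<E> (\<lambda>x. dPhi p (P u g x)) (P u g)" for u
  define z where "z u = exp (k * u) * Y u" for u
  have dz: "(z has_real_derivative exp (k * u) * (k * Y u - I u)) (at u within {0..})" if u: "0 \<le> u" for u
  proof -
    have "(Y has_real_derivative - I u - 0) (at u within {0..})"
      unfolding Y_def[abs_def] I_def
      by (intro DERIV_diff Psi_orbit_derivative[OF p gen ab a u] DERIV_const)
    then show ?thesis unfolding z_def[abs_def]
      by (auto intro!: derivative_eq_intros simp: algebra_simps)
  qed
  have neg: "k * Y u - I u \<le> 0" if u: "0 \<le> u" for u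
  proof -
    define F where "F = P u g"
    have F: "generates M P F (P u g')" unfolding F_def by (rule generates_P[OF gen u])
    have Fab: "AE x in M. a \<le> F x \<and> F x \<le> b" unfolding F_def by (rule P_between[OF u g ab])
    have FD: "F \<in> D" using F by (simp add: generates_iff)
    define \<psi> where "\<psi> = (\<lambda>x. F x powr (1 / p))"
    have \<psi>D: "\<psi> \<in> D" unfolding \<psi>_def by (rule powr_D[OF FD Fab a])
    have \<psi>ab: "AE x in M. a powr (1 / p) \<le> \<psi> x \<and> \<psi> x \<le> b powr (1 / p)"
      using Fab by eventually_elim (use a p in \<open>auto simp: \<psi>_def intro!: powr_mono2\<close>)
    have nn: "ess_nonneg M \<psi>" by (simp add: ess_nonneg_def \<psi>_def)
    have bd: "ess_bounded M \<psi>" unfolding ess_bounded_def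
      by (rule exI[of _ "b powr (1 / p)"]) (use \<psi>ab in \<open>eventually_elim, auto simp: \<psi>_def\<close>)
    have osc: "(Osc M \<psi>)\<^sup>2 \<le> Om\<^sup>2"
      using Osc_bounds[OF D_meas[OF \<psi>D] \<psi>ab] Om by (intro power_mono) auto
    have "Psi M p \<psi> \<le> \<alpha> s * \<E> \<psi> \<psi> + s * (Osc M \<psi>)\<^sup>2"
      using W \<psi>D bd nn s unfolding weak_inequality_def by blast
    moreover have "s * (Osc M \<psi>)\<^sup>2 \<le> s * Om\<^sup>2" using osc s by (intro mult_left_mono) auto
    ultimately have "Y u \<le> \<alpha> s * \<E> \<psi> \<psi>" unfolding Y_def \<psi>_def F_def by linarith
    then have "k * Y u \<le> k * (\<alpha> s * \<E> \<psi> \<psi>)" using \<alpha> by (intro mult_left_mono) (auto simp: k_def)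
    also have "\<dots> = 2 * \<E> \<psi> \<psi>" using \<alpha> by (simp add: k_def)
    also have "\<dots> \<le> I u" using diss[OF F Fab] by (simp add: \<psi>_def I_def F_def)
    finally show ?thesis by simp
  qed
  have "z t \<le> z 0"
  proof (rule DERIV_nonpos_imp_decreasing_open[of 0 t z])
    show "0 \<le> t" by fact
    have "continuous_on {0..} z"
      by (rule DERIV_continuous_on, rule dz) simp
    then show "continuous_on {0..t} z" by (rule continuous_on_subset) auto
    fix u assume u: "0 < u" "u < t"
    have "at u within {0..} = at u" by (rule at_within_interior) (use u in simp)
    then have "(z has_real_derivative exp (k * u) * (k * Y u - I u)) (at u)"
      using dz[of u] u by simp
    moreover have "exp (k * u) * (k * Y u - I u) \<le> 0"
      using neg[of u] u by (simp add: mult_nonneg_nonpos)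
    ultimately show "\<exists>y. (z has_real_derivative y) (at u) \<and> y \<le> 0" by blast
  qed
  then have "exp (- (k * t)) * (exp (k * t) * Y t) \<le> exp (- (k * t)) * Y 0"
    by (intro mult_left_mono) (auto simp: z_def)
  then have "Y t \<le> exp (- (k * t)) * Y 0" by (simp add: mult.assoc[symmetric] flip: exp_add)
  moreover have "Psi M p (\<lambda>x. P 0 g x powr (1 / p)) = Psi M p (\<lambda>x. g x powr (1 / p))"
  proof (rule Psi_cong_AE)
    show "(\<lambda>x. P 0 g x powr (1 / p)) \<in> borel_measurable M" "(\<lambda>x. g x powr (1 / p)) \<in> borel_measurable M"
      using P_meas[OF order_refl g] L2_spaceD(1)[OF g] by measurable
  qed (use P_zero[OF g] in \<open>eventually_elim, simp\<close>)
  ultimately show ?thesis by (simp add: Y_def k_def)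
qed

text \<open>Apply the preceding lemma to \<open>R f + \<delta>\<close> and let \<open>R f \<rightarrow> f\<close> and \<open>\<delta> \<rightarrow> 0\<close> in \<open>L\<^sup>2\<close>. Markov operators keep
  the bounds of \<open>f\<close>, and by \<open>powr_shift_difference\<close> the shift does not increase the distance between the
  \<open>p\<close>-th roots of the bounds.\<close>

lemma weak_inequality_imp_decay:
  assumes W: "weak_inequality M D \<E> p \<alpha>" and p: "1 \<le> p" "p \<le> 2" and \<alpha>: "\<And>r. 0 < r \<Longrightarrow> 0 < \<alpha> r"
    and diss: "\<And>F G a b. \<lbrakk>generates M P F G; AE x in M. a \<le> F x \<and> F x \<le> b; 0 < a\<rbrakk>
      \<Longrightarrow> 2 * \<E> (\<lambda>x. F x powr (1 / p)) (\<lambda>x. F x powr (1 / p)) \<le> \<E> (\<lambda>x. dPhi p (F x)) F"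
  shows "semigroup_decay M D P p \<alpha>"
  unfolding semigroup_decay_def
proof (intro ballI impI allI)
  fix f :: "'a \<Rightarrow> real" and t s :: real
  assume fD: "f \<in> D" and "ess_bounded M f" "ess_nonneg M f" and t: "0 \<le> t" and s: "0 < s"
  then obtain K where K: "AE x in M. \<bar>f x\<bar> \<le> K" and f0: "AE x in M. 0 \<le> f x"
    by (auto simp: ess_bounded_def ess_nonneg_def)
  note fL = D_L2[OF fD]
  define h where "h = (\<lambda>x. f x powr (1 / p))"
  have hm: "h \<in> borel_measurable M" unfolding h_def using D_meas[OF fD] by measurable
  have hK: "AE x in M. 0 \<le> h x \<and> h x \<le> K powr (1 / p)"
    using K f0 by eventually_elim (use p in \<open>auto simp: h_def intro!: powr_mono2\<close>)
  obtain c d where cd: "AE x in M. c \<le> h x \<and> h x \<le> d" "Osc M h = d - c" "c \<le> d" "0 \<le> c"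
    using Osc_attained[OF hm hK] by blast
  define A where "A = c powr p"
  define B where "B = d powr p"
  have AB: "0 \<le> A" "A \<le> B" "A powr (1 / p) = c" "B powr (1 / p) = d"
    using cd p by (auto simp: A_def B_def powr_powr intro!: powr_mono2)
  have fAB: "AE x in M. A \<le> f x \<and> f x \<le> B"
    using cd(1) f0
  proof eventually_elim
    fix x assume h: "c \<le> h x \<and> h x \<le> d" and f: "0 \<le> f x"
    have "f x = h x powr p" using f p by (simp add: h_def powr_powr)
    then show "A \<le> f x \<and> f x \<le> B" using h cd p by (auto simp: A_def B_def intro!: powr_mono2)
  qed
  define \<delta> where "\<delta> n = 1 / (real n + 1)" for n
  have \<delta>: "0 < \<delta> n" "\<delta> n \<le> 1" for n by (auto simp: \<delta>_def)
  have \<delta>0: "\<delta> \<longlonglongrightarrow> 0" using LIMSEQ_inverse_real_of_nat by (simp add: \<delta>_def[abs_def] inverse_eq_divide add.commute)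
  have \<beta>: "1 \<le> real n + 1" for n by simp
  define g where "g n = (\<lambda>x. 1 * R (real n + 1) f x + \<delta> n * 1)" for n
  have gen: "\<exists>g'. generates M P (g n) g'" for n
    unfolding g_def using generates_comb[OF R_generates[OF \<beta> fL] generates_one] by blast
  have gL: "g n \<in> L2_space M" for n using gen[of n] by (auto simp: generates_def)
  have gAB: "AE x in M. A + \<delta> n \<le> g n x \<and> g n x \<le> B + \<delta> n" for n
    using R_between[OF \<beta> fL fAB, of n] by eventually_elim (simp add: g_def)
  have main: "Psi M p (\<lambda>x. P t (g n) x powr (1 / p)) - s * (Osc M h)\<^sup>2
      \<le> exp (- (2 * t / \<alpha> s)) * (Psi M p (\<lambda>x. g n x powr (1 / p)) - s * (Osc M h)\<^sup>2)" for n
  proof -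
    obtain g' where g': "generates M P (g n) g'" using gen by blast
    have pos: "0 < A + \<delta> n" using AB(1) \<delta>(1)[of n] by linarith
    have "(B + \<delta> n) powr (1 / p) - (A + \<delta> n) powr (1 / p) \<le> B powr (1 / p) - A powr (1 / p)"
      using AB p less_imp_le[OF \<delta>(1)] by (intro powr_shift_difference) auto
    then have Om: "(B + \<delta> n) powr (1 / p) - (A + \<delta> n) powr (1 / p) \<le> Osc M h" using AB cd(2) by simp
    show ?thesis
      by (rule weak_inequality_decay_generator[OF W p \<alpha>[OF s] s diss g' gAB pos Om t, OF _ _ pos])
  qed
  have glim: "(\<lambda>n. L2_norm M (\<lambda>x. g n x - f x)) \<longlonglongrightarrow> 0"
  proof (rule Lim_null_comparison)
    show "(\<lambda>n. L2_norm M (\<lambda>x. f x - R (real n + 1) f x) + \<delta> n) \<longlonglongrightarrow> 0"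
      using tendsto_add[OF R_tendsto_L2[OF fL] \<delta>0] by simp
    have "L2_norm M (\<lambda>x. g n x - f x) \<le> L2_norm M (\<lambda>x. f x - R (real n + 1) f x) + \<delta> n" for n
    proof -
      have "L2_norm M (\<lambda>x. (R (real n + 1) f x - f x) + \<delta> n)
          \<le> L2_norm M (\<lambda>x. R (real n + 1) f x - f x) + L2_norm M (\<lambda>x. \<delta> n)"
        using L2.nrm_triangle[OF L2.V_diff[OF R_L2[OF \<beta> fL] fL] L2_const[of "\<delta> n"]] by (simp add: L2_norm_eq)
      moreover have "(\<lambda>x. (R (real n + 1) f x - f x) + \<delta> n) = (\<lambda>x. g n x - f x)" by (simp add: g_def fun_eq_iff)
      ultimately show ?thesis
        using L2.nrm_minus_commute[OF R_L2[OF \<beta>[of n] fL] fL] \<delta>(1)[of n] by (simp add: L2_norm_eq L2_norm_const)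
    qed
    then show "\<forall>\<^sub>F n in sequentially. norm (L2_norm M (\<lambda>x. g n x - f x))
        \<le> L2_norm M (\<lambda>x. f x - R (real n + 1) f x) + \<delta> n"
      using L2.nrm_nonneg[OF L2.V_diff[OF gL fL]] by (simp add: L2_norm_eq)
  qed
  have Pglim: "(\<lambda>n. L2_norm M (\<lambda>x. P t (g n) x - P t f x)) \<longlonglongrightarrow> 0"
    by (rule Lim_null_comparison[OF _ glim])
      (use P_dist[OF t gL fL] L2.nrm_nonneg[OF L2.V_diff[OF P_L2[OF t gL] P_L2[OF t fL]]]
        in \<open>simp add: L2_norm_eq\<close>)
  have g01: "AE x in M. 0 \<le> g n x \<and> g n x \<le> B + 1" for n
    using gAB[of n] by eventually_elim (use AB(1) \<delta>[of n] in linarith)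
  have f01: "AE x in M. 0 \<le> f x \<and> f x \<le> B + 1"
    using fAB by eventually_elim (use AB(1) in linarith)
  have l1: "(\<lambda>n. Psi M p (\<lambda>x. P t (g n) x powr (1 / p)) - s * (Osc M h)\<^sup>2)
      \<longlonglongrightarrow> Psi M p (\<lambda>x. P t f x powr (1 / p)) - s * (Osc M h)\<^sup>2"
    by (intro tendsto_intros Psi_tendsto[OF p P_L2[OF t gL] P_between[OF t gL g01] P_L2[OF t fL] P_between[OF t fL f01] Pglim])
  have l2: "(\<lambda>n. exp (- (2 * t / \<alpha> s)) * (Psi M p (\<lambda>x. g n x powr (1 / p)) - s * (Osc M h)\<^sup>2))
      \<longlonglongrightarrow> exp (- (2 * t / \<alpha> s)) * (Psi M p (\<lambda>x. f x powr (1 / p)) - s * (Osc M h)\<^sup>2)"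
    by (intro tendsto_mult tendsto_diff tendsto_const Psi_tendsto[OF p gL g01 fL f01 glim])
  have "Psi M p (\<lambda>x. P t f x powr (1 / p)) - s * (Osc M h)\<^sup>2
      \<le> exp (- (2 * t / \<alpha> s)) * (Psi M p (\<lambda>x. f x powr (1 / p)) - s * (Osc M h)\<^sup>2)"
    by (rule LIMSEQ_le[OF l1 l2]) (use main in blast)
  then show "Psi M p (\<lambda>x. P t f x powr (1 / p)) - s * (Osc M (\<lambda>x. f x powr (1 / p)))\<^sup>2
      \<le> exp (- (2 * t / \<alpha> s)) * (Psi M p (\<lambda>x. f x powr (1 / p)) - s * (Osc M (\<lambda>x. f x powr (1 / p)))\<^sup>2)"
    by (simp add: h_def)
qed

text \<open>Both sides of the decay agree at time 0, so their derivatives there are ordered. Constant functions are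
  excluded from the decay, but for them the left-hand side vanishes.\<close>

lemma decay_imp_inequality_generator:
  assumes S: "semigroup_decay M D P p \<alpha>" and p: "1 \<le> p" "p \<le> 2" and \<alpha>: "0 < \<alpha> s" and s: "0 < s"
    and gen: "generates M P g g'" and ab: "AE x in M. a \<le> g x \<and> g x \<le> b" and a: "0 < a"
    and diss: "\<E> (\<lambda>x. dPhi p (g x)) g \<le> 2 * \<E> (\<lambda>x. g x powr (1 / p)) (\<lambda>x. g x powr (1 / p))"
  shows "Psi M p (\<lambda>x. g x powr (1 / p)) \<le> \<alpha> s * \<E> (\<lambda>x. g x powr (1 / p)) (\<lambda>x. g x powr (1 / p))
    + s * (Osc M (\<lambda>x. g x powr (1 / p)))\<^sup>2"
proof -
  have g: "g \<in> L2_space M" and gD: "g \<in> D" using gen by (auto simp: generates_iff D_L2)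
  note gm = D_meas[OF gD]
  note \<psi>D = powr_D[OF gD ab a, of "1 / p"]
  show ?thesis
  proof (cases "ess_constant M g")
    case True
    then obtain c where c: "AE x in M. g x = c" by (auto simp: ess_constant_def)
    have "AE x in M. a \<le> c \<and> c \<le> b" using ab c by eventually_elim simp
    then have "0 \<le> c" using a AE_interval_nonempty[of a "\<lambda>x. c" c] by (auto elim: eventually_mono)
    then have "Psi M p (\<lambda>x. g x powr (1 / p)) = 0" by (rule Psi_const[OF p gm _ c])
    then show ?thesis using form_nonneg[OF \<psi>D] \<alpha> s by simp
  next
    case False
    have nn: "ess_nonneg M g" unfolding ess_nonneg_def using ab by eventually_elim (use a in linarith)
    have bd: "ess_bounded M g" unfolding ess_bounded_def
      by (rule exI[of _ b]) (use ab in \<open>eventually_elim, use a in auto\<close>)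
    define Om where "Om = Osc M (\<lambda>x. g x powr (1 / p))"
    define Y where "Y u = Psi M p (\<lambda>x. P u g x powr (1 / p)) - s * Om\<^sup>2" for u
    define Y0 where "Y0 = Psi M p (\<lambda>x. g x powr (1 / p)) - s * Om\<^sup>2"
    define k where "k = 2 / \<alpha> s"
    define I where "I = \<E> (\<lambda>x. dPhi p (g x)) g"
    have SY: "Y u \<le> exp (- (k * u)) * Y0" if "0 \<le> u" for u
      using S gD bd nn False that s unfolding semigroup_decay_def Y_def Y0_def k_def Om_def by force
    have P0: "AE x in M. P 0 g x = g x" by (rule P_zero[OF g])
    have P0g: "generates M P (P 0 g) (P 0 g')" by (rule generates_P[OF gen]) simp
    then have P0D: "P 0 g \<in> D" by (simp add: generates_iff)
    have "Y 0 = Y0"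
    proof -
      have "Psi M p (\<lambda>x. P 0 g x powr (1 / p)) = Psi M p (\<lambda>x. g x powr (1 / p))"
      proof (rule Psi_cong_AE)
        show "(\<lambda>x. P 0 g x powr (1 / p)) \<in> borel_measurable M" "(\<lambda>x. g x powr (1 / p)) \<in> borel_measurable M"
          using D_meas[OF P0D] gm by measurable
      qed (use P0 in \<open>eventually_elim, simp\<close>)
      then show ?thesis by (simp add: Y_def Y0_def)
    qed
    have dD: "(\<lambda>x. dPhi p (v x)) \<in> D" if v: "v \<in> D" "AE x in M. a \<le> v x \<and> v x \<le> b" for v
    proof -
      obtain L where L: "\<And>s t. \<lbrakk>s \<in> {a..b}; t \<in> {a..b}\<rbrakk> \<Longrightarrow> \<bar>dPhi p s - dPhi p t\<bar> \<le> L * \<bar>s - t\<bar>"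
        using dPhi_lipschitz[OF p a, of b] by blast
      show ?thesis by (rule form_contraction(1)[OF v Phi_measurable(2) L])
    qed
    have P0ab: "AE x in M. a \<le> P 0 g x \<and> P 0 g x \<le> b" using P0 ab by eventually_elim simp
    have "\<E> (\<lambda>x. dPhi p (P 0 g x)) (P 0 g) = I" unfolding I_def
      by (rule form_AE[OF dD[OF P0D P0ab] dD[OF gD ab] P0D gD]) (use P0 in \<open>eventually_elim, simp\<close>)+
    then have "((\<lambda>u. Psi M p (\<lambda>x. P u g x powr (1 / p))) has_real_derivative - I) (at 0 within {0..})"
      using Psi_orbit_derivative[OF p gen ab a order_refl] by simp
    then have "(Y has_real_derivative - I - 0) (at 0 within {0..})"
      unfolding Y_def[abs_def] by (intro DERIV_diff DERIV_const)
    then have "((\<lambda>u. exp (- (k * u)) * Y0 - Y u) has_real_derivative (I - k * Y0)) (at 0 within {0..})"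
      by (auto intro!: derivative_eq_intros)
    then have lim: "((\<lambda>u. (exp (- (k * u)) * Y0 - Y u - (exp (- (k * 0)) * Y0 - Y 0)) / (u - 0))
        \<longlongrightarrow> I - k * Y0) (at 0 within {0..})"
      unfolding has_field_derivative_iff .
    have "0 \<le> I - k * Y0"
    proof (rule tendsto_lowerbound[OF lim])
      show "\<forall>\<^sub>F u in at 0 within {0..}. 0 \<le> (exp (- (k * u)) * Y0 - Y u - (exp (- (k * 0)) * Y0 - Y 0)) / (u - 0)"
        unfolding eventually_at_filter
        by (rule always_eventually) (use SY \<open>Y 0 = Y0\<close> in auto)
      have "at (0::real) within {0..} = at_right 0"
        by (simp add: at_within_def) (rule arg_cong[where f="\<lambda>S. inf (nhds 0) (principal S)"], auto)
      then show "at (0::real) within {0..} \<noteq> bot" by simp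
    qed
    then have "k * Y0 \<le> 2 * \<E> (\<lambda>x. g x powr (1 / p)) (\<lambda>x. g x powr (1 / p))" using diss by (simp add: I_def)
    then have "Y0 \<le> \<alpha> s * \<E> (\<lambda>x. g x powr (1 / p)) (\<lambda>x. g x powr (1 / p))"
      using \<alpha> by (simp add: k_def field_simps)
    then show ?thesis by (simp add: Y0_def Om_def)
  qed
qed

text \<open>The preceding lemma applies to \<open>R g\<close> with \<open>g = (f + \<delta>) powr p\<close>. Here \<open>R g\<close> tends to \<open>g\<close> in the form norm,
  so the energy of \<open>(R g) powr (1 / p)\<close> tends to that of \<open>f + \<delta>\<close>, which is at most the energy of \<open>f\<close>. The
  shift makes \<open>g\<close> uniformly positive; at the end it tends to 0.\<close>

lemma decay_imp_weak_inequality: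
  assumes S: "semigroup_decay M D P p \<alpha>" and p: "1 \<le> p" "p \<le> 2" and \<alpha>: "\<And>r. 0 < r \<Longrightarrow> 0 < \<alpha> r"
    and diss: "\<And>F G a b. \<lbrakk>generates M P F G; AE x in M. a \<le> F x \<and> F x \<le> b; 0 < a\<rbrakk>
      \<Longrightarrow> \<E> (\<lambda>x. dPhi p (F x)) F \<le> 2 * \<E> (\<lambda>x. F x powr (1 / p)) (\<lambda>x. F x powr (1 / p))"
  shows "weak_inequality M D \<E> p \<alpha>"
  unfolding weak_inequality_def
proof (intro ballI impI allI)
  fix f :: "'a \<Rightarrow> real" and s :: real
  assume fD: "f \<in> D" and "ess_bounded M f" "ess_nonneg M f" and s: "0 < s"
  then obtain K where K: "AE x in M. \<bar>f x\<bar> \<le> K" and f0: "AE x in M. 0 \<le> f x"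
    by (auto simp: ess_bounded_def ess_nonneg_def)
  note fL = D_L2[OF fD] and fm = D_meas[OF fD]
  have fK: "AE x in M. 0 \<le> f x \<and> f x \<le> K" using K f0 by eventually_elim auto
  obtain c d where cd: "AE x in M. c \<le> f x \<and> f x \<le> d" "Osc M f = d - c" "c \<le> d" "0 \<le> c"
    using Osc_attained[OF fm fK] by blast
  have step: "Psi M p (\<lambda>x. ((f x + \<delta>) powr p) powr (1 / p)) \<le> \<alpha> s * \<E> f f + s * (Osc M f)\<^sup>2"
    if \<delta>: "0 < \<delta>" for \<delta>
  proof -
    define u where "u = (\<lambda>x. f x + \<delta>)"
    define a where "a = c + \<delta>"
    define b where "b = d + \<delta>"
    have a: "0 < a" and ab: "a \<le> b" using cd \<delta> by (auto simp: a_def b_def)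
    have uD: "u \<in> D" unfolding u_def by (rule dom_add[OF fD const_D])
    have uab: "AE x in M. a \<le> u x \<and> u x \<le> b" using cd(1) by eventually_elim (simp add: u_def a_def b_def)
    have uE: "\<E> u u \<le> \<E> f f"
      using form_contraction(2)[OF fD cd(1), of "\<lambda>t. t + \<delta>" 1] by (simp add: u_def)
    define g where "g = (\<lambda>x. u x powr p)"
    define A where "A = a powr p"
    define B where "B = b powr p"
    have A: "0 < A" using a by (simp add: A_def)
    have AB: "A powr (1 / p) = a" "B powr (1 / p) = b" using a ab p by (auto simp: A_def B_def powr_powr)
    have gD: "g \<in> D" unfolding g_def by (rule powr_D[OF uD uab a])
    note gL = D_L2[OF gD]
    have gAB: "AE x in M. A \<le> g x \<and> g x \<le> B"
      using uab by eventually_elim (use a p in \<open>auto simp: g_def A_def B_def intro!: powr_mono2\<close>)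
    have \<beta>: "1 \<le> real n + 1" for n by simp
    define G where "G n = R (real n + 1) g" for n
    have Ggen: "\<exists>G'. generates M P (G n) G'" for n unfolding G_def using R_generates[OF \<beta> gL] by blast
    have GD: "G n \<in> D" for n unfolding G_def by (rule R_D[OF \<beta> gL])
    have GAB: "AE x in M. A \<le> G n x \<and> G n x \<le> B" for n unfolding G_def by (rule R_between[OF \<beta> gL gAB])
    have main: "Psi M p (\<lambda>x. G n x powr (1 / p))
        \<le> \<alpha> s * \<E> (\<lambda>x. G n x powr (1 / p)) (\<lambda>x. G n x powr (1 / p)) + s * (Osc M f)\<^sup>2" for n
    proof -
      obtain G' where G': "generates M P (G n) G'" using Ggen by blast
      have m: "(\<lambda>x. G n x powr (1 / p)) \<in> borel_measurable M" by (rule D_meas[OF powr_D[OF GD GAB A]])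
      have "AE x in M. a \<le> G n x powr (1 / p) \<and> G n x powr (1 / p) \<le> b"
        using GAB[of n] unfolding AB[symmetric]
        by eventually_elim (use A p in \<open>auto intro!: powr_mono2\<close>)
      then have "(Osc M (\<lambda>x. G n x powr (1 / p)))\<^sup>2 \<le> (Osc M f)\<^sup>2"
        using Osc_bounds[OF m, of a b] cd(2) by (intro power_mono) (auto simp: a_def b_def)
      then have "s * (Osc M (\<lambda>x. G n x powr (1 / p)))\<^sup>2 \<le> s * (Osc M f)\<^sup>2" using s by simp
      then show ?thesis
        using decay_imp_inequality_generator[OF S p \<alpha>[OF s] s G' GAB A diss[OF G' GAB A]] by linarith
    qed
    have Gnrm: "(\<lambda>n. H.nrm (\<lambda>x. G n x - g x)) \<longlonglongrightarrow> 0" unfolding G_def by (rule R_tendsto_form[OF gD])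
    have GL2: "(\<lambda>n. L2_norm M (\<lambda>x. G n x - g x)) \<longlonglongrightarrow> 0" by (rule form_tendsto_diag(1)[OF GD gD Gnrm])
    have "(\<lambda>n. \<E> (\<lambda>x. G n x powr (1 / p)) (\<lambda>x. G n x powr (1 / p)))
        \<longlonglongrightarrow> \<E> (\<lambda>x. g x powr (1 / p)) (\<lambda>x. g x powr (1 / p))"
      by (rule form_compose_tendsto[OF GD GAB gD gAB _ powr_derivative2(1,2)
            powr_dd_continuous[OF A, of B "1 / p"] Gnrm])
        (use A in auto)
    then have l2: "(\<lambda>n. \<alpha> s * \<E> (\<lambda>x. G n x powr (1 / p)) (\<lambda>x. G n x powr (1 / p)) + s * (Osc M f)\<^sup>2)
        \<longlonglongrightarrow> \<alpha> s * \<E> (\<lambda>x. g x powr (1 / p)) (\<lambda>x. g x powr (1 / p)) + s * (Osc M f)\<^sup>2"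
      by (intro tendsto_intros)
    have G0: "AE x in M. 0 \<le> G n x \<and> G n x \<le> B" for n using GAB[of n] by eventually_elim (use A in linarith)
    have g0: "AE x in M. 0 \<le> g x \<and> g x \<le> B" using gAB by eventually_elim (use A in linarith)
    have l1: "(\<lambda>n. Psi M p (\<lambda>x. G n x powr (1 / p))) \<longlonglongrightarrow> Psi M p (\<lambda>x. g x powr (1 / p))"
      by (rule Psi_tendsto[OF p D_L2[OF GD] G0 gL g0 GL2])
    have "Psi M p (\<lambda>x. g x powr (1 / p)) \<le> \<alpha> s * \<E> (\<lambda>x. g x powr (1 / p)) (\<lambda>x. g x powr (1 / p)) + s * (Osc M f)\<^sup>2"
      by (rule LIMSEQ_le[OF l1 l2]) (use main in blast)
    moreover have "\<E> (\<lambda>x. g x powr (1 / p)) (\<lambda>x. g x powr (1 / p)) = \<E> u u"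
    proof -
      have ae: "AE x in M. g x powr (1 / p) = u x"
        using uab by eventually_elim (use a p in \<open>simp add: g_def powr_powr\<close>)
      have "(\<lambda>x. g x powr (1 / p)) \<in> D" by (rule powr_D[OF gD gAB A])
      then show ?thesis using uD ae by (intro form_AE)
    qed
    moreover have "\<alpha> s * \<E> u u \<le> \<alpha> s * \<E> f f" using uE \<alpha>[OF s] by simp
    ultimately show ?thesis by (simp add: g_def u_def)
  qed
  define \<delta> where "\<delta> n = 1 / (real n + 1)" for n
  have \<delta>: "0 < \<delta> n" "\<delta> n \<le> 1" for n by (auto simp: \<delta>_def)
  have \<delta>0: "\<delta> \<longlonglongrightarrow> 0" using LIMSEQ_inverse_real_of_nat by (simp add: \<delta>_def[abs_def] inverse_eq_divide add.commute)
  define B where "B = (d + 1) powr p"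
  have d0: "0 \<le> d" using cd by simp
  define k where "k = p * (d + 1) powr (p - 1)"
  have k: "0 \<le> k" using p by (simp add: k_def)
  define w where "w n = (\<lambda>x. (f x + \<delta> n) powr p)" for n
  define w0 where "w0 = (\<lambda>x. f x powr p)"
  have wm: "w n \<in> borel_measurable M" "w0 \<in> borel_measurable M" for n
    unfolding w_def w0_def using fm by measurable
  have wB: "AE x in M. 0 \<le> w n x \<and> w n x \<le> B" for n
    using cd(1)
  proof eventually_elim
    fix x assume "c \<le> f x \<and> f x \<le> d"
    then show "0 \<le> w n x \<and> w n x \<le> B"
      using cd(4) \<delta>[of n] p by (auto simp: w_def B_def intro!: powr_mono2)
  qed
  have w0B: "AE x in M. 0 \<le> w0 x \<and> w0 x \<le> B"
    using cd(1) by eventually_elim (use cd(4) p in \<open>auto simp: w0_def B_def intro!: powr_mono2\<close>)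
  note wL = L2_between[OF wm(1) wB] and w0L = L2_between[OF wm(2) w0B]
  have wlim: "(\<lambda>n. L2_norm M (\<lambda>x. w n x - w0 x)) \<longlonglongrightarrow> 0"
  proof (rule Lim_null_comparison[OF _ tendsto_mult_right_zero[OF \<delta>0, of k]])
    have "L2_norm M (\<lambda>x. w n x - w0 x) \<le> \<bar>k * \<delta> n\<bar>" for n
    proof (rule L2_norm_le_bound)
      show "(\<lambda>x. w n x - w0 x) \<in> borel_measurable M" using wm by measurable
      show "AE x in M. \<bar>w n x - w0 x\<bar> \<le> k * \<delta> n"
        using cd(1)
      proof eventually_elim
        fix x assume x: "c \<le> f x \<and> f x \<le> d"
        have "(f x + \<delta> n) powr p - f x powr p \<le> p * (d + 1) powr (p - 1) * ((f x + \<delta> n) - f x)"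
          using x cd(4) \<delta>[of n] p by (intro powr_increment_le) auto
        moreover have "f x powr p \<le> (f x + \<delta> n) powr p" using x cd(4) \<delta>[of n] p by (intro powr_mono2) auto
        ultimately show "\<bar>w n x - w0 x\<bar> \<le> k * \<delta> n" by (simp add: w_def w0_def k_def)
      qed
    qed
    then show "\<forall>\<^sub>F n in sequentially. norm (L2_norm M (\<lambda>x. w n x - w0 x)) \<le> k * \<delta> n"
      using L2.nrm_nonneg[OF L2.V_diff[OF wL w0L]] k less_imp_le[OF \<delta>(1)] by (simp add: L2_norm_eq)
  qed
  have "Psi M p (\<lambda>x. w0 x powr (1 / p)) \<le> \<alpha> s * \<E> f f + s * (Osc M f)\<^sup>2"
    by (rule LIMSEQ_le_const2[OF Psi_tendsto[OF p wL wB w0L w0B wlim]])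
      (use step[OF \<delta>(1)] in \<open>auto simp: w_def\<close>)
  moreover have "Psi M p (\<lambda>x. w0 x powr (1 / p)) = Psi M p f"
  proof (rule Psi_cong_AE[OF _ fm])
    show "(\<lambda>x. w0 x powr (1 / p)) \<in> borel_measurable M" using wm(2) by measurable
    show "AE x in M. w0 x powr (1 / p) = f x"
      using f0 by eventually_elim (use p in \<open>simp add: w0_def powr_powr\<close>)
  qed
  ultimately show "Psi M p f \<le> \<alpha> s * \<E> f f + s * (Osc M f)\<^sup>2" by simp
qed

end

theorem theorem6p1:
  fixes M :: "'a measure"
    and D :: "('a \<Rightarrow> real) set"
    and \<E> :: "('a \<Rightarrow> real) \<Rightarrow> ('a \<Rightarrow> real) \<Rightarrow> real"
    and P :: "real \<Rightarrow> ('a \<Rightarrow> real) \<Rightarrow> 'a \<Rightarrow> real"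
    and p :: real
    and \<alpha> :: "real \<Rightarrow> real"
  assumes "prob_space M"
    and "dirichlet_form M D \<E>"
    and "markov_semigroup M P"
    and "associated M D \<E> P"
    and "1 \<le> p" and "p \<le> 2"
    and "\<forall>r>0. 0 < \<alpha> r"
  shows "(power_identity M \<E> P \<longrightarrow>
            (weak_inequality M D \<E> p \<alpha> \<longleftrightarrow> semigroup_decay M D P p \<alpha>))
       \<and> (symmetric_semigroup M P \<longrightarrow>
            (weak_inequality M D \<E> p \<alpha> \<longrightarrow> semigroup_decay M D P p \<alpha>))"
proof -
  interpret prob_space M by fact
  interpret dirichlet_form M D \<E> by fact
  interpret markov_semigroup M P by fact
  interpret associated_form M D \<E> P by unfold_locales fact
  have \<alpha>: "\<And>r. 0 < r \<Longrightarrow> 0 < \<alpha> r" using assms(7) by blast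
  note p = assms(5,6)
  show ?thesis
  proof (intro conjI impI iffI)
    assume pid: "power_identity M \<E> P"
    note eq = power_identity_dissipation[OF pid p]
    show "semigroup_decay M D P p \<alpha>" if "weak_inequality M D \<E> p \<alpha>"
      by (rule weak_inequality_imp_decay[OF that p \<alpha>]) (simp_all add: eq)
    show "weak_inequality M D \<E> p \<alpha>" if "semigroup_decay M D P p \<alpha>"
      by (rule decay_imp_weak_inequality[OF that p \<alpha>]) (simp_all add: eq)
  next
    assume sym: "symmetric_semigroup M P" and W: "weak_inequality M D \<E> p \<alpha>"
    show "semigroup_decay M D P p \<alpha>"
      by (rule weak_inequality_imp_decay[OF W p \<alpha> symmetric_dissipation[OF sym p]])
        (auto simp: generates_iff)
  qed
qed

end
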